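(* Let $(\hat\pi_k)$ be a sequence of probability measures on $\mathbb{N}_0$ with $\sum_{j\ge0}j\hat\pi_k(j)=1$ for all $k$, and let $(h_k)$, $(\tau_k)$ be positive sequences converging to zero. Let $$\breve\mu_k=\frac1{\tau_k}\sum_{j\ge2}(j-1)\hat\pi_k(j)\,\delta_{jh_k},$$ and for $n\ge0$, $q\ge0$ let $$\varphi^{h_k}_n(q)=\frac1{h_k}\,\mathbb{E}\big(1-e^{-h_kqX_{n,k}}\big),$$ where $(X_{n,k})_{n\ge0}$ is the Galton-Watson process with family-size distribution $\hat\pi_k$ and $X_{0,k}=1$. (i) Suppose $(\breve\mu_k)$ Lévy-converges to some finite measure $\kappa$ on $[0,\infty]$, with associated Lévy triple $(\alpha_0,\alpha_\infty,\mu)$ given by $d\kappa=\alpha_0\,d\delta_0+\alpha_\infty\,d\delta_\infty+(x\wedge1)\,d\mu(x)$. Then, as $k\to\infty$ and whenever $n\tau_k\to t$ (with $n=n_k$), $$\varphi^{h_k}_n(q)\to\varphi(q,t)\quad\text{for every }q,t\in[0,\infty), \qquad( * )$$ where $\varphi$ is the unique solution of $$\partial_t\varphi(q,t)=-\Psi(\varphi(q,t)),\qquad\varphi(q,0)=q,$$ with $$\Psi(q)=\tfrac12\alpha_0q^2+\alpha_\infty q+\int_{(0,\infty)}\frac{e^{-qx}-1+qx}{x}\,d\mu(x).$$ Moreover, $\varphi(\cdot,t)$ is a Bernstein function for each $t\ge0$ and has the form $$\varphi(q,t)=\beta_0(t)q+\beta_\infty+\int_{(0,\infty)}(1-e^{-qx})\,d\nu_t(x),$$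 where $\beta_\infty=0$, $\beta_0(t)\ge0$ and $\int_{(0,\infty)}(x\wedge1)\,d\nu_t(x)<\infty$. (ii) Conversely, suppose that for some function $\varphi$ the convergence $( * )$ holds (as $k\to\infty$, whenever $n\tau_k\to t$), and $\varphi(q_0,t_0)>0$ for some $q_0,t_0>0$. Then $(\breve\mu_k)$ Lévy-converges to some finite measure $\kappa$ on $[0,\infty]$.
   Context: $\mathbb{N}_0=\{0,1,2,\dots\}$; $\delta_x$ is the Dirac mass at $x$; $x\wedge 1=\min(x,1)$. Lévy-convergence: $(\breve\mu_k)$ Lévy-converges to a finite measure $\kappa$ on $[0,\infty]$ if $(x\wedge1)\,d\breve\mu_k(x)\to d\kappa(x)$ weak-$\star$ on $[0,\infty]$, i.e. when tested against every $g\in C([0,\infty])$. A Lévy triple is $(\alpha_0,\alpha_\infty,\mu)$ with $\alpha_0,\alpha_\infty\ge 0$ and $\mu$ a nonnegative measure on $(0,\infty)$ with $\int_{(0,\infty)}(x\wedge 1)\,d\mu(x)<\infty$. A function $f:(0,\infty)\to\mathbb{R}$ is Bernstein if it is smooth, nonnegative, and its derivative $g=f'$ is completely monotone, i.e. $(-1)^ng^{(n)}\ge0$ for all integers $n\ge0$. *)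

theory Defs
  imports "HOL-Probability.Probability"
begin

text \<open>Borel measures on the open half-line \<open>(0,\<infinity>)\<close>; the carrier space is \<open>{0<..}\<close>, so integrals
  with respect to such a measure are integrals over \<open>(0,\<infinity>)\<close>.\<close>

definition halfline_measure :: "real measure \<Rightarrow> bool" where
  "halfline_measure \<mu> \<longleftrightarrow> sets \<mu> = sets (restrict_space borel {0<..})"

definition finite_min_moment :: "real measure \<Rightarrow> bool" where
  "finite_min_moment \<mu> \<longleftrightarrow> (\<integral>\<^sup>+x. ennreal (min x 1) \<partial>\<mu>) < \<infinity>"

definition levy_triple :: "real \<Rightarrow> real \<Rightarrow> real measure \<Rightarrow> bool" where
  "levy_triple \<alpha>\<^sub>0 \<alpha>inf \<mu> \<longleftrightarrow>
     0 \<le> \<alpha>\<^sub>0 \<and> 0 \<le> \<alpha>inf \<and> halfline_measure \<mu> \<and> finite_min_moment \<mu>"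

text \<open>The compact interval \<open>[0,\<infinity>]\<close> is the type \<open>ennreal\<close> with its order topology.\<close>

definition finite_borel_measure :: "ennreal measure \<Rightarrow> bool" where
  "finite_borel_measure \<kappa> \<longleftrightarrow> sets \<kappa> = sets borel \<and> finite_measure \<kappa>"

text \<open>\<open>d\<kappa> = \<alpha>\<^sub>0 d\<delta>\<^sub>0 + \<alpha>inf d\<delta>\<^sub>\<infinity> + (x \<and> 1) d\<mu>(x)\<close> as measures on \<open>[0,\<infinity>]\<close>.\<close>

definition associated_levy_triple ::
    "ennreal measure \<Rightarrow> real \<Rightarrow> real \<Rightarrow> real measure \<Rightarrow> bool" where
  "associated_levy_triple \<kappa> \<alpha>\<^sub>0 \<alpha>inf \<mu> \<longleftrightarrow> levy_triple \<alpha>\<^sub>0 \<alpha>inf \<mu> \<and>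
     (\<forall>A \<in> sets borel. emeasure \<kappa> A =
        ennreal \<alpha>\<^sub>0 * indicator A 0 + ennreal \<alpha>inf * indicator A \<infinity>
        + (\<integral>\<^sup>+x. ennreal (min x 1) * indicator A (ennreal x) \<partial>\<mu>))"

definition levy_converges :: "(nat \<Rightarrow> real measure) \<Rightarrow> ennreal measure \<Rightarrow> bool" where
  "levy_converges m \<kappa> \<longleftrightarrow> finite_borel_measure \<kappa> \<and>
     (\<forall>g :: ennreal \<Rightarrow> real. continuous_on UNIV g \<longrightarrow>
        (\<lambda>k. \<integral>x. g (ennreal x) * min x 1 \<partial>m k) \<longlonglongrightarrow> (\<integral>x. g x \<partial>\<kappa>))"

text \<open>The measure \<open>\<tau>\<inverse> \<Sum>\<^sub>j\<^sub>\<ge>\<^sub>2 (j - 1) \<pi>(j) \<delta>\<^sub>j\<^sub>h\<close> on \<open>(0,\<infinity>)\<close>, written as the image under \<open>j \<mapsto> jh\<close> of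
  the measure on \<open>{2,3,\<dots>}\<close> with these weights; the lemma below gives the sum form.\<close>

definition breve_mu :: "nat pmf \<Rightarrow> real \<Rightarrow> real \<Rightarrow> real measure" where
  "breve_mu \<pi> h \<tau> =
     distr (density (count_space {2..}) (\<lambda>j. ennreal (1 / \<tau> * ((real j - 1) * pmf \<pi> j))))
       (restrict_space borel {0<..}) (\<lambda>j. real j * h)"

lemma emeasure_breve_mu:
  assumes "h > 0" and A: "A \<in> sets (restrict_space borel {0<..})"
  shows "emeasure (breve_mu \<pi> h \<tau>) A =
    (\<Sum>j. if 2 \<le> j then ennreal (1 / \<tau> * ((real j - 1) * pmf \<pi> j)) * indicator A (real j * h) else 0)"
proof -
  let ?w = "\<lambda>j. ennreal (1 / \<tau> * ((real j - 1) * pmf \<pi> j))"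
  have m: "(\<lambda>j. real j * h) \<in> measurable (density (count_space {2..}) ?w) (restrict_space borel {0<..})"
    using assms(1) by (auto simp: measurable_def space_restrict_space)
  have "emeasure (breve_mu \<pi> h \<tau>) A =
      (\<integral>\<^sup>+j. ?w j * indicator ((\<lambda>j. real j * h) -` A \<inter> {2..}) j \<partial>count_space {2..})"
    unfolding breve_mu_def by (subst emeasure_distr[OF m A]) (simp add: emeasure_density)
  also have "\<dots> = (\<integral>\<^sup>+j. (if 2 \<le> j then ?w j * indicator A (real j * h) else 0) \<partial>count_space UNIV)"
    by (subst nn_integral_count_space_indicator)
      (auto intro!: nn_integral_cong simp: indicator_def)
  finally show ?thesis
    by (simp add: nn_integral_count_space_nat)
qed

text \<open>The Galton-Watson process with family-size distribution \<open>\<pi>\<close>, started from one individual, on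
  the canonical space of an i.i.d. array with law \<open>\<pi>\<close>: \<open>\<omega> (n, i)\<close> is the family size of the
  \<open>i\<close>-th individual of generation \<open>n\<close>.\<close>

definition gw_space :: "nat pmf \<Rightarrow> (nat \<times> nat \<Rightarrow> nat) measure" where
  "gw_space \<pi> = (\<Pi>\<^sub>M i\<in>UNIV. measure_pmf \<pi>)"

primrec galton_watson :: "nat \<Rightarrow> (nat \<times> nat \<Rightarrow> nat) \<Rightarrow> nat" where
  "galton_watson 0 \<omega> = 1"
| "galton_watson (Suc n) \<omega> = (\<Sum>i<galton_watson n \<omega>. \<omega> (n, i))"

definition gw_phi :: "nat pmf \<Rightarrow> real \<Rightarrow> nat \<Rightarrow> real \<Rightarrow> real" where
  "gw_phi \<pi> h n q =
     1 / h * (\<integral>\<omega>. 1 - exp (- h * q * real (galton_watson n \<omega>)) \<partial>gw_space \<pi>)"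

definition gw_phi_converges ::
    "(nat \<Rightarrow> nat pmf) \<Rightarrow> (nat \<Rightarrow> real) \<Rightarrow> (nat \<Rightarrow> real) \<Rightarrow> (real \<Rightarrow> real \<Rightarrow> real) \<Rightarrow> bool" where
  "gw_phi_converges \<pi> h \<tau> \<phi> \<longleftrightarrow>
     (\<forall>q\<ge>0. \<forall>t\<ge>0. \<forall>n :: nat \<Rightarrow> nat. (\<lambda>k. real (n k) * \<tau> k) \<longlonglongrightarrow> t \<longrightarrow>
        (\<lambda>k. gw_phi (\<pi> k) (h k) (n k) q) \<longlonglongrightarrow> \<phi> q t)"

definition branching_mechanism :: "real \<Rightarrow> real \<Rightarrow> real measure \<Rightarrow> real \<Rightarrow> real" where
  "branching_mechanism \<alpha>\<^sub>0 \<alpha>inf \<mu> q =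
     1/2 * \<alpha>\<^sub>0 * q\<^sup>2 + \<alpha>inf * q + (\<integral>x. (exp (- q * x) - 1 + q * x) / x \<partial>\<mu>)"

text \<open>\<open>\<partial>\<^sub>t\<phi> = -\<Psi>(\<phi>)\<close>, \<open>\<phi>(q,0) = q\<close> for \<open>q, t \<in> [0,\<infinity>)\<close>. As \<open>\<Psi>\<close> is a function on \<open>[0,\<infinity>)\<close>, solutions
  are required to take values there; at \<open>t = 0\<close> the derivative is one-sided.\<close>

definition solves_branching_ode :: "(real \<Rightarrow> real) \<Rightarrow> (real \<Rightarrow> real \<Rightarrow> real) \<Rightarrow> bool" where
  "solves_branching_ode \<Psi> \<phi> \<longleftrightarrow>
     (\<forall>q\<ge>0. \<phi> q 0 = q \<and>
        (\<forall>t\<ge>0. 0 \<le> \<phi> q t \<and> (\<phi> q has_real_derivative - \<Psi> (\<phi> q t)) (at t within {0..})))"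

text \<open>Only the values on \<open>(0,\<infinity>)\<close> matter in the following three notions.\<close>

definition smooth_on_halfline :: "(real \<Rightarrow> real) \<Rightarrow> bool" where
  "smooth_on_halfline f \<longleftrightarrow> (\<forall>n. \<forall>x>0. (deriv ^^ n) f differentiable (at x))"

definition completely_monotone :: "(real \<Rightarrow> real) \<Rightarrow> bool" where
  "completely_monotone g \<longleftrightarrow>
     smooth_on_halfline g \<and> (\<forall>n. \<forall>x>0. 0 \<le> (-1) ^ n * (deriv ^^ n) g x)"

definition bernstein_function :: "(real \<Rightarrow> real) \<Rightarrow> bool" where
  "bernstein_function f \<longleftrightarrow>
     smooth_on_halfline f \<and> (\<forall>x>0. 0 \<le> f x) \<and> completely_monotone (deriv f)"

end

theory Submission
  imports Defs "HOL-Real_Asymp.Real_Asymp"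
begin

text \<open>
  Let \<open>G\<close> be the generating function of the family size. The branching property gives
  \<open>E s ^ X\<^sub>n\<^sub>+\<^sub>1 = E (G s) ^ X\<^sub>n\<close>, so that \<open>u\<^sub>n = gw_phi \<pi> h n q\<close> satisfies \<open>u\<^sub>n\<^sub>+\<^sub>1 = u\<^sub>n - \<tau> \<Psi>\<^sub>k u\<^sub>n\<close> with
  \<open>\<Psi>\<^sub>k u = (G (1 - h u) - (1 - h u)) / (h \<tau>)\<close>. This is the Euler scheme with step \<open>\<tau>\<close> for the branching
  equation with mechanism \<open>\<Psi>\<^sub>k\<close>. Since the mean family size is one, \<open>G\<close> is nonexpansive on \<open>[0, 1]\<close>. Hence
  the scheme is nonexpansive, its errors do not grow (\<open>nonexpansive_euler_error\<close>), and \<open>\<Psi>\<^sub>k\<close> is nonnegative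
  and nondecreasing.

  Mean one also allows to write \<open>\<Psi>\<^sub>k u\<close> as an integral of \<open>(1 - h u) ^ j - 1 + j h u\<close>, which is close to
  \<open>exp (- u x) - 1 + u x\<close> for \<open>x = j h\<close>. Up to an error of order \<open>h\<close> times the total mass, \<open>\<Psi>\<^sub>k u\<close> is therefore
  the integral over \<open>[0, \<infinity>]\<close> of a fixed continuous function against the measure \<open>(x \<and> 1) d\<mu>\<^sub>k x\<close>, where
  \<open>\<mu>\<^sub>k\<close> is the measure \<open>breve_mu\<close> (\<open>discrete_mechanism_near_kernel_integral\<close>). So Levy-convergence
  implies \<open>\<Psi>\<^sub>k \<longlonglongrightarrow> \<Psi>\<close>, locally uniformly by monotonicity, and \<open>gw_phi\<close> converges to the flow of \<open>\<Psi>\<close>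
  (\<open>gw_phi_converges_to_ode\<close>). The flow exists by separation of variables and is unique because \<open>\<Psi>\<close>
  is nondecreasing.

  For the representation, \<open>gw_phi \<pi> h n q\<close> is the integral of \<open>(1 - exp (- q x)) / (1 - exp (- x))\<close> against
  measures on \<open>[0, \<infinity>]\<close> of mass at most one. A subsequential limit of these represents \<open>\<phi> q t\<close>; it has no
  atom at infinity as \<open>\<phi> q t \<le> q\<close> (\<open>bernstein_representation\<close>), and the Bernstein property follows by
  differentiating under the integral.

  For the converse, positivity of \<open>\<phi> q\<^sub>0 t\<^sub>0\<close> keeps the Euler scheme above some \<open>\<delta> > 0\<close> up to time \<open>t\<^sub>0\<close>
  although it decreases at a rate of at least a constant times the mass of \<open>(x \<and> 1) d\<mu>\<^sub>k x\<close>. So these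
  masses are bounded (\<open>kernel_mass_bounded\<close>), and by compactness there are subsequential limits. By the
  direct part each of them has the flow \<open>\<phi>\<close>, hence the mechanism \<open>- \<partial>\<^sub>t \<phi>\<close> at \<open>t = 0\<close>. Second differences
  in \<open>u\<close> turn the mechanism into the moments of a weighted limit measure, so it determines the limit
  (\<open>kernel_integrals_determine\<close>), and the whole sequence converges.

  All measures on \<open>[0, \<infinity>]\<close> are transported to \<open>[0, 1]\<close> by \<open>y = exp (- x)\<close>, where Helly's selection theorem
  and polynomial approximation are at hand.
\<close>

section \<open>The kernel of the branching mechanism\<close>

text \<open>
  Dividing the integrand of \<open>\<Psi>\<close> by \<open>x \<and> 1\<close> leaves a function of \<open>x\<close> that extends continuously to
  \<open>[0, \<infinity>]\<close>. The value \<open>u\<^sup>2 / 2\<close> at \<open>0\<close> is what the atom \<open>\<alpha>\<^sub>0\<close> of \<open>\<kappa>\<close> is integrated against, the value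
  \<open>u\<close> at \<open>\<infinity>\<close> is what the atom \<open>\<alpha>inf\<close> is integrated against.
\<close>

definition branching_kernel :: "real \<Rightarrow> real \<Rightarrow> real" where
  "branching_kernel u x = (if x = 0 then u\<^sup>2 / 2 else (exp (- u * x) - 1 + u * x) / (x * min x 1))"

text \<open>
  The same kernel in the coordinate \<open>y = exp (- x)\<close>, which maps \<open>[0, \<infinity>]\<close> onto \<open>[0, 1]\<close>; the point
  \<open>x = \<infinity>\<close> becomes \<open>y = 0\<close>.
\<close>

definition compact_kernel :: "real \<Rightarrow> real \<Rightarrow> real" where
  "compact_kernel u y = (if y \<le> 0 then u else branching_kernel u (- ln y))"

lemma one_minus_exp_le_min:
  fixes u x :: real assumes "0 \<le> u" "0 \<le> x"
  shows "1 - exp (- u * x) \<le> (1 + u) * min x 1"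
proof (cases "x \<le> 1")
  case True
  have "1 - exp (- u * x) \<le> u * x"
    using exp_ge_add_one_self[of "- u * x"] by simp
  also have "\<dots> \<le> (1 + u) * x" using assms by (simp add: algebra_simps)
  finally show ?thesis using True by simp
next
  case False
  then show ?thesis using assms by simp (smt (verit) exp_ge_zero)
qed

text \<open>
  The derivative in \<open>u\<close> is \<open>(1 - exp (- u x)) / min x 1\<close>, which lies between \<open>0\<close> and \<open>1 + u\<close>. The bound is
  uniform in \<open>x\<close>, so it survives integration against any finite measure.
\<close>

lemma branching_kernel_increment:
  assumes "0 \<le> u" "u \<le> v" "0 \<le> x"
  shows "0 \<le> branching_kernel v x - branching_kernel u x"
    and "branching_kernel v x - branching_kernel u x \<le> (v - u) * (1 + v)"
proof -
  have *: "0 \<le> branching_kernel v x - branching_kernel u x \<and>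
     branching_kernel v x - branching_kernel u x \<le> (v - u) * (1 + v)"
  proof (cases "x = 0")
    case True
    have "branching_kernel v x - branching_kernel u x = (v - u) * ((v + u) / 2)"
      using True by (simp add: branching_kernel_def power2_eq_square field_simps)
    moreover have "0 \<le> (v - u) * ((v + u) / 2)" using assms by simp
    moreover have "(v - u) * ((v + u) / 2) \<le> (v - u) * (1 + v)"
      using assms by (intro mult_left_mono) auto
    ultimately show ?thesis by simp
  next
    case False
    then have x: "0 < x" using assms by simp
    let ?d = "(v - u) * x - (exp (- u * x) - exp (- v * x))"
    have eq: "branching_kernel v x - branching_kernel u x = ?d / (x * min x 1)"
      using x by (simp add: branching_kernel_def diff_divide_distrib[symmetric] algebra_simps)
    have e1: "exp (- v * x) = exp (- u * x) * exp (- ((v - u) * x))"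
      by (simp add: exp_add[symmetric] algebra_simps)
    have e2: "exp (- u * x) = exp (- v * x) * exp ((v - u) * x)"
      by (simp add: exp_add[symmetric] algebra_simps)
    have "exp (- u * x) - exp (- v * x) = exp (- u * x) * (1 - exp (- ((v - u) * x)))"
      using e1 by (simp add: algebra_simps)
    also have "\<dots> \<le> 1 * ((v - u) * x)"
      using assms x exp_ge_add_one_self[of "- ((v - u) * x)"]
      by (intro mult_mono) auto
    finally have lower: "0 \<le> ?d" by simp
    have "exp (- v * x) * ((v - u) * x) \<le> exp (- v * x) * (exp ((v - u) * x) - 1)"
      using exp_ge_add_one_self[of "(v - u) * x"] by (intro mult_left_mono) (linarith, simp)
    also have "\<dots> = exp (- u * x) - exp (- v * x)"
      unfolding right_diff_distrib e2[symmetric] by simp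
    finally have "?d \<le> (v - u) * x * (1 - exp (- v * x))"
      by (simp add: algebra_simps)
    also have "\<dots> \<le> (v - u) * x * ((1 + v) * min x 1)"
      using assms x by (intro mult_left_mono one_minus_exp_le_min) auto
    finally have "?d / (x * min x 1) \<le> (v - u) * (1 + v)"
      using x by (simp add: divide_le_eq mult_ac)
    moreover have "0 \<le> ?d / (x * min x 1)" using lower x by simp
    ultimately show ?thesis using eq by simp
  qed
  show "0 \<le> branching_kernel v x - branching_kernel u x" using * by simp
  show "branching_kernel v x - branching_kernel u x \<le> (v - u) * (1 + v)" using * by simp
qed

lemma compact_kernel_increment:
  assumes "0 \<le> u" "u \<le> v" "y \<in> {0..1}"
  shows "0 \<le> compact_kernel v y - compact_kernel u y"
    and "compact_kernel v y - compact_kernel u y \<le> (v - u) * (1 + v)"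
proof -
  show "0 \<le> compact_kernel v y - compact_kernel u y"
    using branching_kernel_increment(1)[OF assms(1,2), of "- ln y"] assms
    by (auto simp: compact_kernel_def)
  have "(v - u) * 1 \<le> (v - u) * (1 + v)" using assms by (intro mult_left_mono) auto
  then show "compact_kernel v y - compact_kernel u y \<le> (v - u) * (1 + v)"
    using branching_kernel_increment(2)[OF assms(1,2), of "- ln y"] assms
    by (auto simp: compact_kernel_def)
qed

lemma compact_kernel_0 [simp]: "compact_kernel 0 y = 0"
  by (simp add: compact_kernel_def branching_kernel_def)

lemma compact_kernel_bounds:
  assumes "0 \<le> u" "y \<in> {0..1}"
  shows "0 \<le> compact_kernel u y" "compact_kernel u y \<le> u * (1 + u)"
  using compact_kernel_increment[of 0 u y] assms by auto

text \<open>
  Squaring \<open>1 + z / 2 \<le> exp (z / 2)\<close> yields the extra term \<open>z\<^sup>2 / 4\<close>.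
\<close>

lemma exp_gt_add_one: "1 + z < exp z" if "z \<noteq> 0" for z :: real
proof (cases "0 \<le> 1 + z / 2")
  case True
  have "1 + z < (1 + z / 2)\<^sup>2" using that by (simp add: power2_sum)
  also have "\<dots> \<le> (exp (z / 2))\<^sup>2" by (intro power_mono exp_ge_add_one_self True)
  also have "\<dots> = exp z" by (simp add: power2_eq_square exp_add[symmetric])
  finally show ?thesis .
next
  case False
  then show ?thesis by (smt (verit) exp_gt_zero field_sum_of_halves)
qed

lemma compact_kernel_pos:
  assumes "0 < u" "y \<in> {0..1}"
  shows "0 < compact_kernel u y"
proof (cases "y = 0 \<or> y = 1")
  case True
  then show ?thesis using assms by (auto simp: compact_kernel_def branching_kernel_def)
next
  case False
  then have x: "0 < - ln y" using assms by auto
  have "0 < (exp (- u * - ln y) - 1 + u * - ln y) / (- ln y * min (- ln y) 1)"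
    using x assms exp_gt_add_one[of "- u * - ln y"] by (intro divide_pos_pos mult_pos_pos) auto
  then show ?thesis using assms False x
    by (auto simp: compact_kernel_def branching_kernel_def)
qed

lemma continuous_on_extend_to_point:
  fixes f :: "'a::t1_space \<Rightarrow> 'b::topological_space"
  assumes "continuous_on (S - {a}) f" "(f \<longlongrightarrow> f a) (at a within S)"
  shows "continuous_on S f"
  unfolding continuous_on_def
proof
  fix y assume "y \<in> S"
  show "(f \<longlongrightarrow> f y) (at y within S)"
  proof (cases "y = a")
    case False
    have "at y within S = at y within (S - {a})"
      using False by (intro at_within_nhd[of _ "- {a}"]) auto
    then show ?thesis using assms(1) \<open>y \<in> S\<close> False by (simp add: continuous_on_def)
  qed (simp add: assms(2))
qed

lemma continuous_on_branching_kernel: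
  assumes "0 \<le> u"
  shows "continuous_on {0..} (branching_kernel u)"
proof -
  have "((\<lambda>x. (exp (- u * x) - 1 + u * x) / (x * x)) \<longlongrightarrow> u\<^sup>2 / 2) (at_right 0)"
  proof (cases "u = 0")
    case False
    then have "((\<lambda>x. (exp (- u * x) - 1 + u * x) / (x * x)) \<longlongrightarrow> u * u / 2) (at_right 0)"
      using assms by real_asymp
    then show ?thesis by (simp add: power2_eq_square)
  qed simp
  then have lim0: "(branching_kernel u \<longlongrightarrow> u\<^sup>2 / 2) (at_right 0)"
  proof (rule Lim_transform_eventually)
    have "\<forall>\<^sub>F x in at_right 0. x \<in> {0<..<1::real}"
      by (rule eventually_at_right_less[THEN eventually_elim2[where Q="\<lambda>x. x < 1"], rotated 2])
         (auto intro!: eventually_at_rightI[of 0 1])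
    then show "\<forall>\<^sub>F x in at_right 0. (exp (- u * x) - 1 + u * x) / (x * x) = branching_kernel u x"
      by eventually_elim (auto simp: branching_kernel_def)
  qed
  have "continuous_on {0<..} (\<lambda>x. (exp (- u * x) - 1 + u * x) / (x * min x 1))"
    by (intro continuous_intros) (auto simp: min_def)
  then have "continuous_on ({0..} - {0}) (branching_kernel u)"
    by (rule continuous_on_eq[OF continuous_on_subset]) (auto simp: branching_kernel_def)
  then show ?thesis
    by (rule continuous_on_extend_to_point) (use lim0 in \<open>simp add: at_within_Ici_at_right branching_kernel_def\<close>)
qed

lemma continuous_on_compact_kernel:
  assumes "0 \<le> u"
  shows "continuous_on {0..1} (compact_kernel u)"
proof -
  have "((\<lambda>x. (exp (- u * x) - 1 + u * x) / x) \<longlongrightarrow> u) at_top"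
  proof (cases "u = 0")
    case False
    then have "0 < u" using assms by simp
    then show ?thesis by real_asymp
  qed simp
  then have "(branching_kernel u \<longlongrightarrow> u) at_top"
    by (rule Lim_transform_eventually)
       (auto simp: branching_kernel_def intro!: eventually_mono[OF eventually_ge_at_top[of 1]])
  moreover have "filterlim (\<lambda>y::real. - ln y) at_top (at_right 0)"
    by real_asymp
  ultimately have "((\<lambda>y. branching_kernel u (- ln y)) \<longlongrightarrow> u) (at_right 0)"
    by (rule filterlim_compose)
  then have lim0: "(compact_kernel u \<longlongrightarrow> u) (at_right 0)"
    by (rule Lim_transform_eventually)
       (auto simp: compact_kernel_def intro!: eventually_at_rightI[of 0 1])
  have "{0..1} - {0} = {0<..1::real}" by auto
  moreover have "continuous_on {0<..1} (compact_kernel u)"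
  proof (rule continuous_on_eq)
    show "continuous_on {0<..1} (\<lambda>y. branching_kernel u (- ln y))"
      by (rule continuous_on_compose2[OF continuous_on_branching_kernel[OF assms]])
         (auto intro!: continuous_intros)
  qed (auto simp: compact_kernel_def)
  ultimately have "continuous_on ({0..1} - {0}) (compact_kernel u)" by simp
  then show ?thesis
    by (rule continuous_on_extend_to_point) (use lim0 in \<open>simp add: at_within_Icc_at_right compact_kernel_def\<close>)
qed

text \<open>
  A continuous positive function on a compact interval is bounded away from zero. This is what turns
  control of the mechanism at a single \<open>u\<close> into control of the total mass.
\<close>

lemma compact_kernel_lower_bound:
  assumes "0 < u"
  obtains c where "0 < c" "\<And>y. y \<in> {0..1} \<Longrightarrow> c \<le> compact_kernel u y"
proof -
  have "\<exists>y\<in>{0..1::real}. \<forall>z\<in>{0..1}. compact_kernel u y \<le> compact_kernel u z"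
    using assms by (intro continuous_attains_inf continuous_on_compact_kernel) auto
  then show ?thesis using that compact_kernel_pos[OF assms] by blast
qed

lemma measurable_compact_kernel: "compact_kernel u \<in> borel_measurable borel"
  unfolding compact_kernel_def[abs_def] branching_kernel_def[abs_def] by measurable

lemma compact_kernel_exp:
  assumes "0 \<le> x"
  shows "compact_kernel u (exp (- x)) * min x 1 = (if x = 0 then 0 else (exp (- u * x) - 1 + u * x) / x)"
  using assms by (auto simp: compact_kernel_def branching_kernel_def)

lemma power_one_minus_near_exp:
  fixes s :: real
  assumes "0 \<le> s" "s \<le> 1/2"
  shows "(1 - s) ^ j \<le> exp (- (real j * s))" "exp (- (real j * s)) - 2 * s \<le> (1 - s) ^ j"
proof -
  have "(1 - s) ^ j \<le> exp (- s) ^ j"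
    using exp_ge_add_one_self[of "- s"] assms by (intro power_mono) auto
  then show "(1 - s) ^ j \<le> exp (- (real j * s))" by (simp add: exp_of_nat_mult[symmetric])
  let ?z = "real j * s"
  have "- s - 2 * s\<^sup>2 \<le> ln (1 - s)" using assms by (intro ln_one_minus_pos_lower_bound) auto
  then have "exp (- s - 2 * s\<^sup>2) \<le> 1 - s" using assms by (simp add: ln_ge_iff)
  then have "exp (- s - 2 * s\<^sup>2) ^ j \<le> (1 - s) ^ j" by (intro power_mono) auto
  moreover have "exp (- s - 2 * s\<^sup>2) ^ j = exp (- ?z) * exp (- (2 * s * ?z))"
    by (simp add: exp_of_nat_mult[symmetric] exp_add[symmetric] algebra_simps power2_eq_square)
  moreover have "exp (- ?z) * (1 - 2 * s * ?z) \<le> exp (- ?z) * exp (- (2 * s * ?z))"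
    using exp_ge_add_one_self[of "- (2 * s * ?z)"] by (intro mult_left_mono) auto
  moreover have "exp (- ?z) * ?z \<le> 1"
  proof -
    have "?z \<le> exp ?z" using exp_ge_add_one_self[of ?z] by linarith
    then have "exp (- ?z) * ?z \<le> exp (- ?z) * exp ?z" by (intro mult_left_mono) auto
    then show ?thesis by (simp add: exp_add[symmetric])
  qed
  then have "2 * s * (exp (- ?z) * ?z) \<le> 2 * s * 1" using assms by (intro mult_left_mono) auto
  ultimately show "exp (- ?z) - 2 * s \<le> (1 - s) ^ j"
    by (simp add: algebra_simps)
qed

text \<open>
  Term by term comparison of the discrete and the limiting mechanism. With \<open>s = h u\<close>, the difference
  \<open>f\<close> of \<open>(1 - s)^j - 1 + j s\<close> and \<open>(j - 1) / j * (exp (- j s) - 1 + j s)\<close> has to be small relative to the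
  weight \<open>(j - 1) h min (j h) 1\<close>, uniformly in \<open>j\<close>. The factor \<open>j - 1\<close> in place of \<open>j\<close> makes the two second
  derivatives in \<open>s\<close> equal to \<open>j (j - 1)\<close> times \<open>(1 - s)^(j - 2)\<close> and \<open>exp (- j s)\<close>, which differ by \<open>O(s)\<close>;
  two integrations settle the case \<open>j h \<le> 1\<close>. For \<open>j h > 1\<close> the weight is of order \<open>j h\<close> and crude bounds
  suffice.
\<close>

lemma generation_term_near_kernel_term:
  fixes h u :: real and j :: nat
  assumes "0 < h" "h \<le> 1/2" "0 \<le> u" "h * u \<le> 1/2"
  shows "\<bar>((1 - h * u) ^ j - 1 + real j * (h * u))
            - h * ((real j - 1) * min (real j * h) 1 * compact_kernel u (exp (- (real j * h))))\<bar>
         \<le> (u ^ 3 + 6 * u + 2) * h * (h * ((real j - 1) * min (real j * h) 1))"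
proof (cases "j \<le> 1")
  case True
  then have "j = 0 \<or> j = 1" by auto
  then show ?thesis by auto
next
  case False
  then have j: "2 \<le> j" by simp
  define s where "s = h * u"
  have s: "0 \<le> s" "s \<le> 1/2" using assms by (auto simp: s_def)
  let ?n = "real j"
  define f where "f t = ((1 - t) ^ j - 1 + ?n * t) - (?n - 1) / ?n * (exp (- (?n * t)) - 1 + ?n * t)" for t
  have kernel: "h * ((?n - 1) * min (?n * h) 1 * compact_kernel u (exp (- (?n * h))))
      = (?n - 1) / ?n * (exp (- (?n * s)) - 1 + ?n * s)"
  proof -
    have "min (?n * h) 1 * compact_kernel u (exp (- (?n * h)))
        = (exp (- (?n * s)) - 1 + ?n * s) / (?n * h)"
      using compact_kernel_exp[of "?n * h" u] assms j by (simp add: s_def mult_ac)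
    then show ?thesis using assms j by (simp add: mult.assoc)
  qed
  have f_eq: "((1 - h * u) ^ j - 1 + ?n * (h * u))
       - h * ((?n - 1) * min (?n * h) 1 * compact_kernel u (exp (- (?n * h)))) = f s"
    unfolding kernel f_def by (simp add: s_def)
  have "\<bar>f s\<bar> \<le> (u ^ 3 + 6 * u + 2) * h * (h * ((?n - 1) * min (?n * h) 1))"
  proof (cases "?n * h \<le> 1")
    case True
    \<comment> \<open>Taylor expansion at \<open>0\<close>, where \<open>f\<close> and \<open>f1 = f'\<close> vanish; \<open>f2 = f''\<close>.\<close>
    define f1 where "f1 t = ?n * (1 - (1 - t) ^ (j - 1)) - (?n - 1) * (1 - exp (- (?n * t)))" for t
    define f2 where "f2 t = ?n * (?n - 1) * ((1 - t) ^ (j - 2) - exp (- (?n * t)))" for t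
    have d1: "(f has_real_derivative f1 t) (at t)" for t
      unfolding f_def f1_def using j
      by (auto intro!: derivative_eq_intros simp: field_simps)
    have d2: "(f1 has_real_derivative f2 t) (at t)" for t
      unfolding f1_def f2_def using j
      by (auto intro!: derivative_eq_intros simp: field_simps of_nat_diff numeral_2_eq_2)
    have f2: "\<bar>f2 t\<bar> \<le> ?n * (?n - 1) * (2 * s)" if t: "0 \<le> t" "t \<le> s" for t
    proof -
      have t2: "t \<le> 1/2" using t s by simp
      have "(1 - t) ^ (j - 2) \<le> exp (- (real (j - 2) * t))"
        using t t2 by (intro power_one_minus_near_exp)
      also have "\<dots> = exp (- (?n * t)) + exp (- (real (j - 2) * t)) * (1 - exp (- (2 * t)))"
        using j by (simp add: of_nat_diff algebra_simps exp_add[symmetric])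
      also have "exp (- (real (j - 2) * t)) * (1 - exp (- (2 * t))) \<le> 1 * (2 * t)"
        using t exp_ge_add_one_self[of "- (2 * t)"] by (intro mult_mono) auto
      finally have up: "(1 - t) ^ (j - 2) \<le> exp (- (?n * t)) + 2 * t" by simp
      have "exp (- (?n * t)) - 2 * t \<le> (1 - t) ^ j"
        using t t2 by (intro power_one_minus_near_exp)
      also have "\<dots> \<le> (1 - t) ^ (j - 2)" using t t2 by (intro power_decreasing) auto
      finally have "\<bar>(1 - t) ^ (j - 2) - exp (- (?n * t))\<bar> \<le> 2 * s" using up t by linarith
      then show ?thesis unfolding f2_def abs_mult using j
        by (intro mult_mono) auto
    qed
    have "\<bar>f s\<bar> \<le> ?n * (?n - 1) * (2 * s) * s\<^sup>2 / 2"
    proof (cases "s = 0")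
      case True then show ?thesis by (simp add: f_def)
    next
      case False
      define diff where "diff m = (if m = 0 then f else if m = Suc 0 then f1 else f2)" for m :: nat
      have "\<exists>t>0. t < s \<and> f s = (\<Sum>m<2. diff m 0 / fact m * s ^ m) + diff 2 t / fact 2 * s ^ 2"
        using s False d1 d2
        by (intro Maclaurin) (auto simp: diff_def less_2_cases_iff)
      then obtain t where t: "0 < t" "t < s" "f s = f2 t / 2 * s\<^sup>2"
        by (auto simp: diff_def numeral_2_eq_2 f_def f1_def)
      then have "\<bar>f s\<bar> = \<bar>f2 t\<bar> * (s\<^sup>2 / 2)" by (simp only: t(3) abs_mult) simp
      also have "\<dots> \<le> ?n * (?n - 1) * (2 * s) * (s\<^sup>2 / 2)"
        using f2[of t] t by (intro mult_right_mono) auto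
      finally show ?thesis by simp
    qed
    also have "\<dots> = u ^ 3 * h * (h * ((?n - 1) * min (?n * h) 1))"
      using True by (simp add: s_def power2_eq_square power3_eq_cube)
    also have "\<dots> \<le> (u ^ 3 + 6 * u + 2) * h * (h * ((?n - 1) * min (?n * h) 1))"
      using assms j by (intro mult_right_mono) auto
    finally show ?thesis .
  next
    case False
    have "f s = ((1 - s) ^ j - exp (- (?n * s))) + s - (1 - exp (- (?n * s))) / ?n"
      using j by (simp add: f_def field_simps)
    moreover have "\<bar>(1 - s) ^ j - exp (- (?n * s))\<bar> \<le> 2 * s"
      using power_one_minus_near_exp[OF s, of j] by linarith
    moreover have "0 \<le> (1 - exp (- (?n * s))) / ?n" using s by simp
    moreover have "(1 - exp (- (?n * s))) / ?n \<le> h"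
      using False j assms by (simp add: divide_le_eq mult.commute) (smt (verit) exp_gt_zero)
    ultimately have "\<bar>f s\<bar> \<le> 2 * s + s + h"
      using s by linarith
    then have "\<bar>f s\<bar> \<le> h * (3 * u + 1)"
      by (simp add: s_def algebra_simps)
    also have "\<dots> \<le> h * (3 * u + 1) * (2 * (h * (?n - 1)))"
    proof -
      \<comment> \<open>Here \<open>h \<le> 1/2\<close> enters: \<open>(j - 1) h > 1 - h \<ge> 1/2\<close>.\<close>
      have "1 \<le> 2 * (h * (?n - 1))" using False assms by (simp add: algebra_simps)
      then show ?thesis using assms by (intro mult_left_mono[where c = "h * (3 * u + 1)" and a = 1, simplified]) auto
    qed
    also have "\<dots> = (6 * u + 2) * h * (h * ((?n - 1) * min (?n * h) 1))"
      using False by (simp add: algebra_simps)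
    also have "\<dots> \<le> (u ^ 3 + 6 * u + 2) * h * (h * ((?n - 1) * min (?n * h) 1))"
      using assms j by (intro mult_right_mono) auto
    finally show ?thesis .
  qed
  then show ?thesis unfolding f_eq .
qed

section \<open>The branching equation and its Euler scheme\<close>

lemma solves_branching_odeD:
  assumes "solves_branching_ode P \<phi>" "0 \<le> q"
  shows "\<phi> q 0 = q" and "0 \<le> t \<Longrightarrow> 0 \<le> \<phi> q t"
    and "0 \<le> t \<Longrightarrow> (\<phi> q has_real_derivative - P (\<phi> q t)) (at t within {0..})"
  using assms by (auto simp: solves_branching_ode_def)

lemma solves_branching_ode_mvt:
  assumes sol: "solves_branching_ode P \<phi>" "0 \<le> q" and "0 \<le> s" "s < t"
  obtains x where "s < x" "x < t" "\<phi> q t - \<phi> q s = - P (\<phi> q x) * (t - s)"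
proof -
  have "\<exists>x\<in>{s<..<t}. \<phi> q t - \<phi> q s = - P (\<phi> q x) * (t - s)"
  proof (rule mvt_simple[OF \<open>s < t\<close>])
    fix x assume "s \<le> x" "x \<le> t"
    then have "(\<phi> q has_real_derivative - P (\<phi> q x)) (at x within {s..t})"
      using assms by (intro has_field_derivative_subset[OF solves_branching_odeD(3)[OF sol]]) auto
    then show "(\<phi> q has_derivative (*) (- P (\<phi> q x))) (at x within {s..t})"
      by (simp add: has_field_derivative_def)
  qed
  then show ?thesis using that by auto
qed

lemma solves_branching_ode_antimono:
  assumes sol: "solves_branching_ode P \<phi>" and P: "\<And>u. 0 \<le> u \<Longrightarrow> 0 \<le> P u"
    and "0 \<le> q" "0 \<le> s" "s \<le> t"
  shows "\<phi> q t \<le> \<phi> q s"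
proof (cases "s = t")
  case False
  then have "s < t" using assms by simp
  then obtain x where x: "s < x" "\<phi> q t - \<phi> q s = - P (\<phi> q x) * (t - s)"
    using solves_branching_ode_mvt[OF sol \<open>0 \<le> q\<close> \<open>0 \<le> s\<close>] by metis
  have "0 \<le> P (\<phi> q x)" using sol x assms by (auto simp: solves_branching_ode_def)
  then have "0 \<le> P (\<phi> q x) * (t - s)" using \<open>s < t\<close> by simp
  then show ?thesis using x by simp
qed simp

text \<open>
  For a monotone \<open>P\<close> the flow is contracting: the squared distance of two solutions has derivative
  \<open>- 2 (\<psi> - \<phi>) (P \<psi> - P \<phi>) \<le> 0\<close>.
\<close>

lemma solves_branching_ode_unique:
  assumes P: "mono_on {0..} P"
    and sol: "solves_branching_ode P \<phi>" "solves_branching_ode P \<psi>"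
    and "0 \<le> q" "0 \<le> t"
  shows "\<psi> q t = \<phi> q t"
proof (cases "t = 0")
  case True
  then show ?thesis using assms by (auto simp: solves_branching_ode_def)
next
  case False
  let ?d = "\<lambda>s. \<psi> q s - \<phi> q s"
  have "((\<lambda>s. (?d s)\<^sup>2) has_real_derivative 2 * ?d s * (P (\<phi> q s) - P (\<psi> q s))) (at s within {0..t})"
    if "0 \<le> s" for s
  proof -
    have "(\<phi> q has_real_derivative - P (\<phi> q s)) (at s within {0..t})"
      "(\<psi> q has_real_derivative - P (\<psi> q s)) (at s within {0..t})"
      using that \<open>0 \<le> q\<close>
      by (auto intro!: has_field_derivative_subset[where s = "{0..}" and t = "{0..t}"]
            solves_branching_odeD[OF sol(1)] solves_branching_odeD[OF sol(2)])
    then show ?thesis by (auto intro!: derivative_eq_intros simp: algebra_simps)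
  qed
  then have "\<exists>x\<in>{0<..<t}. (?d t)\<^sup>2 - (?d 0)\<^sup>2 = 2 * ?d x * (P (\<phi> q x) - P (\<psi> q x)) * (t - 0)"
    using False assms by (intro mvt_simple) (auto simp: has_field_derivative_def)
  then obtain x where x: "x \<in> {0<..<t}"
      "(?d t)\<^sup>2 - (?d 0)\<^sup>2 = 2 * ?d x * (P (\<phi> q x) - P (\<psi> q x)) * (t - 0)"
    by blast
  have "0 \<le> \<phi> q x" "0 \<le> \<psi> q x"
    using sol x \<open>0 \<le> q\<close> by (auto simp: solves_branching_ode_def)
  then have "?d x * (P (\<phi> q x) - P (\<psi> q x)) \<le> 0"
    using P by (cases "\<phi> q x \<le> \<psi> q x") (auto simp: mono_on_def mult_le_0_iff)
  then have "(2 * t) * (?d x * (P (\<phi> q x) - P (\<psi> q x))) \<le> 0"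
    by (rule mult_nonneg_nonpos[rotated]) (use \<open>0 \<le> t\<close> in simp)
  then have "2 * ?d x * (P (\<phi> q x) - P (\<psi> q x)) * (t - 0) \<le> 0"
    by (simp only: diff_zero mult.commute mult.left_commute)
  moreover have "?d 0 = 0" using sol \<open>0 \<le> q\<close> by (simp add: solves_branching_ode_def)
  ultimately have "(?d t)\<^sup>2 \<le> 0" using x by simp
  then show ?thesis by simp
qed

text \<open>
  Separation of variables. If \<open>P > 0\<close> on \<open>(0, \<infinity>)\<close>, an antiderivative \<open>F\<close> of \<open>- 1 / P\<close> is strictly
  decreasing and \<open>\<phi> q t = F\<inverse> (F q + t)\<close>. Since \<open>P u \<le> C u\<close> near \<open>0\<close>, \<open>F\<close> is at least of the order of
  \<open>- ln u / C\<close> there and hence unbounded, so this is defined for all times.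
\<close>

lemma solves_branching_ode_exists:
  fixes P :: "real \<Rightarrow> real"
  assumes P0: "P 0 = 0"
    and inc: "\<And>u v. 0 \<le> u \<Longrightarrow> u \<le> v \<Longrightarrow> 0 \<le> P v - P u \<and> P v - P u \<le> K * ((v - u) * (1 + v))"
    and alt: "(\<forall>u>0. 0 < P u) \<or> (\<forall>u\<ge>0. P u = 0)"
  shows "\<exists>\<phi>. solves_branching_ode P \<phi>"
  using alt
proof
  assume "\<forall>u\<ge>0. P u = 0"
  then have "solves_branching_ode P (\<lambda>q t. q)"
    by (auto simp: solves_branching_ode_def intro!: derivative_eq_intros)
  then show ?thesis by blast
next
  assume pos: "\<forall>u>0. 0 < P u"
  have "0 < K"
    using inc[of 0 1] P0 pos[rule_format, of 1] by simp
  have cont: "continuous_on {0<..} P"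
    unfolding continuous_on_iff
  proof safe
    fix x e :: real assume x: "0 < x" "0 < e"
    let ?d = "min 1 (e / (K * (2 + x) * 2))"
    show "\<exists>d>0. \<forall>x'\<in>{0<..}. dist x' x < d \<longrightarrow> dist (P x') (P x) < e"
    proof (intro exI[of _ ?d] conjI ballI impI)
      show "0 < ?d" using x \<open>0 < K\<close> by simp
      fix y assume y: "y \<in> {0<..}" "dist y x < ?d"
      have b: "\<bar>P y - P x\<bar> \<le> K * (\<bar>y - x\<bar> * (1 + max x y))"
        using inc[of x y] inc[of y x] x y by (cases "x \<le> y") auto
      have "max x y \<le> 1 + x" using y by (auto simp: dist_real_def)
      then have "K * (\<bar>y - x\<bar> * (1 + max x y)) \<le> K * (\<bar>y - x\<bar> * (2 + x))"
        using \<open>0 < K\<close> by (intro mult_left_mono) auto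
      also have "\<dots> = \<bar>y - x\<bar> * (K * (2 + x))" by simp
      also have "\<dots> \<le> e / (K * (2 + x) * 2) * (K * (2 + x))"
        using y \<open>0 < K\<close> x by (intro mult_right_mono) (auto simp: dist_real_def)
      also have "\<dots> < e" using x \<open>0 < K\<close> by simp
      finally show "dist (P y) (P x) < e" using b by (simp add: dist_real_def)
    qed
  qed
  have "\<exists>F. \<forall>x::real. (0::ereal) < ereal x \<longrightarrow> ereal x < \<infinity> \<longrightarrow>
      (F has_vector_derivative - (1 / P x)) (at x)"
  proof (rule einterval_antiderivative)
    fix x :: real assume "(0::ereal) < ereal x"
    then have "0 < x" by simp
    then show "isCont (\<lambda>x. - (1 / P x)) x"
      using cont pos[rule_format, of x]
      by (intro continuous_intros) (auto simp: continuous_on_eq_continuous_at)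
  qed simp
  then obtain F where F: "\<And>x. 0 < x \<Longrightarrow> (F has_real_derivative - (1 / P x)) (at x)"
    by (auto simp: has_real_derivative_iff_has_vector_derivative)
  have F_strict: "F v < F u" if "0 < u" "u < v" for u v
  proof (rule DERIV_neg_imp_decreasing[OF \<open>u < v\<close>])
    fix x assume "u \<le> x" "x \<le> v"
    then have "0 < x" using that by simp
    then show "\<exists>y. (F has_real_derivative y) (at x) \<and> y < 0"
      using F[of x] pos by (intro exI[of _ "- (1 / P x)"]) auto
  qed
  have F_inj: "u = v" if "0 < u" "0 < v" "F u = F v" for u v
    using F_strict[of u v] F_strict[of v u] that by (cases u v rule: linorder_cases) auto
  have F_cont: "continuous_on {0<..} F"
    by (auto intro!: continuous_at_imp_continuous_on DERIV_isCont F)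
  define g where "g y = (THE u. 0 < u \<and> F u = y)" for y
  have g_F: "g (F u) = u" if "0 < u" for u
    unfolding g_def using that F_inj by (intro the_equality) auto
  have g_deriv: "(g has_real_derivative - P u) (at (F u))" if "0 < u" for u
    unfolding has_field_derivative_def
  proof (rule has_derivative_inverse_strong[where S = "{0<..}" and f = F and x = u and f' = "(*) (- (1 / P u))"])
    show "(F has_derivative (*) (- (1 / P u))) (at u)"
      using F[OF that] by (simp add: has_field_derivative_def)
    show "(*) (- (1 / P u)) \<circ> (*) (- P u) = id"
      using pos[rule_format, OF that] by (auto simp: fun_eq_iff)
  qed (use that F_cont g_F in auto)
  have F_large: "\<exists>u. 0 < u \<and> u \<le> q \<and> F u = F q + t" if "0 < q" "0 \<le> t" for q t
  proof -
    define L where "L = K * (1 + q)"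
    have "0 < L" using \<open>0 < K\<close> that by (simp add: L_def)
    \<comment> \<open>At \<open>a\<close> the comparison function \<open>- ln u / L\<close> has grown by exactly \<open>t\<close>.\<close>
    define a where "a = q * exp (- L * t)"
    have a: "0 < a" "a \<le> q" using that \<open>0 < L\<close> by (auto simp: a_def mult_le_cancel_left1)
    have "F q + ln q / L \<le> F a + ln a / L"
    proof (rule DERIV_nonpos_imp_nonincreasing[of a q "\<lambda>u. F u + ln u / L"])
      fix x assume x: "a \<le> x" "x \<le> q"
      then have "0 < x" using a by simp
      have "P x \<le> K * (x * (1 + x))" using inc[of 0 x] P0 \<open>0 < x\<close> by simp
      also have "\<dots> \<le> K * (x * (1 + q))" using x \<open>0 < x\<close> \<open>0 < K\<close> by (intro mult_left_mono) auto
      also have "\<dots> = L * x" by (simp add: L_def)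
      finally have "1 / (L * x) \<le> 1 / P x"
        using pos \<open>0 < x\<close> by (intro divide_left_mono) auto
      moreover have "((\<lambda>u. F u + ln u / L) has_real_derivative - (1 / P x) + 1 / (L * x)) (at x)"
        using \<open>0 < x\<close> \<open>0 < L\<close> by (auto intro!: derivative_eq_intros F simp: field_simps)
      ultimately show "\<exists>y. ((\<lambda>u. F u + ln u / L) has_real_derivative y) (at x) \<and> y \<le> 0" 
        by (intro exI[of _ "- (1 / P x) + 1 / (L * x)"]) auto
    qed (use a in simp)
    moreover have "ln a = ln q - L * t" using that by (simp add: a_def ln_mult)
    ultimately have "F q + t \<le> F a" using \<open>0 < L\<close> by (simp add: diff_divide_distrib)
    moreover have "continuous_on {a..q} F" by (rule continuous_on_subset[OF F_cont]) (use a in auto)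
    ultimately obtain u where "a \<le> u" "u \<le> q" "F u = F q + t"
      using IVT2'[of F q "F q + t" a] \<open>0 \<le> t\<close> a by auto
    then show ?thesis using a by (intro exI[of _ u]) auto
  qed
  have "solves_branching_ode P (\<lambda>q t. if q = 0 then 0 else g (F q + t))"
    unfolding solves_branching_ode_def
  proof (intro allI impI conjI)
    fix q t :: real assume "0 \<le> q"
    show "(if q = 0 then 0 else g (F q + 0)) = q" using \<open>0 \<le> q\<close> g_F by simp
    assume "0 \<le> t"
    show "0 \<le> (if q = 0 then 0 else g (F q + t))"
      using F_large[of q t] g_F \<open>0 \<le> q\<close> \<open>0 \<le> t\<close> by force
    show "((\<lambda>t. if q = 0 then 0 else g (F q + t)) has_real_derivative
       - P (if q = 0 then 0 else g (F q + t))) (at t within {0..})"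
    proof (cases "q = 0")
      case True then show ?thesis by (simp add: P0)
    next
      case False
      then obtain u where u: "0 < u" "F u = F q + t"
        using F_large[of q t] \<open>0 \<le> q\<close> \<open>0 \<le> t\<close> by auto
      have "(g has_real_derivative - P u) (at (F q + t))" using g_deriv[of u] u by simp
      then have "((\<lambda>t. g (F q + t)) has_real_derivative - P u * 1) (at t)"
        by (rule DERIV_chain2) (auto intro!: derivative_eq_intros)
      then show ?thesis using False u g_F[of u] by (auto intro: has_field_derivative_at_within)
    qed
  qed
  then show ?thesis by blast
qed

text \<open>
  Polya's argument: on a grid on which \<open>P\<close> varies by less than \<open>e / 2\<close> between neighbours, closeness at
  the finitely many grid points propagates to the points in between by monotonicity.
\<close>

lemma monotone_pointwise_imp_uniform:
  fixes P :: "real \<Rightarrow> real" and Q :: "nat \<Rightarrow> real \<Rightarrow> real"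
  assumes "0 \<le> q" and P: "continuous_on {0..q} P" "mono_on {0..q} P"
    and mono: "\<forall>\<^sub>F k in sequentially. mono_on {0..q} (Q k)"
    and lim: "\<And>u. u \<in> {0..q} \<Longrightarrow> (\<lambda>k. Q k u) \<longlonglongrightarrow> P u"
    and "0 < e"
  shows "\<forall>\<^sub>F k in sequentially. \<forall>u\<in>{0..q}. \<bar>Q k u - P u\<bar> \<le> e"
proof -
  have "uniformly_continuous_on {0..q} P"
    using P by (intro compact_uniformly_continuous) auto
  then obtain d where d: "0 < d" "\<And>x y. x \<in> {0..q} \<Longrightarrow> y \<in> {0..q} \<Longrightarrow> dist y x < d \<Longrightarrow> dist (P y) (P x) < e / 2"
    unfolding uniformly_continuous_on_def using \<open>0 < e\<close> by (meson half_gt_zero)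
  obtain N where N: "q / d < real N" using reals_Archimedean2 by blast
  have "0 < real N" using N \<open>0 \<le> q\<close> \<open>0 < d\<close> by (smt (verit) divide_nonneg_pos)
  define a where "a i = q * real i / real N" for i :: nat
  have a_mem: "a i \<in> {0..q}" if "i \<le> N" for i
    using that \<open>0 \<le> q\<close> \<open>0 < real N\<close> by (auto simp: a_def divide_le_eq intro!: mult_left_mono)
  have "\<forall>\<^sub>F k in sequentially. \<forall>i\<in>{..N}. \<bar>Q k (a i) - P (a i)\<bar> < e / 2"
  proof (rule eventually_ball_finite)
    show "\<forall>i\<in>{..N}. \<forall>\<^sub>F k in sequentially. \<bar>Q k (a i) - P (a i)\<bar> < e / 2"
      using lim[OF a_mem] half_gt_zero[OF \<open>0 < e\<close>] unfolding tendsto_iff dist_real_def by blast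
  qed simp
  then show ?thesis using mono
  proof eventually_elim
    case (elim k)
    show ?case
    proof
      fix u assume u: "u \<in> {0..q}"
      define i where "i = (if q = 0 then 0 else min (N - 1) (nat \<lfloor>u * N / q\<rfloor>))"
      have "i < N" using \<open>0 < real N\<close> by (auto simp: i_def)
      have i: "a i \<le> u \<and> u \<le> a (Suc i)"
      proof (cases "q = 0")
        case True
        then show ?thesis using u by (simp add: a_def)
      next
        case False
        then have q: "0 < q" using \<open>0 \<le> q\<close> by simp
        have "u * N \<le> q * N" using u by (intro mult_right_mono) auto
        then have uN: "0 \<le> u * N / q" "u * N / q \<le> N" using u q by (auto simp: divide_le_eq mult.commute)
        have "real i \<le> u * N / q"
        proof -
          have "real i \<le> real (nat \<lfloor>u * N / q\<rfloor>)" using False by (simp add: i_def)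
          also have "\<dots> \<le> u * N / q" using uN by simp
          finally show ?thesis .
        qed
        moreover have "u * N / q \<le> real (Suc i)"
        proof (cases "N - 1 \<le> nat \<lfloor>u * N / q\<rfloor>")
          case True
          then have "Suc i = N" using False \<open>0 < real N\<close> by (simp add: i_def)
          then show ?thesis using uN by simp
        next
          case F: False
          then show ?thesis using False uN by (simp add: i_def min_def) linarith
        qed
        ultimately show ?thesis using q \<open>0 < real N\<close> by (simp add: a_def field_simps)
      qed
      have "dist (a (Suc i)) (a i) < d"
      proof -
        have "a (Suc i) - a i = q / N" using \<open>0 < real N\<close> by (simp add: a_def field_simps)
        moreover have "q / N < d" using N \<open>0 < d\<close> \<open>0 < real N\<close> by (simp add: field_simps)
        ultimately show ?thesis using \<open>0 \<le> q\<close> by (simp add: dist_real_def)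
      qed
      then have "dist (P (a (Suc i))) (P (a i)) < e / 2"
        using \<open>i < N\<close> by (intro d(2) a_mem) auto
      then have gap: "P (a (Suc i)) - P (a i) < e / 2" unfolding dist_real_def by linarith
      have "Q k (a i) \<le> Q k u" "Q k u \<le> Q k (a (Suc i))" "P (a i) \<le> P u" "P u \<le> P (a (Suc i))"
        using elim(2) P(2) i u a_mem[of i] a_mem[of "Suc i"] \<open>i < N\<close>
        by (auto simp: mono_on_def)
      moreover have "\<bar>Q k (a i) - P (a i)\<bar> < e / 2" "\<bar>Q k (a (Suc i)) - P (a (Suc i))\<bar> < e / 2"
        using elim(1) \<open>i < N\<close> by auto
      ultimately show "\<bar>Q k u - P u\<bar> \<le> e" using gap by linarith
    qed
  qed
qed

text \<open>
  As the Euler step is nonexpansive, the errors of the individual steps only add up. One step commits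
  at most \<open>\<tau> e\<close> from replacing \<open>P\<close> by \<open>Q\<close>, and at most \<open>\<tau>\<close> times the decrease of \<open>P \<circ> \<phi> q\<close> from
  freezing the right-hand side; the decreases telescope to at most \<open>\<tau> P q\<close> in total.
\<close>

lemma nonexpansive_euler_error:
  fixes P Q :: "real \<Rightarrow> real" and u :: "nat \<Rightarrow> real"
  assumes P: "mono_on {0..} P" "0 \<le> P 0" and sol: "solves_branching_ode P \<phi>"
    and "0 \<le> q" "0 < \<tau>"
    and close: "\<And>v. v \<in> {0..q} \<Longrightarrow> \<bar>Q v - P v\<bar> \<le> e"
    and nonexp: "\<And>v w. v \<in> {0..q} \<Longrightarrow> w \<in> {0..q} \<Longrightarrow> \<bar>(v - \<tau> * Q v) - (w - \<tau> * Q w)\<bar> \<le> \<bar>v - w\<bar>"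
    and u: "\<And>n. u n \<in> {0..q}" "\<And>n. u (Suc n) = u n - \<tau> * Q (u n)"
  shows "\<bar>u n - \<phi> q (real n * \<tau>)\<bar> \<le> \<bar>u 0 - q\<bar> + real n * \<tau> * e + \<tau> * (P q - P (\<phi> q (real n * \<tau>)))"
proof (induction n)
  case 0
  then show ?case using sol \<open>0 \<le> q\<close> by (simp add: solves_branching_ode_def)
next
  case (Suc n)
  let ?t = "real n * \<tau>"
  let ?v = "\<phi> q ?t" and ?w = "\<phi> q (real (Suc n) * \<tau>)"
  have P_nonneg: "0 \<le> P x" if "0 \<le> x" for x
    using P that by (auto simp: mono_on_def intro: order_trans[of 0 "P 0"])
  have t: "0 \<le> ?t" "?t < real (Suc n) * \<tau>" using \<open>0 < \<tau>\<close> by (auto simp: algebra_simps)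
  have nonneg: "0 \<le> \<phi> q s" if "0 \<le> s" for s
    using sol \<open>0 \<le> q\<close> that by (auto simp: solves_branching_ode_def)
  have anti: "\<phi> q s' \<le> \<phi> q s" if "0 \<le> s" "s \<le> s'" for s s'
    using solves_branching_ode_antimono[OF sol P_nonneg \<open>0 \<le> q\<close> that] .
  have v: "?v \<in> {0..q}"
    using nonneg[OF t(1)] anti[OF _ t(1)] sol \<open>0 \<le> q\<close> by (auto simp: solves_branching_ode_def)
  obtain x where x: "?t < x" "x < real (Suc n) * \<tau>" "?w - ?v = - P (\<phi> q x) * \<tau>"
    using solves_branching_ode_mvt[OF sol \<open>0 \<le> q\<close> t] by (auto simp: algebra_simps)
  have "P ?w \<le> P (\<phi> q x)" "P (\<phi> q x) \<le> P ?v"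
    using P(1) x t anti[of x "real (Suc n) * \<tau>"] anti[of ?t x] nonneg
    by (auto simp: mono_on_def)
  then have "\<bar>\<tau> * P ?v - \<tau> * P (\<phi> q x)\<bar> \<le> \<tau> * (P ?v - P ?w)"
    using \<open>0 < \<tau>\<close> by (simp add: right_diff_distrib[symmetric] abs_mult)
  moreover have "\<tau> * \<bar>Q ?v - P ?v\<bar> \<le> \<tau> * e" using close[OF v] \<open>0 < \<tau>\<close> by simp
  then have "\<bar>\<tau> * Q ?v - \<tau> * P ?v\<bar> \<le> \<tau> * e"
    using \<open>0 < \<tau>\<close> by (simp add: right_diff_distrib[symmetric] abs_mult)
  moreover have "\<bar>(u n - \<tau> * Q (u n)) - (?v - \<tau> * Q ?v)\<bar> \<le> \<bar>u n - ?v\<bar>"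
    by (rule nonexp[OF u(1) v])
  ultimately have "\<bar>u (Suc n) - ?w\<bar> \<le> \<bar>u n - ?v\<bar> + \<tau> * e + \<tau> * (P ?v - P ?w)"
    using x(3) unfolding u(2) by (simp add: mult.commute)
  with Suc.IH show ?case by (simp add: algebra_simps)
qed

section \<open>Generating functions of the Galton-Watson process\<close>

definition offspring_gf :: "nat pmf \<Rightarrow> real \<Rightarrow> real" where
  "offspring_gf \<pi> s = measure_pmf.expectation \<pi> (\<lambda>j. s ^ j)"

lemma space_gw_space [simp]: "space (gw_space \<pi>) = UNIV"
  by (simp add: gw_space_def space_PiM)

lemma prob_space_gw_space: "prob_space (gw_space \<pi>)"
  unfolding gw_space_def by (intro prob_space_PiM measure_pmf.prob_space_axioms)

lemma measurable_galton_watson_PiM: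
  assumes "{p. fst p < n} \<subseteq> J"
  shows "galton_watson n \<in> measurable (PiM J (\<lambda>_. measure_pmf \<pi>)) (count_space UNIV)"
  using assms
proof (induction n)
  case 0
  then show ?case by simp
next
  case (Suc n)
  have IH: "galton_watson n \<in> measurable (PiM J (\<lambda>_. measure_pmf \<pi>)) (count_space UNIV)"
    using Suc.prems by (intro Suc.IH) auto
  have "(\<lambda>\<omega>. \<Sum>i<m. \<omega> (n, i)) \<in> measurable (PiM J (\<lambda>_. measure_pmf \<pi>)) (count_space UNIV)" for m
  proof (induction m)
    case (Suc m)
    have "(\<lambda>\<omega>. \<omega> (n, m)) \<in> measurable (PiM J (\<lambda>_. measure_pmf \<pi>)) (measure_pmf \<pi>)"
      using \<open>{p. fst p < Suc n} \<subseteq> J\<close> by (intro measurable_component_singleton) auto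
    then have "(\<lambda>\<omega>. \<omega> (n, m)) \<in> measurable (PiM J (\<lambda>_. measure_pmf \<pi>)) (count_space UNIV)"
      by simp
    moreover have "(\<lambda>\<omega>. (\<Sum>i<m. \<omega> (n, i)) + a) \<in> measurable (PiM J (\<lambda>_. measure_pmf \<pi>)) (count_space UNIV)" for a
      by (rule measurable_compose[OF Suc]) simp
    ultimately have "(\<lambda>\<omega>. (\<Sum>i<m. \<omega> (n, i)) + \<omega> (n, m)) \<in> measurable (PiM J (\<lambda>_. measure_pmf \<pi>)) (count_space UNIV)"
      by (rule measurable_compose_countable[where f = "\<lambda>a \<omega>. (\<Sum>i<m. \<omega> (n, i)) + a", rotated])
    then show ?case by simp
  qed simp
  then show ?case
    unfolding galton_watson.simps
    by (rule measurable_compose_countable[OF _ IH])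
qed

lemma measurable_galton_watson [measurable]:
  "galton_watson n \<in> measurable (gw_space \<pi>) (count_space UNIV)"
  unfolding gw_space_def by (rule measurable_galton_watson_PiM) simp

text \<open>
  Generation \<open>n\<close> is a function of the families of the earlier generations only. This is what makes it
  independent of the families of generation \<open>n\<close>.
\<close>

lemma galton_watson_restrict:
  "{p. fst p < n} \<subseteq> J \<Longrightarrow> galton_watson n (restrict \<omega> J) = galton_watson n \<omega>"
proof (induction n)
  case (Suc n)
  have "galton_watson n (restrict \<omega> J) = galton_watson n \<omega>"
    using Suc.prems by (intro Suc.IH) auto
  moreover have "(n, i) \<in> J" for i using Suc.prems by auto
  ultimately show ?case by (simp del: restrict_apply add: restrict_apply')
qed simp

lemma indep_vars_coordinates:
  "prob_space.indep_vars (gw_space \<pi>) (\<lambda>_. measure_pmf \<pi>) (\<lambda>p \<omega>. \<omega> p) UNIV"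
proof -
  interpret prob_space "gw_space \<pi>" by (rule prob_space_gw_space)
  interpret P: product_prob_space "\<lambda>_. measure_pmf \<pi>" "UNIV :: (nat \<times> nat) set" by standard
  have m: "(\<lambda>\<omega>. \<omega> p) \<in> measurable (gw_space \<pi>) (measure_pmf \<pi>)" for p
    unfolding gw_space_def by (rule measurable_component_singleton) simp
  have "distr (gw_space \<pi>) (measure_pmf \<pi>) (\<lambda>\<omega>. \<omega> p) = measure_pmf \<pi>" for p
    unfolding gw_space_def by (rule P.PiM_component) simp
  then show ?thesis
    by (subst indep_vars_iff_distr_eq_PiM) (auto simp: m restrict_UNIV gw_space_def distr_id2)
qed

lemma nn_integral_offspring_power:
  assumes "0 \<le> s" "s \<le> 1"
  shows "(\<integral>\<^sup>+j. ennreal s ^ j \<partial>measure_pmf \<pi>) = ennreal (offspring_gf \<pi> s)"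
  using assms unfolding offspring_gf_def
  by (subst nn_integral_eq_integral[symmetric])
     (auto simp: ennreal_power power_le_one
      intro!: nn_integral_cong measure_pmf.integrable_const_bound[where B = 1])

lemma offspring_gf_bounds:
  assumes "0 \<le> s" "s \<le> 1"
  shows "0 \<le> offspring_gf \<pi> s" "offspring_gf \<pi> s \<le> 1"
proof -
  show "0 \<le> offspring_gf \<pi> s" using assms by (simp add: offspring_gf_def)
  have "offspring_gf \<pi> s \<le> measure_pmf.expectation \<pi> (\<lambda>j. 1)" unfolding offspring_gf_def
    using assms
    by (intro integral_mono) (auto simp: power_le_one intro!: measure_pmf.integrable_const_bound[where B = 1])
  then show "offspring_gf \<pi> s \<le> 1" by simp
qed

text \<open>
  On the event that generation \<open>n\<close> has size \<open>m\<close>, the next generation is a sum of \<open>m\<close> independent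
  family sizes that are also independent of this event, so \<open>s\<close> to that power has expectation
  \<open>(offspring_gf \<pi> s)^m\<close>.
\<close>

lemma galton_watson_branching:
  assumes s: "0 \<le> s" "s \<le> 1"
  shows "(\<integral>\<^sup>+\<omega>. ennreal s ^ galton_watson (Suc n) \<omega> \<partial>gw_space \<pi>)
       = (\<integral>\<^sup>+\<omega>. ennreal (offspring_gf \<pi> s) ^ galton_watson n \<omega> \<partial>gw_space \<pi>)"
proof -
  interpret prob_space "gw_space \<pi>" by (rule prob_space_gw_space)
  let ?G = "ennreal (offspring_gf \<pi> s)"
  have coord [measurable]: "(\<lambda>\<omega>. \<omega> p) \<in> measurable (gw_space \<pi>) (count_space UNIV)" for p
    using measurable_component_singleton[of p UNIV "\<lambda>_. measure_pmf \<pi>"] by (simp add: gw_space_def)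
  have [measurable, simp]: "(\<lambda>\<omega>. f (galton_watson n \<omega>)) \<in> borel_measurable (gw_space \<pi>)"
    for f :: "nat \<Rightarrow> ennreal"
    by (rule measurable_compose[OF measurable_galton_watson]) simp
  have [measurable, simp]: "(\<lambda>\<omega>. \<Prod>i<m. ennreal s ^ \<omega> (n, i)) \<in> borel_measurable (gw_space \<pi>)" for m
    by (intro borel_measurable_prod_ennreal measurable_compose[OF coord]) simp
  have split: "f (galton_watson n \<omega>) = (\<Sum>m. indicator {m} (galton_watson n \<omega>) * f m)"
    for f :: "nat \<Rightarrow> ennreal" and \<omega>
    by (subst suminf_finite[of "{galton_watson n \<omega>}"]) (auto simp: indicator_def)
  have generation: "(\<integral>\<^sup>+\<omega>. indicator {m} (galton_watson n \<omega>) * (\<Prod>i<m. ennreal s ^ \<omega> (n, i)) \<partial>gw_space \<pi>)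
      = (\<integral>\<^sup>+\<omega>. indicator {m} (galton_watson n \<omega>) * ?G ^ m \<partial>gw_space \<pi>)" for m
  proof -
    \<comment> \<open>The coordinates are grouped into the past (\<open>None\<close>) and one group for each individual of
      generation \<open>n\<close>.\<close>
    define K where "K = case_option {p. fst p < n} (\<lambda>i. {(n, i :: nat)})"
    define L where "L = insert None (Some ` {..<m})"
    define Y where "Y = case_option (\<lambda>\<omega>. indicator {m} (galton_watson n \<omega>) :: ennreal)
                          (\<lambda>i \<omega>. ennreal s ^ \<omega> (n, i))"
    have "indep_vars (\<lambda>o'. PiM (K o') (\<lambda>_. measure_pmf \<pi>)) (\<lambda>o' \<omega>. restrict (\<lambda>p. \<omega> p) (K o')) L"
      by (rule indep_vars_restrict[OF indep_vars_coordinates])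
         (auto simp: K_def L_def disjoint_family_on_def split: option.splits)
    then have "indep_vars (\<lambda>_. borel) (\<lambda>o' \<omega>. Y o' (restrict (\<lambda>p. \<omega> p) (K o'))) L"
    proof (rule indep_vars_compose2[where Y = Y and X = "\<lambda>o' \<omega>. restrict (\<lambda>p. \<omega> p) (K o')"])
      fix o' assume "o' \<in> L"
      show "Y o' \<in> borel_measurable (PiM (K o') (\<lambda>_. measure_pmf \<pi>))"
      proof (cases o')
        case None
        then show ?thesis
          using measurable_compose[OF measurable_galton_watson_PiM[of n "{p. fst p < n}" \<pi>],
              of "indicator {m} :: nat \<Rightarrow> ennreal" borel]
          by (simp add: Y_def K_def)
      next
        case (Some i)
        have "(\<lambda>\<omega>. \<omega> (n, i)) \<in> measurable (PiM {(n, i)} (\<lambda>_. measure_pmf \<pi>)) (measure_pmf \<pi>)"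
          by (rule measurable_component_singleton) simp
        then have "(\<lambda>\<omega>. \<omega> (n, i)) \<in> measurable (PiM {(n, i)} (\<lambda>_. measure_pmf \<pi>)) (count_space UNIV)"
          by simp
        then show ?thesis
          using Some by (auto simp: Y_def K_def)
      qed
    qed
    then have "(\<integral>\<^sup>+\<omega>. (\<Prod>o'\<in>L. Y o' (restrict (\<lambda>p. \<omega> p) (K o'))) \<partial>gw_space \<pi>)
        = (\<Prod>o'\<in>L. \<integral>\<^sup>+\<omega>. Y o' (restrict (\<lambda>p. \<omega> p) (K o')) \<partial>gw_space \<pi>)"
      by (intro indep_vars_nn_integral) (auto simp: L_def)
    moreover have "Y None (restrict (\<lambda>p. \<omega> p) (K None)) = indicator {m} (galton_watson n \<omega>)" for \<omega>
      by (simp add: Y_def K_def galton_watson_restrict)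
    moreover have "Y (Some i) (restrict (\<lambda>p. \<omega> p) (K (Some i))) = ennreal s ^ \<omega> (n, i)" for \<omega> i
      by (simp add: Y_def K_def)
    moreover have "(\<integral>\<^sup>+\<omega>. ennreal s ^ \<omega> (n, i) \<partial>gw_space \<pi>) = ?G" for i
    proof -
      interpret P: product_prob_space "\<lambda>_. measure_pmf \<pi>" "UNIV :: (nat \<times> nat) set" by standard
      have "(\<integral>\<^sup>+\<omega>. ennreal s ^ \<omega> (n, i) \<partial>gw_space \<pi>)
          = (\<integral>\<^sup>+j. ennreal s ^ j \<partial>distr (gw_space \<pi>) (measure_pmf \<pi>) (\<lambda>\<omega>. \<omega> (n, i)))"
        by (subst nn_integral_distr) (auto simp: gw_space_def intro!: measurable_component_singleton[of "(n, i)" UNIV "\<lambda>_. measure_pmf \<pi>", simplified])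
      also have "distr (gw_space \<pi>) (measure_pmf \<pi>) (\<lambda>\<omega>. \<omega> (n, i)) = measure_pmf \<pi>"
        unfolding gw_space_def by (rule P.PiM_component) simp
      finally show ?thesis using nn_integral_offspring_power[OF s] by simp
    qed
    moreover have "(\<Prod>o'\<in>L. f o') = f None * (\<Prod>i<m. f (Some i))" for f :: "_ \<Rightarrow> ennreal"
      by (simp add: L_def prod.reindex)
    moreover have "(\<integral>\<^sup>+\<omega>. indicator {m} (galton_watson n \<omega>) * ?G ^ m \<partial>gw_space \<pi>)
        = (\<integral>\<^sup>+\<omega>. indicator {m} (galton_watson n \<omega>) \<partial>gw_space \<pi>) * ?G ^ m"
      by (intro nn_integral_multc) simp
    ultimately show ?thesis by simp
  qed
  have "(\<integral>\<^sup>+\<omega>. ennreal s ^ galton_watson (Suc n) \<omega> \<partial>gw_space \<pi>)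
      = (\<integral>\<^sup>+\<omega>. (\<Sum>m. indicator {m} (galton_watson n \<omega>) * (\<Prod>i<m. ennreal s ^ \<omega> (n, i))) \<partial>gw_space \<pi>)"
    by (intro nn_integral_cong, subst split[symmetric]) (simp add: power_sum)
  also have "\<dots> = (\<Sum>m. \<integral>\<^sup>+\<omega>. indicator {m} (galton_watson n \<omega>) * (\<Prod>i<m. ennreal s ^ \<omega> (n, i)) \<partial>gw_space \<pi>)"
    by (intro nn_integral_suminf borel_measurable_times_ennreal) simp_all
  also have "\<dots> = (\<integral>\<^sup>+\<omega>. (\<Sum>m. indicator {m} (galton_watson n \<omega>) * ?G ^ m) \<partial>gw_space \<pi>)"
    unfolding generation by (intro nn_integral_suminf[symmetric] borel_measurable_times_ennreal) simp_all
  also have "\<dots> = (\<integral>\<^sup>+\<omega>. ?G ^ galton_watson n \<omega> \<partial>gw_space \<pi>)"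
    by (intro nn_integral_cong, subst split[symmetric]) simp
  finally show ?thesis .
qed

lemma galton_watson_gf:
  assumes "0 \<le> s" "s \<le> 1"
  shows "(\<integral>\<omega>. s ^ galton_watson n \<omega> \<partial>gw_space \<pi>) = (offspring_gf \<pi> ^^ n) s"
proof -
  interpret prob_space "gw_space \<pi>" by (rule prob_space_gw_space)
  have "(\<integral>\<^sup>+\<omega>. ennreal s ^ galton_watson n \<omega> \<partial>gw_space \<pi>) = ennreal ((offspring_gf \<pi> ^^ n) s)"
    using assms
  proof (induction n arbitrary: s)
    case 0
    then show ?case by (simp add: emeasure_space_1[simplified])
  next
    case (Suc n)
    then show ?case
      using galton_watson_branching[OF Suc.prems] Suc.IH[OF offspring_gf_bounds[OF Suc.prems]]
      by (simp add: funpow_swap1 del: galton_watson.simps)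
  qed
  moreover have "0 \<le> (offspring_gf \<pi> ^^ n) s \<and> (offspring_gf \<pi> ^^ n) s \<le> 1"
    using assms offspring_gf_bounds by (induction n) auto
  ultimately show ?thesis
    using assms
    by (intro integral_eq_nn_integral[THEN trans]) (auto simp: ennreal_power)
qed

lemma gw_phi_eq_gf:
  assumes "0 < h" "0 \<le> q"
  shows "gw_phi \<pi> h n q = (1 - (offspring_gf \<pi> ^^ n) (exp (- h * q))) / h"
proof -
  interpret prob_space "gw_space \<pi>" by (rule prob_space_gw_space)
  let ?s = "exp (- h * q)"
  have s: "0 \<le> ?s" "?s \<le> 1" using assms by auto
  have "exp (- h * q * real (galton_watson n \<omega>)) = ?s ^ galton_watson n \<omega>" for \<omega>
    by (simp add: exp_of_nat_mult[symmetric] mult_ac)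
  moreover have "integrable (gw_space \<pi>) (\<lambda>\<omega>. ?s ^ galton_watson n \<omega>)"
    using s by (intro integrable_const_bound[where B = 1]) (auto simp: power_le_one)
  ultimately show ?thesis
    using galton_watson_gf[OF s, of \<pi> n] by (simp add: gw_phi_def prob_space[simplified])
qed

text \<open>
  One generation changes \<open>u = gw_phi \<pi> h n q\<close> by \<open>- \<tau>\<close> times this function of \<open>u\<close>, so \<open>gw_phi\<close> is the
  explicit Euler scheme with step \<open>\<tau>\<close> for the discrete mechanism.
\<close>

definition discrete_mechanism :: "nat pmf \<Rightarrow> real \<Rightarrow> real \<Rightarrow> real \<Rightarrow> real" where
  "discrete_mechanism \<pi> h \<tau> u = (offspring_gf \<pi> (1 - h * u) - (1 - h * u)) / (h * \<tau>)"

lemma offspring_mean: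
  assumes "(\<lambda>j. real j * pmf \<pi> j) sums 1"
  shows "integrable (measure_pmf \<pi>) real" "measure_pmf.expectation \<pi> real = 1"
proof -
  have "summable (\<lambda>j. norm (pmf \<pi> j * real j))"
    using assms by (simp add: sums_iff mult.commute)
  then have i: "integrable (count_space UNIV) (\<lambda>j. pmf \<pi> j *\<^sub>R real j)"
    by (simp add: integrable_count_space_nat_iff)
  then show "integrable (measure_pmf \<pi>) real"
    unfolding measure_pmf_eq_density by (subst integrable_density) auto
  have "measure_pmf.expectation \<pi> real = (\<integral>j. pmf \<pi> j *\<^sub>R real j \<partial>count_space UNIV)"
    unfolding measure_pmf_eq_density by (subst integral_density) auto
  also have "\<dots> = 1"
    using sums_integral_count_space_nat[OF i] assms by (auto simp: mult.commute intro: sums_unique2)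
  finally show "measure_pmf.expectation \<pi> real = 1" .
qed

text \<open>
  The derivative of the generating function is at most its value at \<open>1\<close>, the mean, which is one.
\<close>

lemma offspring_gf_increment:
  assumes mean: "(\<lambda>j. real j * pmf \<pi> j) sums 1" and st: "0 \<le> s" "s \<le> t" "t \<le> 1"
  shows "0 \<le> offspring_gf \<pi> t - offspring_gf \<pi> s" "offspring_gf \<pi> t - offspring_gf \<pi> s \<le> t - s"
proof -
  have i: "integrable (measure_pmf \<pi>) (\<lambda>j. r ^ j)" if "0 \<le> r" "r \<le> 1" for r :: real
    using that by (intro measure_pmf.integrable_const_bound[where B = 1]) (auto simp: power_le_one)
  have eq: "offspring_gf \<pi> t - offspring_gf \<pi> s = measure_pmf.expectation \<pi> (\<lambda>j. t ^ j - s ^ j)"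
    using st by (simp add: offspring_gf_def i)
  show "0 \<le> offspring_gf \<pi> t - offspring_gf \<pi> s"
    unfolding eq using st by (intro Bochner_Integration.integral_nonneg) (auto intro: power_mono)
  have term_le: "t ^ j - s ^ j \<le> (t - s) * real j" for j
  proof (induction j)
    case (Suc j)
    have "t ^ Suc j - s ^ Suc j = t * (t ^ j - s ^ j) + (t - s) * s ^ j" by (simp add: algebra_simps)
    also have "t * (t ^ j - s ^ j) \<le> 1 * (t ^ j - s ^ j)"
      using st by (intro mult_right_mono) (auto intro: power_mono)
    also have "(t - s) * s ^ j \<le> (t - s) * 1"
      using st by (intro mult_left_mono) (auto intro: power_le_one)
    finally show ?case using Suc by (simp add: algebra_simps)
  qed simp
  have "measure_pmf.expectation \<pi> (\<lambda>j. t ^ j - s ^ j) \<le> measure_pmf.expectation \<pi> (\<lambda>j. (t - s) * real j)"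
    using st i offspring_mean(1)[OF mean] term_le by (intro integral_mono) auto
  then show "offspring_gf \<pi> t - offspring_gf \<pi> s \<le> t - s"
    using offspring_mean[OF mean] unfolding eq by simp
qed

lemma offspring_gf_1 [simp]: "offspring_gf \<pi> 1 = 1"
  by (simp add: offspring_gf_def)

text \<open>
  In terms of the generating function \<open>G\<close> a step maps \<open>u\<close> to \<open>(1 - G (1 - h u)) / h\<close>, and \<open>G\<close> is
  nonexpansive by criticality.
\<close>

lemma discrete_step_nonexpansive:
  assumes "(\<lambda>j. real j * pmf \<pi> j) sums 1" "0 < h" "0 < \<tau>"
    and "v \<in> {0..1 / h}" "w \<in> {0..1 / h}"
  shows "\<bar>(v - \<tau> * discrete_mechanism \<pi> h \<tau> v) - (w - \<tau> * discrete_mechanism \<pi> h \<tau> w)\<bar> \<le> \<bar>v - w\<bar>"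
proof -
  have step: "u - \<tau> * discrete_mechanism \<pi> h \<tau> u = (1 - offspring_gf \<pi> (1 - h * u)) / h" for u
    using assms by (simp add: discrete_mechanism_def field_simps)
  have le: "\<bar>(1 - offspring_gf \<pi> (1 - h * a)) / h - (1 - offspring_gf \<pi> (1 - h * b)) / h\<bar> \<le> \<bar>a - b\<bar>"
    if "a \<le> b" "a \<in> {0..1 / h}" "b \<in> {0..1 / h}" for a b
  proof -
    have ab: "0 \<le> 1 - h * b" "1 - h * b \<le> 1 - h * a" "1 - h * a \<le> 1"
      using that assms by (auto simp: field_simps)
    have "\<bar>offspring_gf \<pi> (1 - h * a) - offspring_gf \<pi> (1 - h * b)\<bar> / h \<le> (h * (b - a)) / h"
      using offspring_gf_increment[OF assms(1) ab] \<open>0 < h\<close>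
      by (intro divide_right_mono) (auto simp: algebra_simps)
    then show ?thesis using that \<open>0 < h\<close>
      by (simp add: diff_divide_distrib[symmetric] abs_divide abs_minus_commute)
  qed
  show ?thesis unfolding step
    using le[of v w] le[of w v] assms(4,5) by (cases "v \<le> w") (auto simp: abs_minus_commute)
qed

text \<open>
  If \<open>u \<mapsto> u - \<tau> \<Psi> u\<close> does not increase distances, then \<open>\<Psi>\<close> has to be nondecreasing.
\<close>

lemma discrete_mechanism_mono:
  assumes "(\<lambda>j. real j * pmf \<pi> j) sums 1" "0 < h" "0 < \<tau>"
  shows "mono_on {0..1 / h} (discrete_mechanism \<pi> h \<tau>)"
proof (rule mono_onI)
  fix v w assume "v \<in> {0..1 / h}" "w \<in> {0..1 / h}" "v \<le> w"
  then have "0 \<le> \<tau> * (discrete_mechanism \<pi> h \<tau> w - discrete_mechanism \<pi> h \<tau> v)"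
    using discrete_step_nonexpansive[OF assms, of v w] by (simp add: algebra_simps)
  then show "discrete_mechanism \<pi> h \<tau> v \<le> discrete_mechanism \<pi> h \<tau> w"
    using \<open>0 < \<tau>\<close> by (simp add: zero_le_mult_iff)
qed

lemma discrete_mechanism_0 [simp]: "discrete_mechanism \<pi> h \<tau> 0 = 0"
  by (simp add: discrete_mechanism_def)

lemma gw_phi_0:
  assumes "0 < h" "0 \<le> q" shows "gw_phi \<pi> h 0 q = (1 - exp (- h * q)) / h"
  using gw_phi_eq_gf[OF assms, of \<pi> 0] by simp

lemma gw_phi_Suc:
  assumes "0 < h" "0 < \<tau>" "0 \<le> q"
  shows "gw_phi \<pi> h (Suc n) q = gw_phi \<pi> h n q - \<tau> * discrete_mechanism \<pi> h \<tau> (gw_phi \<pi> h n q)"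
  using assms by (simp add: gw_phi_eq_gf discrete_mechanism_def field_simps)

lemma gw_phi_range:
  assumes "(\<lambda>j. real j * pmf \<pi> j) sums 1" "0 < h" "0 \<le> q"
  shows "0 \<le> gw_phi \<pi> h n q" "gw_phi \<pi> h n q \<le> q" "gw_phi \<pi> h n q \<le> 1 / h"
proof -
  let ?s = "exp (- h * q)"
  have s: "0 \<le> ?s" "?s \<le> 1" using assms by auto
  have "?s \<le> (offspring_gf \<pi> ^^ n) ?s \<and> (offspring_gf \<pi> ^^ n) ?s \<le> 1"
  proof (induction n)
    case (Suc n)
    let ?r = "(offspring_gf \<pi> ^^ n) ?s"
    have r: "0 \<le> ?r" "?r \<le> 1" using Suc s(1) by linarith+
    have "?r \<le> offspring_gf \<pi> ?r" using offspring_gf_increment(2)[OF assms(1) r] by simp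
    then show ?case using Suc offspring_gf_bounds[OF r] by auto
  qed (use s in auto)
  then have *: "1 - (offspring_gf \<pi> ^^ n) ?s \<le> 1 - ?s" "0 \<le> 1 - (offspring_gf \<pi> ^^ n) ?s"
    and nonneg: "(0::real) \<le> (offspring_gf \<pi> ^^ n) ?s" using exp_gt_zero[of "- h * q"] by linarith+
  show "0 \<le> gw_phi \<pi> h n q" "gw_phi \<pi> h n q \<le> 1 / h"
    using * nonneg assms by (auto simp: gw_phi_eq_gf intro!: divide_right_mono)
  have "1 - ?s \<le> q * h" using exp_ge_add_one_self[of "- h * q"] by (simp add: mult.commute)
  then show "gw_phi \<pi> h n q \<le> q"
    using * assms by (auto simp: gw_phi_eq_gf divide_le_eq)
qed

text \<open>
  The measure \<open>min x 1\<close> times \<open>breve_mu \<pi> h \<tau>\<close>, transported to \<open>[0, 1]\<close> by \<open>y = exp (- x)\<close>. The weight vanishes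
  for \<open>j = 0\<close> and \<open>j = 1\<close>, in accordance with the restriction to \<open>j \<ge> 2\<close> in \<open>breve_mu\<close>.
\<close>

definition compactified_levy :: "nat pmf \<Rightarrow> real \<Rightarrow> real \<Rightarrow> real measure" where
  "compactified_levy \<pi> h \<tau> =
     distr (density (measure_pmf \<pi>) (\<lambda>j. ennreal ((real j - 1) / \<tau> * min (real j * h) 1)))
       borel (\<lambda>j. exp (- (real j * h)))"

lemma levy_weight_bounds:
  assumes "0 < h" "0 < \<tau>"
  shows "0 \<le> (real j - 1) / \<tau> * min (real j * h) 1"
    and "(real j - 1) / \<tau> * min (real j * h) 1 \<le> real j / \<tau>"
proof -
  show "0 \<le> (real j - 1) / \<tau> * min (real j * h) 1" using assms by (cases j) auto
  show "(real j - 1) / \<tau> * min (real j * h) 1 \<le> real j / \<tau>"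
  proof (cases j)
    case (Suc i)
    have "(real j - 1) / \<tau> * min (real j * h) 1 \<le> (real j - 1) / \<tau> * 1"
      using assms Suc by (intro mult_left_mono) auto
    also have "\<dots> \<le> real j / \<tau>" using assms by (simp add: divide_right_mono)
    finally show ?thesis .
  qed simp
qed

lemma integral_compactified_levy:
  assumes "0 < h" "0 < \<tau>" and [measurable]: "F \<in> borel_measurable borel"
  shows "(\<integral>y. F y \<partial>compactified_levy \<pi> h \<tau>)
       = measure_pmf.expectation \<pi> (\<lambda>j. (real j - 1) / \<tau> * min (real j * h) 1 * F (exp (- (real j * h))) :: real)"
  unfolding compactified_levy_def
  by (subst integral_distr, simp_all, subst integral_density)
     (use levy_weight_bounds(1)[OF assms(1,2)] in auto)

lemma finite_measure_compactified_levy: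
  assumes "(\<lambda>j. real j * pmf \<pi> j) sums 1" "0 < h" "0 < \<tau>"
  shows "finite_measure (compactified_levy \<pi> h \<tau>)"
proof (rule finite_measureI)
  have "emeasure (compactified_levy \<pi> h \<tau>) (space (compactified_levy \<pi> h \<tau>))
      = (\<integral>\<^sup>+j. ennreal ((real j - 1) / \<tau> * min (real j * h) 1) \<partial>measure_pmf \<pi>)"
    unfolding compactified_levy_def by (simp add: emeasure_distr emeasure_density)
  also have "\<dots> \<le> (\<integral>\<^sup>+j. ennreal (real j / \<tau>) \<partial>measure_pmf \<pi>)"
    by (intro nn_integral_mono ennreal_leI levy_weight_bounds assms)
  also have "\<dots> < \<infinity>"
    using offspring_mean(1)[OF assms(1)] assms
    by (subst nn_integral_eq_integral) auto
  finally show "emeasure (compactified_levy \<pi> h \<tau>) (space (compactified_levy \<pi> h \<tau>)) \<noteq> \<infinity>"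
    by simp
qed

lemma sets_compactified_levy [simp, measurable_cong]: "sets (compactified_levy \<pi> h \<tau>) = sets borel"
  by (simp add: compactified_levy_def)

lemma AE_compactified_levy:
  assumes "0 < h"
  shows "AE y in compactified_levy \<pi> h \<tau>. y \<in> {0..1}"
  unfolding compactified_levy_def
  using assms by (subst AE_distr_iff) auto

lemma abs_expectation_diff_le:
  fixes f g b :: "nat \<Rightarrow> real"
  assumes "integrable (measure_pmf \<pi>) f" "integrable (measure_pmf \<pi>) g" "integrable (measure_pmf \<pi>) b"
    and "\<And>j. \<bar>f j - g j\<bar> \<le> b j"
  shows "\<bar>measure_pmf.expectation \<pi> f - measure_pmf.expectation \<pi> g\<bar> \<le> measure_pmf.expectation \<pi> b"
proof -
  have "\<bar>measure_pmf.expectation \<pi> f - measure_pmf.expectation \<pi> g\<bar>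
      = \<bar>measure_pmf.expectation \<pi> (\<lambda>j. f j - g j)\<bar>"
    using assms by simp
  also have "\<dots> \<le> measure_pmf.expectation \<pi> (\<lambda>j. \<bar>f j - g j\<bar>)"
    by (rule integral_abs_bound)
  also have "\<dots> \<le> measure_pmf.expectation \<pi> b"
    using assms by (intro integral_mono) auto
  finally show ?thesis .
qed

text \<open>
  Because the mean is one, \<open>offspring_gf \<pi> (1 - s) - (1 - s)\<close> is the expectation of the compensated terms
  \<open>(1 - s)^j - 1 + j s\<close>, to which the comparison with the kernel applies. The error is \<open>O(h)\<close> times the
  total mass.
\<close>

lemma discrete_mechanism_near_kernel_integral:
  assumes mean: "(\<lambda>j. real j * pmf \<pi> j) sums 1" and "0 < h" "h \<le> 1/2" "0 < \<tau>" "0 \<le> u" "h * u \<le> 1/2"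
  shows "\<bar>discrete_mechanism \<pi> h \<tau> u - (\<integral>y. compact_kernel u y \<partial>compactified_levy \<pi> h \<tau>)\<bar>
       \<le> (u ^ 3 + 6 * u + 2) * h * measure (compactified_levy \<pi> h \<tau>) UNIV"
proof -
  let ?E = "measure_pmf.expectation \<pi>"
  define C where "C = u ^ 3 + 6 * u + 2"
  define w where "w j = (real j - 1) / \<tau> * min (real j * h) 1" for j
  define g where "g j = compact_kernel u (exp (- (real j * h)))" for j
  define n where "n j = (1 - h * u) ^ j - 1 + real j * (h * u)" for j
  have w: "0 \<le> w j" "w j \<le> real j / \<tau>" for j
    unfolding w_def by (rule levy_weight_bounds[OF \<open>0 < h\<close> \<open>0 < \<tau>\<close>])+
  have g: "0 \<le> g j" "g j \<le> u * (1 + u)" for j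
    using assms by (auto simp: g_def intro!: compact_kernel_bounds)
  have int_w: "integrable (measure_pmf \<pi>) w"
  proof (rule Bochner_Integration.integrable_bound)
    show "integrable (measure_pmf \<pi>) (\<lambda>j. real j / \<tau>)" using offspring_mean(1)[OF mean] by simp
    have "norm (w j) \<le> norm (real j / \<tau>)" for j
      using w[of j] unfolding real_norm_def by linarith
    then show "AE j in measure_pmf \<pi>. norm (w j) \<le> norm (real j / \<tau>)" by (intro AE_I2)
  qed simp
  have int_wg: "integrable (measure_pmf \<pi>) (\<lambda>j. w j * g j)"
  proof (rule Bochner_Integration.integrable_bound)
    show "integrable (measure_pmf \<pi>) (\<lambda>j. w j * (u * (1 + u)))" using int_w by (rule integrable_mult_left)
    have "norm (w j * g j) \<le> norm (w j * (u * (1 + u)))" for j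
      using mult_left_mono[OF g(2) w(1), of j j] mult_nonneg_nonneg[OF w(1) g(1), of j j]
      unfolding real_norm_def by linarith
    then show "AE j in measure_pmf \<pi>. norm (w j * g j) \<le> norm (w j * (u * (1 + u)))" by (intro AE_I2)
  qed simp
  have int_p: "integrable (measure_pmf \<pi>) (\<lambda>j. (1 - h * u) ^ j)"
    using assms by (intro measure_pmf.integrable_const_bound[where B = 1]) (auto simp: power_le_one)
  have int_l: "integrable (measure_pmf \<pi>) (\<lambda>j. real j * (h * u))"
    using offspring_mean(1)[OF mean] by (rule integrable_mult_left)
  have int_c: "integrable (measure_pmf \<pi>) (\<lambda>j. (1 - h * u) ^ j - 1)"
    using int_p by (rule Bochner_Integration.integrable_diff) simp
  have n_eq: "n = (\<lambda>j. ((1 - h * u) ^ j - 1) + real j * (h * u))" by (simp add: n_def fun_eq_iff)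
  have int_n: "integrable (measure_pmf \<pi>) n"
    unfolding n_eq using int_c int_l by (rule Bochner_Integration.integrable_add)
  have "?E n = ?E (\<lambda>j. (1 - h * u) ^ j - 1) + ?E (\<lambda>j. real j * (h * u))"
    unfolding n_eq using int_c int_l by (rule Bochner_Integration.integral_add)
  also have "?E (\<lambda>j. (1 - h * u) ^ j - 1) = offspring_gf \<pi> (1 - h * u) - 1"
    using Bochner_Integration.integral_diff[OF int_p measure_pmf.integrable_const[of _ 1]]
    by (simp add: offspring_gf_def)
  also have "?E (\<lambda>j. real j * (h * u)) = h * u"
    using offspring_mean(2)[OF mean] by simp
  finally have mech: "discrete_mechanism \<pi> h \<tau> u = ?E (\<lambda>j. n j / (h * \<tau>))"
    by (simp add: discrete_mechanism_def integral_divide_zero)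
  have mass: "measure (compactified_levy \<pi> h \<tau>) UNIV = ?E w"
    using integral_compactified_levy[OF \<open>0 < h\<close> \<open>0 < \<tau>\<close>, of "\<lambda>_. 1" \<pi>]
      sets_eq_imp_space_eq[OF sets_compactified_levy, of \<pi> h \<tau>]
    by (simp add: w_def[abs_def])
  have kernel: "(\<integral>y. compact_kernel u y \<partial>compactified_levy \<pi> h \<tau>) = ?E (\<lambda>j. w j * g j)"
    unfolding integral_compactified_levy[OF \<open>0 < h\<close> \<open>0 < \<tau>\<close> measurable_compact_kernel] w_def g_def ..
  have "\<bar>n j / (h * \<tau>) - w j * g j\<bar> \<le> C * h * w j" for j
  proof -
    define V where "V = (real j - 1) * min (real j * h) 1"
    have wV: "w j = V / \<tau>" by (simp add: w_def V_def)
    have "\<bar>n j - h * (V * g j)\<bar> \<le> C * h * (h * V)"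
      using generation_term_near_kernel_term[OF \<open>0 < h\<close> \<open>h \<le> 1/2\<close> \<open>0 \<le> u\<close> \<open>h * u \<le> 1/2\<close>, of j]
      unfolding n_def g_def V_def C_def .
    then have "\<bar>n j - h * (V * g j)\<bar> / (h * \<tau>) \<le> C * h * (h * V) / (h * \<tau>)"
      using assms by (intro divide_right_mono) auto
    moreover have "\<bar>n j - h * (V * g j)\<bar> / (h * \<tau>) = \<bar>n j / (h * \<tau>) - w j * g j\<bar>"
    proof -
      have "n j / (h * \<tau>) - w j * g j = (n j - h * (V * g j)) / (h * \<tau>)"
        unfolding wV using assms by (simp add: field_simps)
      then show ?thesis using assms by (simp add: abs_divide abs_mult)
    qed
    ultimately show ?thesis unfolding wV using assms by simp
  qed
  then have "\<bar>?E (\<lambda>j. n j / (h * \<tau>)) - ?E (\<lambda>j. w j * g j)\<bar> \<le> ?E (\<lambda>j. C * h * w j)"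
    by (intro abs_expectation_diff_le integrable_divide int_n int_wg integrable_mult_right int_w)
  also have "?E (\<lambda>j. C * h * w j) = C * h * ?E w" by (rule integral_mult_right_zero)
  finally show ?thesis unfolding mech mass kernel C_def .
qed

section \<open>Finite measures on the unit interval\<close>

definition unit_interval_measure :: "real measure \<Rightarrow> bool" where
  "unit_interval_measure \<Lambda> \<longleftrightarrow> sets \<Lambda> = sets borel \<and> finite_measure \<Lambda> \<and> (AE y in \<Lambda>. y \<in> {0..1})"

text \<open>
  Measurability is asked for on all of \<open>\<real>\<close>, because the measures live on the Borel sets of \<open>\<real>\<close> and are
  merely concentrated on \<open>[0, 1]\<close>.
\<close>

definition unit_interval_test :: "(real \<Rightarrow> real) \<Rightarrow> bool" where
  "unit_interval_test F \<longleftrightarrow> continuous_on {0..1} F \<and> F \<in> borel_measurable borel"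

lemma unit_interval_measure_measurable:
  assumes "unit_interval_measure \<Lambda>" shows "borel_measurable \<Lambda> = borel_measurable borel"
  using assms by (auto simp: unit_interval_measure_def intro: measurable_cong_sets)

lemma unit_interval_measure_space:
  assumes "unit_interval_measure \<Lambda>" shows "space \<Lambda> = UNIV"
  using assms sets_eq_imp_space_eq[of \<Lambda> borel] by (simp add: unit_interval_measure_def)

lemma unit_interval_test_bounded:
  assumes "unit_interval_test F"
  obtains B where "0 < B" "\<And>y. y \<in> {0..1} \<Longrightarrow> \<bar>F y\<bar> \<le> B"
proof -
  have "bounded (F ` {0..1})"
    using assms by (intro compact_imp_bounded compact_continuous_image) (auto simp: unit_interval_test_def)
  then show ?thesis using that by (auto simp: bounded_pos)
qed

lemma integrable_unit_interval_bounded: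
  fixes F :: "real \<Rightarrow> real"
  assumes "unit_interval_measure \<Lambda>" "F \<in> borel_measurable borel" "\<And>y. y \<in> {0..1} \<Longrightarrow> \<bar>F y\<bar> \<le> B"
  shows "integrable \<Lambda> F"
proof -
  interpret finite_measure \<Lambda> using assms by (simp add: unit_interval_measure_def)
  show ?thesis
    using assms by (intro integrable_const_bound[where B = B])
      (auto simp: unit_interval_measure_def unit_interval_measure_measurable)
qed

lemma integrable_unit_interval_test:
  assumes "unit_interval_measure \<Lambda>" "unit_interval_test F"
  shows "integrable \<Lambda> F"
  using unit_interval_test_bounded[OF assms(2)] integrable_unit_interval_bounded[OF assms(1)] assms(2)
  by (metis unit_interval_test_def)

lemma integral_unit_interval_cong:
  fixes F :: "real \<Rightarrow> real"
  assumes "unit_interval_measure \<Lambda>" "F \<in> borel_measurable borel" "G \<in> borel_measurable borel"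
    and "\<And>y. y \<in> {0..1} \<Longrightarrow> F y = G y"
  shows "(\<integral>y. F y \<partial>\<Lambda>) = (\<integral>y. G y \<partial>\<Lambda>)"
  using assms by (intro integral_cong_AE)
    (auto simp: unit_interval_measure_measurable unit_interval_measure_def)

lemma integral_unit_interval_bounded_convergence:
  assumes \<Lambda>: "unit_interval_measure \<Lambda>"
    and F: "F \<in> borel_measurable borel" "\<And>n. f n \<in> borel_measurable borel"
    and lim: "\<And>y. y \<in> {0..1} \<Longrightarrow> (\<lambda>n. f n y) \<longlonglongrightarrow> F y"
    and bound: "\<And>n y. y \<in> {0..1} \<Longrightarrow> \<bar>f n y\<bar> \<le> (B :: real)"
  shows "(\<lambda>n. \<integral>y. f n y \<partial>\<Lambda>) \<longlonglongrightarrow> (\<integral>y. F y \<partial>\<Lambda>)"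
proof (rule integral_dominated_convergence[where w = "\<lambda>_. B"])
  interpret finite_measure \<Lambda> using \<Lambda> by (simp add: unit_interval_measure_def)
  have AE: "AE y in \<Lambda>. y \<in> {0..1}" using \<Lambda> by (simp add: unit_interval_measure_def)
  show "AE y in \<Lambda>. (\<lambda>n. f n y) \<longlonglongrightarrow> F y" using AE by eventually_elim (rule lim)
  show "AE y in \<Lambda>. norm (f n y) \<le> B" for n using AE by eventually_elim (simp add: bound)
qed (use F \<Lambda> in \<open>auto simp: unit_interval_measure_measurable unit_interval_measure_def
       intro!: finite_measure.integrable_const\<close>)

lemma unit_interval_test_compact_kernel:
  "0 \<le> u \<Longrightarrow> unit_interval_test (compact_kernel u)"
  unfolding unit_interval_test_def
  by (intro conjI continuous_on_compact_kernel) (assumption, rule measurable_compact_kernel)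

lemma tendsto_subsubsequence:
  fixes f :: "nat \<Rightarrow> 'a::metric_space"
  assumes "\<And>r. strict_mono r \<Longrightarrow> \<exists>s. strict_mono (s :: nat \<Rightarrow> nat) \<and> (\<lambda>k. f (r (s k))) \<longlonglongrightarrow> l"
  shows "f \<longlonglongrightarrow> l"
proof (rule ccontr)
  assume "\<not> f \<longlonglongrightarrow> l"
  then obtain e where "0 < e" and freq: "\<exists>\<^sub>F n in sequentially. \<not> dist (f n) l < e"
    by (auto simp: tendsto_iff frequently_def)
  define A where "A = {n. \<not> dist (f n) l < e}"
  have "infinite A"
    using freq by (simp add: A_def frequently_cofinite[symmetric] cofinite_eq_sequentially)
  then have r: "strict_mono (enumerate A)" "\<And>n. enumerate A n \<in> A"
    by (auto intro: strict_mono_enumerate enumerate_in_set)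
  then obtain s where "(\<lambda>k. f (enumerate A (s k))) \<longlonglongrightarrow> l" using assms by blast
  then have "\<forall>\<^sub>F k in sequentially. dist (f (enumerate A (s k))) l < e"
    using \<open>0 < e\<close> by (rule tendstoD)
  then obtain k where "dist (f (enumerate A (s k))) l < e"
    by (auto simp: eventually_sequentially)
  then show False using r(2)[of "s k"] by (simp add: A_def)
qed

lemma clamped_test_continuous:
  assumes "unit_interval_test F"
  shows "continuous_on UNIV (\<lambda>y. F (max 0 (min 1 y)))"
  by (rule continuous_on_compose2[of "{0..1}" F])
     (use assms in \<open>auto simp: unit_interval_test_def intro!: continuous_intros\<close>)

text \<open>
  Probability measures on \<open>[0, 1]\<close> are tight, so Helly's theorem applies. The limit charges only
  \<open>[0, 1]\<close>, as the truncated distance to this interval has integral zero along the sequence.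
\<close>

lemma unit_interval_prob_compactness:
  assumes P: "\<And>k. unit_interval_measure (P k)" "\<And>k. prob_space (P k)"
  obtains r Q where "strict_mono (r :: nat \<Rightarrow> nat)" "unit_interval_measure Q"
    "\<And>F. unit_interval_test F \<Longrightarrow> (\<lambda>k. \<integral>y. F y \<partial>P (r k)) \<longlonglongrightarrow> (\<integral>y. F y \<partial>Q)"
proof -
  have dist: "real_distribution (P k)" for k
    using P[of k] by (simp add: real_distribution_def real_distribution_axioms_def unit_interval_measure_def)
  have "tight P"
    unfolding tight_def
  proof (intro conjI allI impI dist)
    fix e :: real assume "0 < e"
    have "measure (P k) {-1<..1} = 1" for k
    proof -
      interpret prob_space "P k" by (rule P)
      have "AE y in P k. y \<in> {0..1}" using P by (simp add: unit_interval_measure_def)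
      then have "AE y in P k. y \<in> {-1<..1}" by eventually_elim auto
      moreover have "{-1<..1} \<in> sets (P k)" using P by (simp add: unit_interval_measure_def)
      ultimately show ?thesis by (simp add: prob_eq_1)
    qed
    then show "\<exists>a b. a < b \<and> (\<forall>n. 1 - e < measure (P n) {a<..b})"
      using \<open>0 < e\<close> by (intro exI[of _ "-1"] exI[of _ 1]) auto
  qed
  then have "\<exists>r Q. strict_mono (r :: nat \<Rightarrow> nat) \<and> real_distribution Q \<and> weak_conv_m (P \<circ> id \<circ> r) Q"
    by (rule tight_imp_convergent_subsubsequence) (simp add: strict_mono_def)
  then obtain r Q where r: "strict_mono (r :: nat \<Rightarrow> nat)" and Q: "real_distribution Q"
    and conv: "weak_conv_m (P \<circ> id \<circ> r) Q"
    by blast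
  interpret Q: real_distribution Q by fact
  have lim: "(\<lambda>k. \<integral>y. f y \<partial>P (r k)) \<longlonglongrightarrow> (\<integral>y. f y \<partial>Q)"
    if "continuous_on UNIV f" "\<And>y. \<bar>f y\<bar> \<le> B" for f :: "real \<Rightarrow> real" and B
  proof -
    have "(\<lambda>k. \<integral>y. f y \<partial>(P \<circ> id \<circ> r) k) \<longlonglongrightarrow> (\<integral>y. f y \<partial>Q)"
    proof (rule weak_conv_imp_integral_bdd_continuous_conv[OF _ Q conv])
      show "real_distribution ((P \<circ> id \<circ> r) n)" for n by (simp add: dist)
      show "isCont f y" for y using that(1) by (simp add: continuous_on_eq_continuous_at)
      show "norm (f y) \<le> B" for y using that(2) by simp
    qed
    then show ?thesis by (simp add: comp_def)
  qed
  define d where "d y = min 1 \<bar>y - max 0 (min 1 y)\<bar>" for y :: real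
  have d: "continuous_on UNIV d" "\<And>y. \<bar>d y\<bar> \<le> 1" "\<And>y. 0 \<le> d y" "\<And>y. d y = 0 \<longleftrightarrow> y \<in> {0..1}"
    unfolding d_def by (auto intro!: continuous_intros)
  have d_meas: "d \<in> borel_measurable borel" using d(1) by (rule borel_measurable_continuous_onI)
  have "(\<integral>y. d y \<partial>P k) = (\<integral>y. 0 \<partial>P k)" for k
    using d(4) by (intro integral_unit_interval_cong[OF P(1)] d_meas) auto
  then have "(\<lambda>k. 0) \<longlonglongrightarrow> (\<integral>y. d y \<partial>Q)"
    using lim[OF d(1,2)] by simp
  then have "(\<integral>y. d y \<partial>Q) = 0"
    by (simp add: LIMSEQ_const_iff)
  moreover have "integrable Q d"
    using d by (intro Q.integrable_const_bound[where B = 1]) (auto simp: d_meas)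
  ultimately have "AE y in Q. d y = 0"
    using d(3) by (subst (asm) integral_nonneg_eq_0_iff_AE) auto
  then have Q': "unit_interval_measure Q"
    by (simp add: unit_interval_measure_def d(4) Q.finite_measure_axioms)
  have "(\<lambda>k. \<integral>y. F y \<partial>P (r k)) \<longlonglongrightarrow> (\<integral>y. F y \<partial>Q)" if F: "unit_interval_test F" for F
  proof -
    let ?G = "\<lambda>y. F (max 0 (min 1 y))"
    obtain B where "\<And>y. y \<in> {0..1} \<Longrightarrow> \<bar>F y\<bar> \<le> B" using unit_interval_test_bounded[OF F] by blast
    then have "(\<lambda>k. \<integral>y. ?G y \<partial>P (r k)) \<longlonglongrightarrow> (\<integral>y. ?G y \<partial>Q)"
      by (intro lim[of _ B] clamped_test_continuous F) auto
    moreover have "(\<integral>y. ?G y \<partial>N) = (\<integral>y. F y \<partial>N)" if "unit_interval_measure N" for N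
    proof (rule integral_unit_interval_cong[OF that])
      show "?G \<in> borel_measurable borel"
        by (intro borel_measurable_continuous_onI clamped_test_continuous F)
    qed (use F in \<open>auto simp: unit_interval_test_def\<close>)
    ultimately show ?thesis using P Q' by simp
  qed
  then show ?thesis using that r Q' by blast
qed

lemma unit_interval_measure_scale:
  assumes "unit_interval_measure \<Lambda>" "0 \<le> c"
  shows "unit_interval_measure (density \<Lambda> (\<lambda>_. ennreal c))"
    and "F \<in> borel_measurable borel \<Longrightarrow> (\<integral>y. F y \<partial>density \<Lambda> (\<lambda>_. ennreal c)) = c * (\<integral>y. F y \<partial>\<Lambda>)"
proof -
  interpret finite_measure \<Lambda> using assms by (simp add: unit_interval_measure_def)
  have "finite_measure (density \<Lambda> (\<lambda>_. ennreal c))"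
    by (rule finite_measureI) (simp add: emeasure_density ennreal_mult_eq_top_iff)
  then show "unit_interval_measure (density \<Lambda> (\<lambda>_. ennreal c))"
    using assms by (auto simp: unit_interval_measure_def AE_density)
  show "(\<integral>y. F y \<partial>density \<Lambda> (\<lambda>_. ennreal c)) = c * (\<integral>y. F y \<partial>\<Lambda>)" if "F \<in> borel_measurable borel"
    using that assms by (subst integral_density) (auto simp: unit_interval_measure_measurable)
qed

text \<open>
  First a subsequence along which the total masses converge is chosen. If their limit is positive, the
  measures are normalised, otherwise they converge to the null measure.
\<close>

lemma unit_interval_compactness:
  assumes \<Lambda>: "\<And>k. unit_interval_measure (\<Lambda> k)" and mass: "\<And>k. measure (\<Lambda> k) UNIV \<le> K"
  obtains r \<Lambda>' where "strict_mono (r :: nat \<Rightarrow> nat)" "unit_interval_measure \<Lambda>'"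
    "\<And>F. unit_interval_test F \<Longrightarrow> (\<lambda>k. \<integral>y. F y \<partial>\<Lambda> (r k)) \<longlonglongrightarrow> (\<integral>y. F y \<partial>\<Lambda>')"
proof -
  let ?m = "\<lambda>k. measure (\<Lambda> k) UNIV"
  have mem: "\<forall>k. ?m k \<in> {0..K}" using mass by simp
  obtain m r where "m \<in> {0..K}" and r: "strict_mono (r :: nat \<Rightarrow> nat)" "(?m \<circ> r) \<longlonglongrightarrow> m"
    using seq_compactE[OF compact_imp_seq_compact[OF compact_Icc] mem] by blast
  then have r: "strict_mono r" "(\<lambda>k. ?m (r k)) \<longlonglongrightarrow> m" by (simp_all add: comp_def)
  show ?thesis
  proof (cases "m = 0")
    case True
    have "(\<lambda>k. \<integral>y. F y \<partial>\<Lambda> (r k)) \<longlonglongrightarrow> 0" if F: "unit_interval_test F" for F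
    proof -
      obtain B where B: "0 < B" "\<And>y. y \<in> {0..1} \<Longrightarrow> \<bar>F y\<bar> \<le> B" using unit_interval_test_bounded[OF F] by blast
      have bound: "norm (\<integral>y. F y \<partial>\<Lambda> k) \<le> B * ?m k" for k
      proof -
        interpret finite_measure "\<Lambda> k" using \<Lambda> by (simp add: unit_interval_measure_def)
        have "AE y in \<Lambda> k. y \<in> {0..1}" using \<Lambda> by (simp add: unit_interval_measure_def)
        then have "AE y in \<Lambda> k. norm (F y) \<le> B" by eventually_elim (simp add: B(2))
        then have "(\<integral>y. norm (F y) \<partial>\<Lambda> k) \<le> (\<integral>y. B \<partial>\<Lambda> k)"
          by (intro integral_mono_AE integrable_norm integrable_unit_interval_test[OF \<Lambda> F] integrable_const)
        then have "norm (\<integral>y. F y \<partial>\<Lambda> k) \<le> (\<integral>y. B \<partial>\<Lambda> k)"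
          using integral_norm_bound[of "\<Lambda> k" F] by linarith
        then show ?thesis by (simp add: unit_interval_measure_space[OF \<Lambda>] mult.commute)
      qed
      show ?thesis
      proof (rule Lim_null_comparison)
        show "\<forall>\<^sub>F k in sequentially. norm (\<integral>y. F y \<partial>\<Lambda> (r k)) \<le> B * ?m (r k)"
          by (intro always_eventually allI bound)
        show "(\<lambda>k. B * ?m (r k)) \<longlonglongrightarrow> 0" using tendsto_mult_left[OF r(2), of B] True by simp
      qed
    qed
    moreover have "unit_interval_measure (null_measure borel)"
      by (auto simp: unit_interval_measure_def intro!: finite_measureI AE_I[where N = UNIV])
    moreover have "(\<integral>y. F y \<partial>null_measure borel) = 0" for F :: "real \<Rightarrow> real"
      by (rule integral_eq_zero_AE) (auto intro!: AE_I[where N = UNIV])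
    ultimately show ?thesis by (intro that[OF r(1), of "null_measure borel"]) auto
  next
    case False
    then have "0 < m" using \<open>m \<in> {0..K}\<close> by simp
    then have "\<forall>\<^sub>F k in sequentially. 0 < ?m (r k)" using r(2) by (rule order_tendstoD(1)[rotated])
    then obtain N where N: "\<And>k. N \<le> k \<Longrightarrow> 0 < ?m (r k)" by (auto simp: eventually_sequentially)
    define r' where "r' k = r (k + N)" for k
    have r': "strict_mono r'" "(\<lambda>k. ?m (r' k)) \<longlonglongrightarrow> m" "\<And>k. 0 < ?m (r' k)"
      using r(1) LIMSEQ_ignore_initial_segment[OF r(2), of N] N by (auto simp: r'_def strict_mono_def)
    define P where "P k = density (\<Lambda> (r' k)) (\<lambda>_. ennreal (1 / ?m (r' k)))" for k
    have P: "unit_interval_measure (P k)" for k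
      unfolding P_def by (intro unit_interval_measure_scale \<Lambda>) simp
    have "prob_space (P k)" for k
    proof
      interpret finite_measure "\<Lambda> (r' k)" using \<Lambda> by (simp add: unit_interval_measure_def)
      have "emeasure (P k) (space (P k)) = ennreal (1 / ?m (r' k)) * emeasure (\<Lambda> (r' k)) UNIV"
        using \<Lambda>[of "r' k"] unfolding P_def
        by (subst emeasure_density) (auto simp: unit_interval_measure_space[OF \<Lambda>] unit_interval_measure_def)
      also have "\<dots> = 1" using r'(3)[of k]
        by (simp add: emeasure_eq_measure ennreal_mult[symmetric])
      finally show "emeasure (P k) (space (P k)) = 1" .
    qed
    then obtain s Q where s: "strict_mono (s :: nat \<Rightarrow> nat)" and Q: "unit_interval_measure Q"
      and conv: "\<And>F. unit_interval_test F \<Longrightarrow> (\<lambda>k. \<integral>y. F y \<partial>P (s k)) \<longlonglongrightarrow> (\<integral>y. F y \<partial>Q)"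
      using unit_interval_prob_compactness[of P] P by metis
    have "(\<lambda>k. \<integral>y. F y \<partial>\<Lambda> ((r' \<circ> s) k)) \<longlonglongrightarrow> (\<integral>y. F y \<partial>density Q (\<lambda>_. ennreal m))"
      if F: "unit_interval_test F" for F
    proof -
      have Fm: "F \<in> borel_measurable borel" using F by (simp add: unit_interval_test_def)
      have "(\<integral>y. F y \<partial>P (s k)) = 1 / ?m (r' (s k)) * (\<integral>y. F y \<partial>\<Lambda> (r' (s k)))" for k
        unfolding P_def by (intro unit_interval_measure_scale \<Lambda> Fm) simp
      then have eq: "?m (r' (s k)) * (\<integral>y. F y \<partial>P (s k)) = (\<integral>y. F y \<partial>\<Lambda> ((r' \<circ> s) k))" for k
        using r'(3)[of "s k"] by simp
      have "(\<lambda>k. ?m (r' (s k)) * (\<integral>y. F y \<partial>P (s k))) \<longlonglongrightarrow> m * (\<integral>y. F y \<partial>Q)"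
        using LIMSEQ_subseq_LIMSEQ[OF r'(2) s] conv[OF F] by (intro tendsto_mult) (auto simp: comp_def)
      then show ?thesis
        unfolding eq using unit_interval_measure_scale(2)[OF Q _ Fm, of m] \<open>0 < m\<close> by simp
    qed
    moreover have "unit_interval_measure (density Q (\<lambda>_. ennreal m))"
      using \<open>0 < m\<close> by (intro unit_interval_measure_scale Q) simp
    ultimately show ?thesis using that[OF strict_mono_o[OF r'(1) s]] by blast
  qed
qed

lemma unit_interval_test_mult:
  "unit_interval_test F \<Longrightarrow> unit_interval_test G \<Longrightarrow> unit_interval_test (\<lambda>y. F y * G y)"
  by (auto simp: unit_interval_test_def intro!: continuous_intros)

text \<open>
  The second difference of \<open>u \<mapsto> compact_kernel u y\<close> at \<open>u = 0\<close> with step \<open>1\<close>, in which the term linear in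
  \<open>u\<close> cancels.
\<close>

definition kernel_difference :: "real \<Rightarrow> real" where
  "kernel_difference y = compact_kernel 2 y - 2 * compact_kernel 1 y"

lemma kernel_difference_eq:
  assumes "0 < y" "y < 1"
  shows "kernel_difference y = (1 - y)\<^sup>2 / (- ln y * min (- ln y) 1)"
proof -
  define D where "D = - ln y * min (- ln y) 1"
  have "exp (2 * ln y) = y\<^sup>2" using assms by (simp add: exp_double)
  then have "compact_kernel 2 y = (y\<^sup>2 - 1 - 2 * ln y) / D" "compact_kernel 1 y = (y - 1 - ln y) / D"
    using assms by (simp_all add: compact_kernel_def branching_kernel_def D_def)
  then have "kernel_difference y = ((y\<^sup>2 - 1 - 2 * ln y) - 2 * (y - 1 - ln y)) / D"
    by (simp add: kernel_difference_def add_divide_distrib diff_divide_distrib)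
  also have "(y\<^sup>2 - 1 - 2 * ln y) - 2 * (y - 1 - ln y) = (1 - y)\<^sup>2"
    by (simp add: power2_eq_square algebra_simps)
  finally show ?thesis by (simp only: D_def)
qed

text \<open>
  Shifting \<open>u\<close> by \<open>q\<close> multiplies the second difference of \<open>exp (- u x)\<close> by \<open>exp (- q x) = y ^ q\<close>. Integrals
  of the kernel therefore encode the moments of a measure weighted by \<open>kernel_difference\<close>.
\<close>

lemma kernel_second_difference:
  assumes "y \<in> {0..1}"
  shows "compact_kernel (real q + 2) y - 2 * compact_kernel (real q + 1) y + compact_kernel (real q) y
       = y ^ q * kernel_difference y"
proof -
  consider "y = 0" | "y = 1" | "0 < y" "y < 1" using assms by fastforce
  then show ?thesis
  proof cases
    case 3
    define D where "D = - ln y * min (- ln y) 1"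
    have "D \<noteq> 0" using 3 by (simp add: D_def min_def)
    have K: "compact_kernel (real n) y = (y ^ n - 1 - real n * ln y) / D" for n
      using 3 by (simp add: compact_kernel_def branching_kernel_def D_def exp_of_nat_mult)
    have "compact_kernel (real q + 2) y - 2 * compact_kernel (real q + 1) y + compact_kernel (real q) y
        = (y ^ (q + 2) - 2 * y ^ (q + 1) + y ^ q) / D"
      using K[of "q + 2"] K[of "q + 1"] K[of q] \<open>D \<noteq> 0\<close> by (simp add: field_simps)
    also have "\<dots> = y ^ q * ((1 - y)\<^sup>2 / D)" by (simp add: power2_eq_square algebra_simps)
    finally show ?thesis using kernel_difference_eq[OF 3] by (simp add: D_def)
  qed (auto simp: kernel_difference_def compact_kernel_def branching_kernel_def power2_eq_square field_simps)
qed

lemma kernel_difference_pos: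
  assumes "0 < y" "y \<le> 1"
  shows "0 < kernel_difference y"
proof (cases "y = 1")
  case True
  then show ?thesis by (simp add: kernel_difference_def compact_kernel_def branching_kernel_def)
next
  case False
  then have "y < 1" "0 < - ln y" using assms by auto
  then show ?thesis using assms unfolding kernel_difference_eq[OF assms(1) \<open>y < 1\<close>]
    by (intro divide_pos_pos mult_pos_pos) auto
qed

lemma unit_interval_test_kernel_difference: "unit_interval_test kernel_difference"
  using unit_interval_test_compact_kernel[of 1] unit_interval_test_compact_kernel[of 2]
  by (auto simp: unit_interval_test_def kernel_difference_def[abs_def] intro!: continuous_intros)

text \<open>
  By the preceding identity the moments of the weighted measures agree, hence by Weierstrass all their
  integrals of continuous functions. The weight \<open>W\<close> is positive except at \<open>y = 0\<close> (the point \<open>x = \<infinity>\<close>), so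
  for a test function vanishing there it can be removed by dividing by \<open>W + 1/n\<close>. An arbitrary test
  function is reduced to this case by subtracting a multiple of \<open>compact_kernel 1\<close>, which has value \<open>1\<close>
  at \<open>0\<close> and whose integrals agree by assumption.
\<close>

lemma kernel_integrals_determine:
  assumes \<Lambda>: "unit_interval_measure \<Lambda>" "unit_interval_measure \<Lambda>'"
    and eq: "\<And>u. 0 \<le> u \<Longrightarrow> (\<integral>y. compact_kernel u y \<partial>\<Lambda>) = (\<integral>y. compact_kernel u y \<partial>\<Lambda>')"
    and F: "unit_interval_test F"
  shows "(\<integral>y. F y \<partial>\<Lambda>) = (\<integral>y. F y \<partial>\<Lambda>')"
proof -
  let ?W = kernel_difference
  note int = integrable_unit_interval_test
  note W = unit_interval_test_kernel_difference
  have W_meas: "?W \<in> borel_measurable borel" using W by (simp add: unit_interval_test_def)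
  have pow: "unit_interval_test (\<lambda>y. y ^ q)" for q :: nat
    by (auto simp: unit_interval_test_def intro!: continuous_intros)
  have moment: "(\<integral>y. y ^ q * ?W y \<partial>N) = (\<integral>y. compact_kernel (real q + 2) y \<partial>N)
      - 2 * (\<integral>y. compact_kernel (real q + 1) y \<partial>N) + (\<integral>y. compact_kernel (real q) y \<partial>N)"
    if N: "unit_interval_measure N" for N and q :: nat
  proof -
    have K: "unit_interval_test (compact_kernel (real q + 2))" "unit_interval_test (compact_kernel (real q + 1))"
      "unit_interval_test (compact_kernel (real q))"
      by (auto intro: unit_interval_test_compact_kernel)
    have Km: "compact_kernel (real q + 2) \<in> borel_measurable borel" "compact_kernel (real q + 1) \<in> borel_measurable borel"
       "compact_kernel (real q) \<in> borel_measurable borel" using K by (auto simp: unit_interval_test_def)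
    have "(\<integral>y. y ^ q * ?W y \<partial>N) =
        (\<integral>y. compact_kernel (real q + 2) y - 2 * compact_kernel (real q + 1) y + compact_kernel (real q) y \<partial>N)"
      using W_meas Km by (intro integral_unit_interval_cong[OF N]) (auto simp: kernel_second_difference)
    then show ?thesis using int[OF N K(1)] int[OF N K(2)] int[OF N K(3)] by simp
  qed
  have mono_eq: "(\<integral>y. y ^ q * ?W y \<partial>\<Lambda>) = (\<integral>y. y ^ q * ?W y \<partial>\<Lambda>')" for q :: nat
    unfolding moment[OF \<Lambda>(1)] moment[OF \<Lambda>(2)] using eq by simp
  have poly_eq: "(\<integral>y. p y * ?W y \<partial>\<Lambda>) = (\<integral>y. p y * ?W y \<partial>\<Lambda>')" if poly: "real_polynomial_function p" for p
  proof -
    obtain a n where p: "p = (\<lambda>y. \<Sum>i\<le>n. a i * y ^ i)"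
      using poly real_polynomial_function_iff_sum[of p] by auto
    have "(\<integral>y. p y * ?W y \<partial>N) = (\<Sum>i\<le>n. a i * (\<integral>y. y ^ i * ?W y \<partial>N))" if N: "unit_interval_measure N" for N
      using int[OF N unit_interval_test_mult[OF pow W]]
      by (simp add: p sum_distrib_right mult.assoc)
    then show ?thesis using \<Lambda> mono_eq by simp
  qed
  have weighted_eq: "(\<integral>y. G y * ?W y \<partial>\<Lambda>) = (\<integral>y. G y * ?W y \<partial>\<Lambda>')" if G: "unit_interval_test G" for G
  proof -
    have "\<exists>p. real_polynomial_function p \<and> (\<forall>y\<in>{0..1}. \<bar>G y - p y\<bar> < 1 / real (Suc n))" for n
    proof -
      have "continuous_on {0..1} G" using G by (simp add: unit_interval_test_def)
      then obtain p where "real_polynomial_function p" "\<And>y. y \<in> {0..1} \<Longrightarrow> \<bar>G y - p y\<bar> < 1 / real (Suc n)"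
        by (rule Stone_Weierstrass_real_polynomial_function[OF compact_Icc, of 0 1 G "1 / real (Suc n)"]) auto
      then show ?thesis by blast
    qed
    then have "\<exists>p. \<forall>n. real_polynomial_function (p n) \<and> (\<forall>y\<in>{0..1}. \<bar>G y - p n y\<bar> < 1 / real (Suc n))"
      by (intro choice allI)
    then obtain p where p: "\<And>n. real_polynomial_function (p n)"
      and close: "\<And>n y. y \<in> {0..1} \<Longrightarrow> \<bar>G y - p n y\<bar> < 1 / real (Suc n)"
      by blast
    obtain B where B: "0 < B" "\<And>y. y \<in> {0..1} \<Longrightarrow> \<bar>G y\<bar> \<le> B"
      using unit_interval_test_bounded[OF G] by blast
    obtain C where C: "0 < C" "\<And>y. y \<in> {0..1} \<Longrightarrow> \<bar>?W y\<bar> \<le> C"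
      using unit_interval_test_bounded[OF W] by blast
    have "(\<lambda>n. \<integral>y. p n y * ?W y \<partial>N) \<longlonglongrightarrow> (\<integral>y. G y * ?W y \<partial>N)" if N: "unit_interval_measure N" for N
    proof (rule integral_unit_interval_bounded_convergence[OF N])
      show "(\<lambda>y. G y * ?W y) \<in> borel_measurable borel"
        using unit_interval_test_mult[OF G W] by (simp add: unit_interval_test_def)
      show "(\<lambda>y. p n y * ?W y) \<in> borel_measurable borel" for n
      proof (rule borel_measurable_times[OF borel_measurable_continuous_onI W_meas])
        show "continuous_on UNIV (p n)"
          using continuous_on_polymonial_function[of "p n" UNIV] p[of n]
          by (simp add: real_polynomial_function_eq)
      qed
      fix y :: real assume y: "y \<in> {0..1}"
      have "(\<lambda>n. p n y) \<longlonglongrightarrow> G y"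
      proof (rule LIM_zero_cancel, rule Lim_null_comparison)
        show "\<forall>\<^sub>F n in sequentially. norm (p n y - G y) \<le> 1 / real (Suc n)"
          using close[OF y] by (intro always_eventually) (auto simp: abs_minus_commute less_imp_le)
        show "(\<lambda>n. 1 / real (Suc n)) \<longlonglongrightarrow> 0" by (rule LIMSEQ_Suc[OF lim_1_over_n])
      qed
      then show "(\<lambda>n. p n y * ?W y) \<longlonglongrightarrow> G y * ?W y" by (intro tendsto_intros)
      show "\<bar>p n y * ?W y\<bar> \<le> (B + 1) * C" for n
      proof -
        have "1 / real (Suc n) \<le> 1" by simp
        then have "\<bar>p n y\<bar> \<le> B + 1" using close[OF y, of n] B(2)[OF y] by linarith
        then show ?thesis using C(2)[OF y] B(1) unfolding abs_mult by (intro mult_mono) auto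
      qed
    qed
    from this[OF \<Lambda>(1)] this[OF \<Lambda>(2)] show ?thesis
      unfolding poly_eq[OF p] by (rule LIMSEQ_unique)
  qed
  have K1: "unit_interval_test (compact_kernel 1)" by (rule unit_interval_test_compact_kernel) simp
  define G where "G y = F y - F 0 * compact_kernel 1 y" for y
  have G: "unit_interval_test G"
    using F K1 by (auto simp: unit_interval_test_def G_def[abs_def] intro!: continuous_intros)
  have G0: "G 0 = 0" by (simp add: G_def compact_kernel_def)
  obtain B where B: "0 < B" "\<And>y. y \<in> {0..1} \<Longrightarrow> \<bar>G y\<bar> \<le> B" using unit_interval_test_bounded[OF G] by blast
  have W_nonneg: "0 \<le> ?W y" if "y \<in> {0..1}" for y
    using kernel_difference_pos[of y] that
    by (cases "y = 0") (auto simp: kernel_difference_def compact_kernel_def intro: less_imp_le)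
  define g where "g n y = G y / (\<bar>?W y\<bar> + 1 / real (Suc n))" for n y
  have g: "unit_interval_test (g n)" for n
    using G W by (auto simp: unit_interval_test_def g_def[abs_def] add_nonneg_eq_0_iff
      simp del: of_nat_Suc intro!: continuous_intros borel_measurable_divide borel_measurable_add)
  have "(\<lambda>n. \<integral>y. g n y * ?W y \<partial>N) \<longlonglongrightarrow> (\<integral>y. G y \<partial>N)" if N: "unit_interval_measure N" for N
  proof (rule integral_unit_interval_bounded_convergence[OF N, where B = B])
    show "G \<in> borel_measurable borel" "\<And>n. (\<lambda>y. g n y * ?W y) \<in> borel_measurable borel"
      using G unit_interval_test_mult[OF g W] by (auto simp: unit_interval_test_def)
    fix y :: real assume y: "y \<in> {0..1}"
    show "(\<lambda>n. g n y * ?W y) \<longlonglongrightarrow> G y"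
    proof (cases "y = 0")
      case True then show ?thesis by (simp add: g_def G0)
    next
      case False
      then have W_pos: "0 < ?W y" using y kernel_difference_pos by simp
      have "(\<lambda>n. G y / (\<bar>?W y\<bar> + 1 / real (Suc n)) * ?W y) \<longlonglongrightarrow> G y / (\<bar>?W y\<bar> + 0) * ?W y"
        using W_pos by (intro tendsto_intros LIMSEQ_Suc[OF lim_1_over_n]) auto
      then show ?thesis using W_pos by (simp add: g_def)
    qed
    show "\<bar>g n y * ?W y\<bar> \<le> B" for n
    proof -
      have pos: "0 < ?W y + 1 / real (Suc n)" using W_nonneg[OF y] by (intro add_nonneg_pos) auto
      have "?W y / (?W y + 1 / real (Suc n)) \<le> 1" "0 \<le> ?W y / (?W y + 1 / real (Suc n))"
        using pos W_nonneg[OF y] by (auto simp: divide_le_eq_1_pos simp del: of_nat_Suc)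
      then have "\<bar>G y\<bar> * (?W y / (?W y + 1 / real (Suc n))) \<le> B * 1"
        using B(2)[OF y] by (intro mult_mono) auto
      moreover have "\<bar>g n y * ?W y\<bar> = \<bar>G y\<bar> * (?W y / (?W y + 1 / real (Suc n)))"
        using pos W_nonneg[OF y] by (simp add: g_def abs_mult abs_divide del: of_nat_Suc)
      ultimately show ?thesis by simp
    qed
  qed
  from this[OF \<Lambda>(1)] this[OF \<Lambda>(2)] have G_eq: "(\<integral>y. G y \<partial>\<Lambda>) = (\<integral>y. G y \<partial>\<Lambda>')"
    unfolding weighted_eq[OF g] by (rule LIMSEQ_unique)
  have "(\<integral>y. G y \<partial>N) = (\<integral>y. F y \<partial>N) - F 0 * (\<integral>y. compact_kernel 1 y \<partial>N)" if N: "unit_interval_measure N" for N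
    unfolding G_def using int[OF N F] int[OF N K1] by simp
  then show ?thesis using G_eq \<Lambda> eq[of 1] by simp
qed

section \<open>Bernstein functions\<close>

lemma iterated_deriv_halfline:
  fixes F :: "nat \<Rightarrow> real \<Rightarrow> real"
  assumes D: "\<And>n x. 0 < x \<Longrightarrow> (F n has_real_derivative F (Suc n) x) (at x)"
    and f: "\<And>x. 0 < x \<Longrightarrow> f x = F 0 x"
  shows "0 < x \<Longrightarrow> (deriv ^^ n) f x = F n x"
    and "0 < x \<Longrightarrow> ((deriv ^^ n) f has_real_derivative F (Suc n) x) (at x)"
proof -
  have step: "((deriv ^^ n) f has_real_derivative F (Suc n) x) (at x)"
    if "0 < x" "\<And>x. 0 < x \<Longrightarrow> (deriv ^^ n) f x = F n x" for n x
    using that by (intro has_field_derivative_transform_within_open[OF D, of x "{0<..}"]) auto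
  have eq: "0 < x \<Longrightarrow> (deriv ^^ n) f x = F n x" for n x
  proof (induction n arbitrary: x)
    case 0
    then show ?case using f by simp
  next
    case (Suc n)
    then show ?case using DERIV_imp_deriv[OF step[OF Suc.prems Suc.IH]] by simp
  qed
  show "0 < x \<Longrightarrow> (deriv ^^ n) f x = F n x" by (rule eq)
  show "0 < x \<Longrightarrow> ((deriv ^^ n) f has_real_derivative F (Suc n) x) (at x)" by (rule step[OF _ eq])
qed

lemma bernstein_functionI:
  fixes F :: "nat \<Rightarrow> real \<Rightarrow> real"
  assumes D: "\<And>n x. 0 < x \<Longrightarrow> (F n has_real_derivative F (Suc n) x) (at x)"
    and f: "\<And>x. 0 < x \<Longrightarrow> f x = F 0 x"
    and nonneg: "\<And>x. 0 < x \<Longrightarrow> 0 \<le> F 0 x"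
    and sign: "\<And>n x. 0 < x \<Longrightarrow> 0 \<le> (-1) ^ n * F (Suc n) x"
  shows "bernstein_function f"
proof -
  have smooth: "smooth_on_halfline f"
    unfolding smooth_on_halfline_def real_differentiable_def
    using iterated_deriv_halfline(2)[OF D f] by blast
  have "(deriv ^^ n) (deriv f) = (deriv ^^ Suc n) f" for n
    by (simp add: funpow_swap1)
  then have "completely_monotone (deriv f)"
    unfolding completely_monotone_def smooth_on_halfline_def
    using smooth sign iterated_deriv_halfline(1)[OF D f]
    by (auto simp: smooth_on_halfline_def simp del: funpow.simps)
  then show ?thesis using smooth nonneg f by (simp add: bernstein_function_def)
qed

lemma DERIV_of_quadratic_error:
  fixes f :: "real \<Rightarrow> real"
  assumes "0 < \<delta>" and err: "\<And>d. \<bar>d\<bar> \<le> \<delta> \<Longrightarrow> \<bar>f (q + d) - f q - d * D\<bar> \<le> C * d\<^sup>2"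
  shows "(f has_real_derivative D) (at q)"
  unfolding DERIV_def
proof (rule LIM_zero_cancel, rule Lim_null_comparison)
  have "\<forall>\<^sub>F d in at (0::real). dist d 0 < \<delta>" using \<open>0 < \<delta>\<close> by (auto simp: eventually_at)
  moreover have "\<forall>\<^sub>F d in at (0::real). d \<noteq> 0" by (simp add: eventually_at_filter)
  ultimately show "\<forall>\<^sub>F d in at 0. norm ((f (q + d) - f q) / d - D) \<le> \<bar>C\<bar> * \<bar>d\<bar>"
  proof eventually_elim
    case (elim d)
    have "norm ((f (q + d) - f q) / d - D) = \<bar>f (q + d) - f q - d * D\<bar> / \<bar>d\<bar>"
    proof -
      have "(f (q + d) - f q) / d - D = (f (q + d) - f q - d * D) / d"
        using elim by (simp add: diff_divide_distrib)
      then show ?thesis by (simp add: abs_divide)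
    qed
    also have "\<dots> \<le> \<bar>C\<bar> * d\<^sup>2 / \<bar>d\<bar>"
    proof (rule divide_right_mono)
      have "C * d\<^sup>2 \<le> \<bar>C\<bar> * d\<^sup>2" by (intro mult_right_mono) auto
      moreover have "\<bar>d\<bar> \<le> \<delta>" using elim by (simp add: dist_real_def)
      ultimately show "\<bar>f (q + d) - f q - d * D\<bar> \<le> \<bar>C\<bar> * d\<^sup>2" using err[of d] by linarith
    qed simp
    also have "\<dots> = \<bar>C\<bar> * \<bar>d\<bar>"
    proof -
      have "d\<^sup>2 / \<bar>d\<bar> = \<bar>d\<bar>" using elim by (cases "0 < d") (auto simp: power2_eq_square)
      then show ?thesis by (simp only: times_divide_eq_right[symmetric])
    qed
    finally show ?case .
  qed
  have "((\<lambda>d::real. \<bar>C\<bar> * \<bar>d\<bar>) \<longlongrightarrow> \<bar>C\<bar> * \<bar>0\<bar>) (at 0)" by (intro tendsto_intros)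
  then show "((\<lambda>d::real. \<bar>C\<bar> * \<bar>d\<bar>) \<longlongrightarrow> 0) (at 0)" by simp
qed

lemma exp_second_order_error:
  fixes z :: real
  shows "\<bar>exp z - 1 - z\<bar> \<le> z\<^sup>2 * exp \<bar>z\<bar>"
proof -
  have upper: "exp w - 1 \<le> w * exp w" for w :: real
  proof -
    have "exp w * (1 + - w) \<le> exp w * exp (- w)"
      by (intro mult_left_mono exp_ge_add_one_self) auto
    then show ?thesis by (simp add: exp_add[symmetric] algebra_simps)
  qed
  have "\<bar>exp z - 1\<bar> \<le> \<bar>z\<bar> * exp \<bar>z\<bar>"
  proof (cases "0 \<le> z")
    case True
    then show ?thesis using upper[of z] by simp
  next
    case False
    then have "exp z \<le> 1" by simp
    then have "\<bar>exp z - 1\<bar> \<le> \<bar>z\<bar> * 1" using exp_ge_add_one_self[of z] False by linarith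
    also have "\<dots> \<le> \<bar>z\<bar> * exp \<bar>z\<bar>" by (intro mult_left_mono) auto
    finally show ?thesis .
  qed
  then have "\<bar>z\<bar> * \<bar>exp z - 1\<bar> \<le> \<bar>z\<bar> * (\<bar>z\<bar> * exp \<bar>z\<bar>)" by (intro mult_left_mono) auto
  moreover have "exp z - 1 - z \<le> z * (exp z - 1)" using upper[of z] by (simp add: algebra_simps)
  moreover have "z * (exp z - 1) \<le> \<bar>z\<bar> * \<bar>exp z - 1\<bar>" by (metis abs_ge_self abs_mult)
  moreover have "0 \<le> exp z - 1 - z" using exp_ge_add_one_self[of z] by linarith
  ultimately show ?thesis by (simp add: power2_eq_square)
qed

lemma power_times_exp_bound:
  fixes q :: real
  assumes "0 < q" "0 \<le> x"
  shows "x ^ n * exp (- q * x) \<le> fact n / q ^ n"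
proof -
  let ?f = "\<lambda>n. (q * x) ^ n /\<^sub>R fact n"
  have "?f sums exp (q * x)" by (rule exp_converges)
  then have "summable ?f" "suminf ?f = exp (q * x)" by (auto simp: sums_iff)
  moreover have "sum ?f {n} \<le> suminf ?f"
    using assms \<open>summable ?f\<close> by (intro sum_le_suminf) auto
  ultimately have "?f n \<le> exp (q * x)" by simp
  then have "q ^ n * x ^ n \<le> fact n * exp (q * x)"
    by (simp add: power_mult_distrib field_simps)
  then have "(q ^ n * x ^ n) * exp (- q * x) \<le> (fact n * exp (q * x)) * exp (- q * x)"
    by (intro mult_right_mono) auto
  also have "\<dots> = fact n" by (simp add: mult.assoc exp_add[symmetric])
  finally show ?thesis using assms by (simp add: pos_le_divide_eq mult_ac)
qed

context
  fixes \<nu> :: "real measure"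
  assumes halfline: "halfline_measure \<nu>" and moment: "finite_min_moment \<nu>"
begin

lemma halfline_space: "space \<nu> = {0<..}"
  using halfline sets_eq_imp_space_eq[of \<nu>] by (simp add: halfline_measure_def space_restrict_space)

lemma halfline_borel_measurable:
  fixes f :: "real \<Rightarrow> real" assumes "f \<in> borel_measurable borel" shows "f \<in> borel_measurable \<nu>"
proof -
  have "sets \<nu> = sets (restrict_space borel {0<..})" using halfline by (simp add: halfline_measure_def)
  then show ?thesis using measurable_restrict_space1[OF assms] measurable_cong_sets by blast
qed

lemma integrable_min_halfline: "integrable \<nu> (\<lambda>x. min x 1)"
proof (rule integrableI_bounded)
  have "(\<integral>\<^sup>+x. ennreal (norm (min x 1)) \<partial>\<nu>) = (\<integral>\<^sup>+x. ennreal (min x 1) \<partial>\<nu>)"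
    by (intro nn_integral_cong) (auto simp: halfline_space)
  then show "(\<integral>\<^sup>+x. ennreal (norm (min x 1)) \<partial>\<nu>) < \<infinity>"
    using moment by (simp add: finite_min_moment_def)
qed (simp add: halfline_borel_measurable)

lemma integrable_halfline_bound:
  fixes f :: "real \<Rightarrow> real"
  assumes "f \<in> borel_measurable borel" "\<And>x. 0 < x \<Longrightarrow> \<bar>f x\<bar> \<le> C * min x 1"
  shows "integrable \<nu> f"
proof (rule Bochner_Integration.integrable_bound)
  show "integrable \<nu> (\<lambda>x. C * min x 1)" using integrable_min_halfline by simp
  show "AE x in \<nu>. norm (f x) \<le> norm (C * min x 1)"
  proof (rule AE_I2)
    fix x assume "x \<in> space \<nu>"
    then have "\<bar>f x\<bar> \<le> C * min x 1" using assms by (simp add: halfline_space)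
    then show "norm (f x) \<le> norm (C * min x 1)" by simp
  qed
qed (rule halfline_borel_measurable[OF assms(1)])

definition laplace_moment :: "nat \<Rightarrow> real \<Rightarrow> real" where
  "laplace_moment n q = (\<integral>x. x ^ n * exp (- q * x) \<partial>\<nu>)"

lemma integrable_laplace_moment:
  assumes "0 < q" shows "integrable \<nu> (\<lambda>x. x ^ Suc n * exp (- q * x))"
proof (rule integrable_halfline_bound)
  fix x :: real assume "0 < x"
  let ?C = "1 + fact (Suc n) / q ^ Suc n"
  have C: "0 \<le> fact (Suc n) / q ^ Suc n" using assms by (intro divide_nonneg_pos) auto
  show "\<bar>x ^ Suc n * exp (- q * x)\<bar> \<le> ?C * min x 1"
  proof (cases "x \<le> 1")
    case True
    have "x ^ Suc n * exp (- q * x) \<le> x ^ 1 * 1"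
      using \<open>0 < x\<close> True assms by (intro mult_mono power_decreasing) auto
    also have "\<dots> \<le> ?C * x"
      using mult_right_mono[of 1 ?C x] \<open>0 < x\<close> C by simp
    finally show ?thesis using True \<open>0 < x\<close> by simp
  next
    case False
    then show ?thesis using power_times_exp_bound[of q x "Suc n"] assms \<open>0 < x\<close>
      by (simp add: abs_mult del: fact_Suc power_Suc)
  qed
qed simp

lemma integrable_one_minus_exp:
  assumes "0 \<le> q" shows "integrable \<nu> (\<lambda>x. 1 - exp (- q * x))"
proof (rule integrable_halfline_bound)
  fix x :: real assume "0 < x"
  then show "\<bar>1 - exp (- q * x)\<bar> \<le> (1 + q) * min x 1"
    using one_minus_exp_le_min[of q x] assms by simp
qed simp

text \<open>
  The remainder of the expansion of \<open>exp (- (q + d) x)\<close> is \<open>O(d\<^sup>2)\<close>, with half of the exponential decay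
  left to dominate the extra powers of \<open>x\<close>. Integrated over \<open>x\<close>, this differentiates Laplace moments
  under the integral sign.
\<close>

lemma laplace_remainder_bound:
  fixes q d x :: real
  assumes q: "0 < q" "\<bar>d\<bar> \<le> q / 2" and "0 < x"
  shows "\<bar>x ^ n * (exp (- (q + d) * x) - exp (- q * x) + d * x * exp (- q * x))\<bar>
       \<le> d\<^sup>2 * (x ^ Suc (Suc n) * exp (- (q / 2) * x))"
proof -
  have "- (q + d) * x = - q * x + - d * x" by (simp add: algebra_simps)
  then have "exp (- (q + d) * x) = exp (- q * x) * exp (- d * x)" by (simp only: mult_exp_exp)
  then have "exp (- (q + d) * x) - exp (- q * x) + d * x * exp (- q * x)
      = exp (- q * x) * (exp (- d * x) - 1 - (- d * x))"
    by (simp add: algebra_simps)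
  then have "\<bar>exp (- (q + d) * x) - exp (- q * x) + d * x * exp (- q * x)\<bar>
      \<le> exp (- q * x) * ((- d * x)\<^sup>2 * exp \<bar>- d * x\<bar>)"
    using mult_left_mono[OF exp_second_order_error[of "- d * x"], of "exp (- q * x)"] by (simp add: abs_mult)
  also have "\<dots> = d\<^sup>2 * x\<^sup>2 * (exp (- q * x) * exp (\<bar>d\<bar> * x))"
    using \<open>0 < x\<close> by (simp add: abs_mult power_mult_distrib)
  also have "exp (- q * x) * exp (\<bar>d\<bar> * x) = exp ((\<bar>d\<bar> - q) * x)"
    by (simp add: exp_add[symmetric] algebra_simps)
  also have "(\<bar>d\<bar> - q) * x \<le> - (q / 2) * x"
    using q \<open>0 < x\<close> by (intro mult_right_mono) auto
  then have "d\<^sup>2 * x\<^sup>2 * exp ((\<bar>d\<bar> - q) * x) \<le> d\<^sup>2 * x\<^sup>2 * exp (- (q / 2) * x)"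
    by (intro mult_left_mono) auto
  finally have "x ^ n * \<bar>exp (- (q + d) * x) - exp (- q * x) + d * x * exp (- q * x)\<bar>
      \<le> x ^ n * (d\<^sup>2 * x\<^sup>2 * exp (- (q / 2) * x))"
    using \<open>0 < x\<close> by (intro mult_left_mono) auto
  moreover have "x ^ n * (d\<^sup>2 * x\<^sup>2 * exp (- (q / 2) * x)) = d\<^sup>2 * (x ^ Suc (Suc n) * exp (- (q / 2) * x))"
    by (simp add: power2_eq_square)
  moreover have "\<bar>x ^ n\<bar> = x ^ n" using \<open>0 < x\<close> by simp
  ultimately show ?thesis unfolding abs_mult by (simp only:)
qed

lemma laplace_remainder_integral:
  assumes q: "0 < q" "\<bar>d\<bar> \<le> q / 2"
  shows "\<bar>\<integral>x. x ^ n * (exp (- (q + d) * x) - exp (- q * x) + d * x * exp (- q * x)) \<partial>\<nu>\<bar>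
       \<le> laplace_moment (Suc (Suc n)) (q / 2) * d\<^sup>2"
proof -
  let ?f = "\<lambda>x. x ^ n * (exp (- (q + d) * x) - exp (- q * x) + d * x * exp (- q * x))"
  let ?g = "\<lambda>x. d\<^sup>2 * (x ^ Suc (Suc n) * exp (- (q / 2) * x))"
  have g: "integrable \<nu> ?g" using integrable_laplace_moment[of "q / 2" "Suc n"] q by (intro integrable_mult_right) auto
  have le: "norm (?f x) \<le> ?g x" if "x \<in> space \<nu>" for x
    using laplace_remainder_bound[OF q, of x n] that unfolding halfline_space real_norm_def by simp
  have f: "integrable \<nu> ?f"
  proof (rule Bochner_Integration.integrable_bound[OF g])
    show "?f \<in> borel_measurable \<nu>" by (rule halfline_borel_measurable) measurable
    show "AE x in \<nu>. norm (?f x) \<le> norm (?g x)"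
    proof (rule AE_I2)
      fix x assume "x \<in> space \<nu>"
      then have "norm (?f x) \<le> ?g x" by (rule le)
      also have "\<dots> \<le> norm (?g x)" unfolding real_norm_def by (rule abs_ge_self)
      finally show "norm (?f x) \<le> norm (?g x)" .
    qed
  qed
  have "norm (\<integral>x. ?f x \<partial>\<nu>) \<le> (\<integral>x. ?g x \<partial>\<nu>)" by (rule Bochner_Integration.integral_norm_bound_integral[OF f g le])
  then show ?thesis by (simp add: laplace_moment_def mult.commute)
qed

lemma laplace_moment_DERIV:
  assumes "0 < q"
  shows "(laplace_moment (Suc n) has_real_derivative - laplace_moment (Suc (Suc n)) q) (at q)"
proof (rule DERIV_of_quadratic_error)
  show "0 < q / 2" using assms by simp
  fix d :: real assume d: "\<bar>d\<bar> \<le> q / 2"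
  then have qd: "0 < q + d" using assms by (simp add: abs_le_iff)
  note int = integrable_laplace_moment[OF qd, of n] integrable_laplace_moment[OF assms, of n]
    integrable_mult_right[OF integrable_laplace_moment[OF assms, of "Suc n"], of d]
  have "laplace_moment (Suc n) (q + d) - laplace_moment (Suc n) q - d * - laplace_moment (Suc (Suc n)) q
     = (\<integral>x. (x ^ Suc n * exp (- (q + d) * x) - x ^ Suc n * exp (- q * x)) + d * (x ^ Suc (Suc n) * exp (- q * x)) \<partial>\<nu>)"
    unfolding laplace_moment_def
    by (subst Bochner_Integration.integral_add[OF Bochner_Integration.integrable_diff[OF int(1,2)] int(3)],
        subst Bochner_Integration.integral_diff[OF int(1,2)], subst integral_mult_right_zero) simp
  also have "\<dots> = (\<integral>x. x ^ Suc n * (exp (- (q + d) * x) - exp (- q * x) + d * x * exp (- q * x)) \<partial>\<nu>)"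
    by (intro Bochner_Integration.integral_cong refl) (simp add: algebra_simps)
  finally show "\<bar>laplace_moment (Suc n) (q + d) - laplace_moment (Suc n) q - d * - laplace_moment (Suc (Suc n)) q\<bar>
      \<le> laplace_moment (Suc (Suc (Suc n))) (q / 2) * d\<^sup>2"
    using laplace_remainder_integral[OF assms d, of "Suc n"] by simp
qed

lemma levy_khintchine_DERIV:
  assumes "0 < q"
  shows "((\<lambda>q. \<beta> * q + (\<integral>x. 1 - exp (- q * x) \<partial>\<nu>)) has_real_derivative \<beta> + laplace_moment 1 q) (at q)"
proof (rule DERIV_of_quadratic_error)
  show "0 < q / 2" using assms by simp
  fix d :: real assume d: "\<bar>d\<bar> \<le> q / 2"
  then have qd: "0 \<le> q + d" using assms by (simp add: abs_le_iff)
  note int = integrable_one_minus_exp[OF qd] integrable_one_minus_exp[OF less_imp_le[OF assms]]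
    integrable_mult_right[OF integrable_laplace_moment[OF assms, of 0], of d]
  have "(\<beta> * (q + d) + (\<integral>x. 1 - exp (- (q + d) * x) \<partial>\<nu>)) - (\<beta> * q + (\<integral>x. 1 - exp (- q * x) \<partial>\<nu>)) - d * (\<beta> + laplace_moment 1 q)
     = (\<integral>x. ((1 - exp (- (q + d) * x)) - (1 - exp (- q * x))) - d * (x ^ Suc 0 * exp (- q * x)) \<partial>\<nu>)"
    unfolding laplace_moment_def
    by (subst Bochner_Integration.integral_diff[OF Bochner_Integration.integrable_diff[OF int(1,2)] int(3)],
        subst Bochner_Integration.integral_diff[OF int(1,2)], subst integral_mult_right_zero)
       (simp add: algebra_simps)
  also have "\<dots> = (\<integral>x. - (x ^ 0 * (exp (- (q + d) * x) - exp (- q * x) + d * x * exp (- q * x))) \<partial>\<nu>)"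
    by (intro Bochner_Integration.integral_cong refl) (simp add: algebra_simps)
  also have "\<dots> = - (\<integral>x. x ^ 0 * (exp (- (q + d) * x) - exp (- q * x) + d * x * exp (- q * x)) \<partial>\<nu>)"
    by (rule Bochner_Integration.integral_minus)
  finally show "\<bar>(\<beta> * (q + d) + (\<integral>x. 1 - exp (- (q + d) * x) \<partial>\<nu>)) - (\<beta> * q + (\<integral>x. 1 - exp (- q * x) \<partial>\<nu>)) - d * (\<beta> + laplace_moment 1 q)\<bar>
      \<le> laplace_moment (Suc (Suc 0)) (q / 2) * d\<^sup>2"
    using laplace_remainder_integral[OF assms d, of 0] by (simp only: abs_minus_cancel)
qed

text \<open>
  All derivatives are explicit: the first is \<open>\<beta>\<close> plus the first Laplace moment, and each further one
  raises the order of the moment and changes the sign.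
\<close>

lemma levy_khintchine_bernstein:
  assumes "0 \<le> \<beta>" and f: "\<And>q. 0 \<le> q \<Longrightarrow> f q = \<beta> * q + (\<integral>x. 1 - exp (- q * x) \<partial>\<nu>)"
  shows "bernstein_function f"
proof -
  define F where "F n q = (case n of 0 \<Rightarrow> \<beta> * q + (\<integral>x. 1 - exp (- q * x) \<partial>\<nu>)
      | Suc m \<Rightarrow> (if m = 0 then \<beta> else 0) + (-1) ^ m * laplace_moment (Suc m) q)" for n q
  have L_nonneg: "0 \<le> laplace_moment n q" for n q
    unfolding laplace_moment_def by (intro Bochner_Integration.integral_nonneg) (auto simp: halfline_space)
  show ?thesis
  proof (rule bernstein_functionI[of F])
    fix n and x :: real assume x: "0 < x"
    show "(F n has_real_derivative F (Suc n) x) (at x)"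
    proof (cases n)
      case 0
      then show ?thesis using levy_khintchine_DERIV[OF x, of \<beta>] by (simp add: F_def[abs_def])
    next
      case (Suc m)
      have "((\<lambda>q. (if m = 0 then \<beta> else 0) + (-1) ^ m * laplace_moment (Suc m) q) has_real_derivative
          0 + (-1) ^ m * - laplace_moment (Suc (Suc m)) x) (at x)"
        by (intro DERIV_add DERIV_const DERIV_cmult laplace_moment_DERIV x)
      then show ?thesis by (simp add: F_def[abs_def] Suc)
    qed
    show "0 \<le> (-1) ^ n * F (Suc n) x"
      using L_nonneg[of "Suc n" x] \<open>0 \<le> \<beta>\<close>
      by (simp add: F_def distrib_left mult.assoc[symmetric] power_mult_distrib[symmetric])
    show "0 \<le> F 0 x"
      using x \<open>0 \<le> \<beta>\<close>
      by (auto simp: F_def halfline_space intro!: add_nonneg_nonneg Bochner_Integration.integral_nonneg)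
    show "f x = F 0 x" using f x by (simp add: F_def)
  qed
qed

end

text \<open>
  The function \<open>(1 - exp (- q x)) / (1 - exp (- x))\<close> of \<open>x \<in> [0, \<infinity>]\<close> in the coordinate \<open>y = exp (- x)\<close>.
\<close>

definition bernstein_kernel :: "real \<Rightarrow> real \<Rightarrow> real" where
  "bernstein_kernel q y = (if y = 1 then q else (1 - y powr q) / (1 - y))"

lemma unit_interval_test_bernstein_kernel:
  assumes "0 < q" shows "unit_interval_test (bernstein_kernel q)"
  unfolding unit_interval_test_def
proof
  show "bernstein_kernel q \<in> borel_measurable borel"
    unfolding bernstein_kernel_def[abs_def] by measurable
  have c: "continuous_on ({0..1} - {1}) (bernstein_kernel q)"
  proof (rule continuous_on_eq)
    show "continuous_on ({0..1} - {1}) (\<lambda>y. (1 - y powr q) / (1 - y))"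
      using assms by (intro continuous_intros continuous_on_powr') auto
  qed (auto simp: bernstein_kernel_def)
  have "((\<lambda>y. (1 - y powr q) / (1 - y)) \<longlongrightarrow> q) (at_left 1)"
    using assms by real_asymp
  then have lim1: "(bernstein_kernel q \<longlongrightarrow> q) (at_left 1)"
    by (rule Lim_transform_eventually)
       (auto simp: bernstein_kernel_def eventually_at_filter)
  show "continuous_on {0..1} (bernstein_kernel q)"
    by (rule continuous_on_extend_to_point[OF c]) (use lim1 in \<open>simp add: at_within_Icc_at_left bernstein_kernel_def\<close>)
qed

text \<open>
  Splitting off the atoms, \<open>\<rho> {1}\<close> (that is, \<open>x = 0\<close>) is the drift \<open>\<beta>\<close>, and \<open>\<nu>\<close> is the image under
  \<open>x = - ln y\<close> of \<open>1 / (1 - y)\<close> times \<open>\<rho>\<close> on \<open>(0, 1)\<close>. The atom \<open>\<rho> {0}\<close> (\<open>x = \<infinity>\<close>) would be a killing term;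
  it is a lower bound of \<open>f\<close> and hence zero, because \<open>f q \<le> q\<close>.
\<close>

lemma bernstein_representation:
  assumes \<rho>: "unit_interval_measure \<rho>"
    and f: "\<And>q. 0 < q \<Longrightarrow> f q = (\<integral>y. bernstein_kernel q y \<partial>\<rho>)"
    and f_le: "\<And>q. 0 < q \<Longrightarrow> f q \<le> q" and f0: "f 0 = 0"
  obtains \<beta> \<nu> where "0 \<le> \<beta>" "halfline_measure \<nu>" "finite_min_moment \<nu>"
    "\<And>q. 0 \<le> q \<Longrightarrow> f q = \<beta> * q + (\<integral>x. 1 - exp (- q * x) \<partial>\<nu>)"
proof -
  interpret finite_measure \<rho> using \<rho> by (simp add: unit_interval_measure_def)
  have sets_\<rho> [measurable_cong, simp]: "sets \<rho> = sets borel" using \<rho> by (simp add: unit_interval_measure_def)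
  have [simp]: "space \<rho> = UNIV" using \<rho> by (rule unit_interval_measure_space)
  define w where "w y = (indicator {0<..<1} y / (1 - y) :: real)" for y
  have w_nonneg: "0 \<le> w y" for y by (simp add: w_def indicator_def)
  have w_meas [measurable]: "w \<in> borel_measurable borel" unfolding w_def[abs_def] by measurable
  \<comment> \<open>The value \<open>1\<close> outside \<open>(0, 1)\<close>, where the density \<open>w\<close> vanishes, keeps the range in \<open>(0, \<infinity>)\<close>.\<close>
  define T where "T y = (if 0 < y \<and> y < 1 then - ln y else 1)" for y :: real
  have T_pos: "0 < T y" for y by (simp add: T_def)
  have T_meas0 [measurable]: "T \<in> borel_measurable borel" unfolding T_def[abs_def] by measurable
  have T_meas: "T \<in> measurable (density \<rho> (\<lambda>y. ennreal (w y))) (restrict_space borel {0<..})"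
    by (rule measurable_restrict_space2) (auto simp: T_pos)
  define \<nu> where "\<nu> = distr (density \<rho> (\<lambda>y. ennreal (w y))) (restrict_space borel {0<..}) T"
  have half: "halfline_measure \<nu>" by (simp add: halfline_measure_def \<nu>_def)
  have meas_half: "g \<in> borel_measurable (restrict_space borel {0<..})"
    if "g \<in> borel_measurable borel" for g :: "real \<Rightarrow> 'b::topological_space"
    using that by (rule measurable_restrict_space1)
  have min_le: "min x 1 \<le> 2 * (1 - exp (- x))" if "0 < x" for x :: real
  proof -
    have "exp (- x) \<le> 1 / (1 + x)"
      using exp_ge_add_one_self[of x] that by (simp add: exp_minus field_simps)
    then have "x / (1 + x) \<le> 1 - exp (- x)" using that by (simp add: field_simps)
    then have "2 * (x / (1 + x)) \<le> 2 * (1 - exp (- x))" by (intro mult_left_mono) auto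
    moreover have "min x 1 \<le> 2 * (x / (1 + x))"
      using that by (cases "x \<le> 1") (auto simp: field_simps)
    ultimately show ?thesis by (rule order_trans[rotated])
  qed
  have "(\<integral>\<^sup>+x. ennreal (min x 1) \<partial>\<nu>) = (\<integral>\<^sup>+y. ennreal (w y) * ennreal (min (T y) 1) \<partial>\<rho>)"
    unfolding \<nu>_def by (subst nn_integral_distr[OF T_meas]) (auto intro!: meas_half simp: nn_integral_density)
  also have "\<dots> \<le> (\<integral>\<^sup>+y. 2 \<partial>\<rho>)"
  proof (rule nn_integral_mono)
    fix y :: real
    have "w y * min (T y) 1 \<le> 2"
    proof (cases "0 < y \<and> y < 1")
      case True
      then have "w y * min (T y) 1 \<le> 1 / (1 - y) * (2 * (1 - y))"
        using min_le[of "- ln y"] by (simp add: w_def T_def divide_right_mono)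
      also have "\<dots> = 2" using True by (simp add: field_simps)
      finally show ?thesis .
    qed (auto simp: w_def)
    then show "ennreal (w y) * ennreal (min (T y) 1) \<le> 2"
      using w_nonneg[of y] T_pos[of y]
      by (simp add: ennreal_mult[symmetric] ennreal_le_iff[symmetric, of 2 "w y * min (T y) 1"] del: ennreal_le_iff)
  qed
  also have "\<dots> < \<infinity>" by (simp add: ennreal_mult_less_top emeasure_eq_measure)
  finally have mom: "finite_min_moment \<nu>" by (simp add: finite_min_moment_def)
  have lk: "(\<integral>x. 1 - exp (- q * x) \<partial>\<nu>) = (\<integral>y. indicator {0<..<1} y * bernstein_kernel q y \<partial>\<rho>)" for q
  proof -
    have "(\<integral>x. 1 - exp (- q * x) \<partial>\<nu>) = (\<integral>y. w y * (1 - exp (- q * T y)) \<partial>\<rho>)"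
      unfolding \<nu>_def by (subst integral_distr[OF T_meas])
        (auto intro!: meas_half simp: integral_density w_nonneg)
    also have "\<dots> = (\<integral>y. indicator {0<..<1} y * bernstein_kernel q y \<partial>\<rho>)"
      by (intro Bochner_Integration.integral_cong refl)
         (auto simp: w_def T_def bernstein_kernel_def powr_def indicator_def)
    finally show ?thesis .
  qed
  let ?\<beta> = "measure \<rho> {1}"
  have decomp: "f q = measure \<rho> {0} + ?\<beta> * q + (\<integral>x. 1 - exp (- q * x) \<partial>\<nu>)" if "0 < q" for q
  proof -
    have H: "bernstein_kernel q \<in> borel_measurable borel"
      using unit_interval_test_bernstein_kernel[OF that] by (simp add: unit_interval_test_def)
    have int: "integrable \<rho> (\<lambda>y. indicator {0<..<1} y * bernstein_kernel q y)"
      using integrable_unit_interval_test[OF \<rho> unit_interval_test_bernstein_kernel[OF that]]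
        integrable_mult_indicator[of "{0<..<1}" \<rho> "bernstein_kernel q"] by simp
    have "f q = (\<integral>y. (indicator {0} y + q * indicator {1} y) + indicator {0<..<1} y * bernstein_kernel q y \<partial>\<rho>)"
      unfolding f[OF that]
      using H by (intro integral_unit_interval_cong[OF \<rho>])
        (auto simp: indicator_def bernstein_kernel_def that)
    also have "\<dots> = (\<integral>y. indicator {0} y + q * indicator {1} y \<partial>\<rho>) + (\<integral>x. 1 - exp (- q * x) \<partial>\<nu>)"
      unfolding lk by (rule Bochner_Integration.integral_add[OF _ int])
        (intro Bochner_Integration.integrable_add integrable_mult_right integrable_real_indicator; simp add: emeasure_eq_measure)
    also have "(\<integral>y. indicator {0} y + q * indicator {1} y \<partial>\<rho>) = measure \<rho> {0} + q * measure \<rho> {1}"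
      by (subst Bochner_Integration.integral_add) (auto simp: emeasure_eq_measure)
    finally show ?thesis by simp
  qed
  have "measure \<rho> {0} \<le> 0"
  proof (rule field_le_epsilon)
    fix e :: real assume "0 < e"
    have "0 \<le> (\<integral>x. 1 - exp (- e * x) \<partial>\<nu>)"
      using \<open>0 < e\<close> by (intro Bochner_Integration.integral_nonneg) (auto simp: halfline_space[OF half mom])
    moreover have "0 \<le> ?\<beta> * e" using \<open>0 < e\<close> by simp
    ultimately show "measure \<rho> {0} \<le> 0 + e" using decomp[OF \<open>0 < e\<close>] f_le[OF \<open>0 < e\<close>] by linarith
  qed
  then have "measure \<rho> {0} = 0" by (simp add: measure_le_0_iff)
  then have "f q = ?\<beta> * q + (\<integral>x. 1 - exp (- q * x) \<partial>\<nu>)" if "0 \<le> q" for q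
    using decomp[of q] f0 that by (cases "q = 0") auto
  then show ?thesis using that[OF _ half mom, of ?\<beta>] by simp
qed

text \<open>
  The law of \<open>x = h X\<close> times \<open>(1 - exp (- x)) / h\<close>, in the coordinate \<open>y = exp (- x)\<close>. With this weight the
  total mass is \<open>gw_phi \<pi> h n 1 \<le> 1\<close>, so that these measures stay in a compact set as \<open>h\<close> tends to zero.
\<close>

definition gw_exp_law :: "nat pmf \<Rightarrow> real \<Rightarrow> nat \<Rightarrow> real measure" where
  "gw_exp_law \<pi> h n =
     distr (density (gw_space \<pi>) (\<lambda>\<omega>. ennreal ((1 - exp (- h * real (galton_watson n \<omega>))) / h)))
       borel (\<lambda>\<omega>. exp (- h * real (galton_watson n \<omega>)))"

lemma gw_exp_law_props:
  assumes "0 < h"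
  shows "unit_interval_measure (gw_exp_law \<pi> h n)"
    and "0 < q \<Longrightarrow> (\<integral>y. bernstein_kernel q y \<partial>gw_exp_law \<pi> h n) = gw_phi \<pi> h n q"
    and "measure (gw_exp_law \<pi> h n) UNIV = gw_phi \<pi> h n 1"
proof -
  interpret prob_space "gw_space \<pi>" by (rule prob_space_gw_space)
  define y where "y \<omega> = exp (- h * real (galton_watson n \<omega>))" for \<omega>
  define w where "w \<omega> = (1 - y \<omega>) / h" for \<omega>
  have law: "gw_exp_law \<pi> h n = distr (density (gw_space \<pi>) (\<lambda>\<omega>. ennreal (w \<omega>))) borel y"
    by (simp add: gw_exp_law_def y_def[abs_def] w_def[abs_def])
  have y_meas [measurable]: "y \<in> borel_measurable (gw_space \<pi>)"
    unfolding y_def[abs_def] by (rule measurable_compose[OF measurable_galton_watson]) simp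
  have w_meas [measurable]: "w \<in> borel_measurable (gw_space \<pi>)"
    unfolding w_def[abs_def] by measurable
  have y: "0 \<le> y \<omega>" "y \<omega> \<le> 1" for \<omega> using assms by (auto simp: y_def)
  have w: "0 \<le> w \<omega>" "w \<omega> \<le> 1 / h" for \<omega>
    using assms y[of \<omega>] by (auto simp: w_def intro!: divide_right_mono)
  have integral: "(\<integral>y. F y \<partial>gw_exp_law \<pi> h n) = (\<integral>\<omega>. w \<omega> * F (y \<omega>) \<partial>gw_space \<pi>)"
    if [measurable]: "F \<in> borel_measurable borel" for F :: "real \<Rightarrow> real"
    unfolding law
    by (subst integral_distr, simp_all, subst integral_density) (use w in auto)
  have sets: "sets (gw_exp_law \<pi> h n) = sets borel" by (simp add: gw_exp_law_def)
  have "finite_measure (gw_exp_law \<pi> h n)"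
  proof (rule finite_measureI)
    have "emeasure (gw_exp_law \<pi> h n) (space (gw_exp_law \<pi> h n)) = (\<integral>\<^sup>+\<omega>. ennreal (w \<omega>) \<partial>gw_space \<pi>)"
      unfolding law using sets.top[of "gw_space \<pi>"] by (simp add: emeasure_distr emeasure_density)
    also have "\<dots> \<le> (\<integral>\<^sup>+\<omega>. ennreal (1 / h) \<partial>gw_space \<pi>)"
      by (intro nn_integral_mono ennreal_leI w)
    also have "\<dots> < \<infinity>" by (simp add: emeasure_space_1[simplified])
    finally show "emeasure (gw_exp_law \<pi> h n) (space (gw_exp_law \<pi> h n)) \<noteq> \<infinity>" by simp
  qed
  moreover have "AE y in gw_exp_law \<pi> h n. y \<in> {0..1}"
    unfolding law using y by (subst AE_distr_iff) auto
  ultimately show "unit_interval_measure (gw_exp_law \<pi> h n)"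
    using sets by (simp add: unit_interval_measure_def)
  show "(\<integral>y. bernstein_kernel q y \<partial>gw_exp_law \<pi> h n) = gw_phi \<pi> h n q" if "0 < q"
  proof -
    have "w \<omega> * bernstein_kernel q (y \<omega>) = 1 / h * (1 - exp (- h * q * real (galton_watson n \<omega>)))" for \<omega>
      using assms by (auto simp: w_def y_def bernstein_kernel_def powr_def mult_ac)
    then show ?thesis
      using unit_interval_test_bernstein_kernel[OF that]
      by (subst integral) (auto simp: unit_interval_test_def gw_phi_def simp del: times_divide_eq_left)
  qed
  show "measure (gw_exp_law \<pi> h n) UNIV = gw_phi \<pi> h n 1"
    using integral[of "\<lambda>_. 1"] sets_eq_imp_space_eq[OF sets] by (simp add: gw_phi_def w_def y_def)
qed

section \<open>The scaling limit\<close>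

lemma kernel_integral_increment:
  assumes \<Lambda>: "unit_interval_measure \<Lambda>" and uv: "0 \<le> u" "u \<le> v"
  defines "P \<equiv> \<lambda>u. \<integral>y. compact_kernel u y \<partial>\<Lambda>"
  shows "0 \<le> P v - P u \<and> P v - P u \<le> measure \<Lambda> UNIV * ((v - u) * (1 + v))"
proof -
  interpret finite_measure \<Lambda> using \<Lambda> by (simp add: unit_interval_measure_def)
  have int: "integrable \<Lambda> (compact_kernel w)" if "0 \<le> w" for w
    by (intro integrable_unit_interval_test[OF \<Lambda>] unit_interval_test_compact_kernel that)
  have eq: "P v - P u = (\<integral>y. compact_kernel v y - compact_kernel u y \<partial>\<Lambda>)"
    unfolding P_def using int uv by simp
  have AE: "AE y in \<Lambda>. y \<in> {0..1}" using \<Lambda> by (simp add: unit_interval_measure_def)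
  have "AE y in \<Lambda>. 0 \<le> compact_kernel v y - compact_kernel u y"
    using AE by eventually_elim (rule compact_kernel_increment(1)[OF uv])
  then have "0 \<le> P v - P u" unfolding eq by (rule integral_nonneg_AE)
  moreover have "AE y in \<Lambda>. compact_kernel v y - compact_kernel u y \<le> (v - u) * (1 + v)"
    using AE by eventually_elim (rule compact_kernel_increment(2)[OF uv])
  then have "P v - P u \<le> (\<integral>y. (v - u) * (1 + v) \<partial>\<Lambda>)"
    unfolding eq using int uv
    by (intro integral_mono_AE Bochner_Integration.integrable_diff integrable_const) auto
  ultimately show ?thesis
    by (simp add: unit_interval_measure_space[OF \<Lambda>] mult.assoc)
qed

lemma kernel_integral_lower_bound:
  assumes \<Lambda>: "unit_interval_measure \<Lambda>" and c: "\<And>y. y \<in> {0..1} \<Longrightarrow> c \<le> compact_kernel u y" and "0 \<le> u"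
  shows "c * measure \<Lambda> UNIV \<le> (\<integral>y. compact_kernel u y \<partial>\<Lambda>)"
proof -
  interpret finite_measure \<Lambda> using \<Lambda> by (simp add: unit_interval_measure_def)
  have "AE y in \<Lambda>. y \<in> {0..1}" using \<Lambda> by (simp add: unit_interval_measure_def)
  then have "AE y in \<Lambda>. c \<le> compact_kernel u y" by eventually_elim (rule c)
  then have "(\<integral>y. c \<partial>\<Lambda>) \<le> (\<integral>y. compact_kernel u y \<partial>\<Lambda>)"
    by (intro integral_mono_AE integrable_const integrable_unit_interval_test[OF \<Lambda>]
          unit_interval_test_compact_kernel \<open>0 \<le> u\<close>)
  then show ?thesis by (simp add: unit_interval_measure_space[OF \<Lambda>] mult.commute)
qed

text \<open>
  All that the branching equation needs from its mechanism. Either the measure is null, and the mechanism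
  is zero, or the mechanism is positive on \<open>(0, \<infinity>)\<close> because the kernel is bounded away from zero.
\<close>

lemma kernel_integral_mechanism:
  assumes \<Lambda>: "unit_interval_measure \<Lambda>"
  defines "P \<equiv> \<lambda>u. \<integral>y. compact_kernel u y \<partial>\<Lambda>"
  shows "P 0 = 0" "mono_on {0..} P" "\<And>u. 0 \<le> u \<Longrightarrow> 0 \<le> P u" "\<And>q. continuous_on {0..q} P"
    and "\<exists>\<phi>. solves_branching_ode P \<phi>"
proof -
  let ?K = "measure \<Lambda> UNIV"
  have inc: "0 \<le> P v - P u \<and> P v - P u \<le> ?K * ((v - u) * (1 + v))" if "0 \<le> u" "u \<le> v" for u v
    unfolding P_def by (rule kernel_integral_increment[OF \<Lambda> that])
  have "compact_kernel 0 = (\<lambda>_. 0)" by (simp add: fun_eq_iff)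
  then show P0: "P 0 = 0" by (simp add: P_def)
  show mono: "mono_on {0..} P" using inc by (intro mono_onI) fastforce
  show nonneg: "0 \<le> P u" if "0 \<le> u" for u using inc[of 0 u] P0 that by simp
  show "continuous_on {0..q} P" for q
  proof (rule lipschitz_on_continuous_on)
    show "(?K * (1 + max 0 q))-lipschitz_on {0..q} P"
    proof (rule lipschitz_onI)
      have le: "\<bar>P b - P a\<bar> \<le> ?K * (1 + max 0 q) * (b - a)" if "0 \<le> a" "a \<le> b" "b \<le> q" for a b
      proof -
        have "\<bar>P b - P a\<bar> \<le> ?K * ((b - a) * (1 + b))" using inc[of a b] that by simp
        also have "\<dots> \<le> ?K * ((b - a) * (1 + max 0 q))"
          using that by (intro mult_left_mono) auto
        finally show ?thesis by (simp add: mult_ac)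
      qed
      fix x y assume "x \<in> {0..q}" "y \<in> {0..q}"
      then show "dist (P x) (P y) \<le> ?K * (1 + max 0 q) * dist x y"
        using le[of x y] le[of y x] by (cases "x \<le> y") (auto simp: dist_real_def abs_minus_commute)
    qed simp
  qed
  have "(\<forall>u>0. 0 < P u) \<or> (\<forall>u\<ge>0. P u = 0)"
  proof (cases "?K = 0")
    case True
    then show ?thesis using inc[of 0] P0 nonneg by force
  next
    case False
    have "0 < P u" if u: "0 < u" for u
    proof -
      obtain c where c: "0 < c" "\<And>y. y \<in> {0..1} \<Longrightarrow> c \<le> compact_kernel u y"
        using compact_kernel_lower_bound[OF u] by blast
      have "c * ?K \<le> P u"
        unfolding P_def by (rule kernel_integral_lower_bound[OF \<Lambda> c(2)]) (use u in auto)
      moreover have "0 < c * ?K" using c False by (simp add: zero_less_measure_iff less_le)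
      ultimately show ?thesis by linarith
    qed
    then show ?thesis by blast
  qed
  then show "\<exists>\<phi>. solves_branching_ode P \<phi>"
    using inc P0 by (intro solves_branching_ode_exists) auto
qed

lemma solves_branching_ode_cong:
  assumes "\<And>u. 0 \<le> u \<Longrightarrow> \<Psi> u = P u"
  shows "solves_branching_ode \<Psi> \<phi> \<longleftrightarrow> solves_branching_ode P \<phi>"
  using assms unfolding solves_branching_ode_def by (intro all_cong imp_cong conj_cong refl) auto

lemma floor_times_step_tendsto:
  fixes \<tau> :: "nat \<Rightarrow> real"
  assumes "\<And>k. 0 < \<tau> k" "\<tau> \<longlonglongrightarrow> 0" "0 \<le> t"
  shows "(\<lambda>k. real (nat \<lfloor>t / \<tau> k\<rfloor>) * \<tau> k) \<longlonglongrightarrow> t"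
proof (rule tendsto_sandwich)
  have *: "t - \<tau> k \<le> real (nat \<lfloor>t / \<tau> k\<rfloor>) * \<tau> k \<and> real (nat \<lfloor>t / \<tau> k\<rfloor>) * \<tau> k \<le> t" for k
  proof -
    have "0 \<le> t / \<tau> k" using assms(1)[of k] assms(3) by simp
    then have "real (nat \<lfloor>t / \<tau> k\<rfloor>) \<le> t / \<tau> k" "t / \<tau> k - 1 \<le> real (nat \<lfloor>t / \<tau> k\<rfloor>)"
      by linarith+
    then show ?thesis using assms(1)[of k] by (simp add: field_simps)
  qed
  show "\<forall>\<^sub>F k in sequentially. t - \<tau> k \<le> real (nat \<lfloor>t / \<tau> k\<rfloor>) * \<tau> k"
    "\<forall>\<^sub>F k in sequentially. real (nat \<lfloor>t / \<tau> k\<rfloor>) * \<tau> k \<le> t" using * by auto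
  show "(\<lambda>k. t - \<tau> k) \<longlonglongrightarrow> t" using tendsto_diff[OF tendsto_const assms(2), of t] by simp
qed simp

lemma unit_interval_measure_compactified_levy:
  assumes "(\<lambda>j. real j * pmf \<pi> j) sums 1" "0 < h" "0 < \<tau>"
  shows "unit_interval_measure (compactified_levy \<pi> h \<tau>)"
  using finite_measure_compactified_levy[OF assms] AE_compactified_levy[OF assms(2)]
  by (simp add: unit_interval_measure_def)

lemma unit_interval_test_const: "unit_interval_test (\<lambda>_. c)"
  by (simp add: unit_interval_test_def)

locale scaled_offspring =
  fixes \<pi> :: "nat \<Rightarrow> nat pmf" and h \<tau> :: "nat \<Rightarrow> real"
  assumes mean: "\<And>k. (\<lambda>j. real j * pmf (\<pi> k) j) sums 1"
    and h_pos: "\<And>k. 0 < h k" and h_lim: "h \<longlonglongrightarrow> 0"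
    and \<tau>_pos: "\<And>k. 0 < \<tau> k" and \<tau>_lim: "\<tau> \<longlonglongrightarrow> 0"
begin

abbreviation "\<Lambda> k \<equiv> compactified_levy (\<pi> k) (h k) (\<tau> k)"
abbreviation "\<Psi> k \<equiv> discrete_mechanism (\<pi> k) (h k) (\<tau> k)"

lemma \<Lambda>: "unit_interval_measure (\<Lambda> k)"
  by (rule unit_interval_measure_compactified_levy[OF mean h_pos \<tau>_pos])

lemma eventually_h_small: "0 < c \<Longrightarrow> \<forall>\<^sub>F k in sequentially. h k < c"
  using h_lim by (rule order_tendstoD)

lemma eventually_h_times_le: "\<forall>\<^sub>F k in sequentially. h k * u \<le> 1/2"
proof -
  have "(\<lambda>k. h k * u) \<longlonglongrightarrow> 0 * u" by (intro tendsto_intros h_lim)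
  then have "\<forall>\<^sub>F k in sequentially. h k * u < 1/2" by (rule order_tendstoD) simp
  then show ?thesis by eventually_elim simp
qed

lemma mechanism_near_kernel:
  assumes "0 \<le> u"
  shows "\<forall>\<^sub>F k in sequentially. \<bar>\<Psi> k u - (\<integral>y. compact_kernel u y \<partial>\<Lambda> k)\<bar>
      \<le> (u ^ 3 + 6 * u + 2) * h k * measure (\<Lambda> k) UNIV"
  using eventually_h_small[of "1/2", simplified] eventually_h_times_le[of u]
proof eventually_elim
  case (elim k)
  then show ?case
    using assms by (intro discrete_mechanism_near_kernel_integral mean h_pos \<tau>_pos) auto
qed

lemma mechanism_tendsto:
  assumes conv: "\<And>F. unit_interval_test F \<Longrightarrow> (\<lambda>k. \<integral>y. F y \<partial>\<Lambda> k) \<longlonglongrightarrow> (\<integral>y. F y \<partial>\<Lambda>')" and "0 \<le> u"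
  shows "(\<lambda>k. \<Psi> k u) \<longlonglongrightarrow> (\<integral>y. compact_kernel u y \<partial>\<Lambda>')"
proof -
  have "(\<lambda>k. measure (\<Lambda> k) UNIV) \<longlonglongrightarrow> (\<integral>y. 1 \<partial>\<Lambda>')"
    using conv[OF unit_interval_test_const[of 1]] by (simp add: unit_interval_measure_space[OF \<Lambda>])
  then have "(\<lambda>k. (u ^ 3 + 6 * u + 2) * h k * measure (\<Lambda> k) UNIV)
      \<longlonglongrightarrow> (u ^ 3 + 6 * u + 2) * 0 * (\<integral>y. 1 \<partial>\<Lambda>')"
    by (intro tendsto_intros h_lim)
  then have bound: "(\<lambda>k. (u ^ 3 + 6 * u + 2) * h k * measure (\<Lambda> k) UNIV) \<longlonglongrightarrow> 0" by simp
  have "(\<lambda>k. \<Psi> k u - (\<integral>y. compact_kernel u y \<partial>\<Lambda> k)) \<longlonglongrightarrow> 0"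
    by (rule Lim_null_comparison[OF _ bound])
       (use mechanism_near_kernel[OF \<open>0 \<le> u\<close>] in simp)
  from tendsto_add[OF this conv[OF unit_interval_test_compact_kernel[OF \<open>0 \<le> u\<close>]]]
  show ?thesis by simp
qed

lemma gw_phi_initial_tendsto:
  assumes "0 \<le> q" shows "(\<lambda>k. gw_phi (\<pi> k) (h k) 0 q) \<longlonglongrightarrow> q"
proof (cases "q = 0")
  case True
  then show ?thesis by (simp add: gw_phi_0[OF h_pos])
next
  case False
  then have "0 < q" using assms by simp
  then have "((\<lambda>x. (1 - exp (- x * q)) / x) \<longlongrightarrow> q) (at_right 0)" by real_asymp
  moreover have "filterlim h (at_right 0) sequentially"
    using h_lim h_pos by (intro tendsto_imp_filterlim_at_right) auto
  ultimately have "(\<lambda>k. (1 - exp (- h k * q)) / h k) \<longlonglongrightarrow> q" by (rule filterlim_compose)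
  then show ?thesis by (simp add: gw_phi_0[OF h_pos assms])
qed

text \<open>
  The initial values converge, and the discrete mechanisms converge uniformly on \<open>[0, q]\<close>, being
  monotone with continuous limit; the error bound for nonexpansive Euler schemes does the rest.
\<close>

lemma gw_phi_converges_to_ode:
  assumes \<Lambda>': "unit_interval_measure \<Lambda>'"
    and conv: "\<And>F. unit_interval_test F \<Longrightarrow> (\<lambda>k. \<integral>y. F y \<partial>\<Lambda> k) \<longlonglongrightarrow> (\<integral>y. F y \<partial>\<Lambda>')"
    and sol: "solves_branching_ode (\<lambda>u. \<integral>y. compact_kernel u y \<partial>\<Lambda>') \<phi>"
  shows "gw_phi_converges \<pi> h \<tau> \<phi>"
  unfolding gw_phi_converges_def
proof (intro allI impI)
  fix q t :: real and n :: "nat \<Rightarrow> nat"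
  assume q: "0 \<le> q" and t: "0 \<le> t" and n: "(\<lambda>k. real (n k) * \<tau> k) \<longlonglongrightarrow> t"
  define P where "P u = (\<integral>y. compact_kernel u y \<partial>\<Lambda>')" for u
  have P: "P 0 = 0" "mono_on {0..} P" "\<And>u. 0 \<le> u \<Longrightarrow> 0 \<le> P u" "continuous_on {0..q} P"
    using kernel_integral_mechanism[OF \<Lambda>'] unfolding P_def[abs_def] by blast+
  have sol: "solves_branching_ode P \<phi>" using sol by (simp add: P_def[abs_def])
  have "continuous (at t within {0..}) (\<phi> q)"
    by (rule DERIV_continuous[OF solves_branching_odeD(3)[OF sol q t]])
  moreover have "real (n k) * \<tau> k \<in> {0..}" for k using less_imp_le[OF \<tau>_pos[of k]] by simp
  ultimately have "(\<lambda>k. \<phi> q (real (n k) * \<tau> k)) \<longlonglongrightarrow> \<phi> q t"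
    using n by (rule continuous_within_tendsto_compose')
  moreover have "(\<lambda>k. gw_phi (\<pi> k) (h k) (n k) q - \<phi> q (real (n k) * \<tau> k)) \<longlonglongrightarrow> 0"
  proof (rule tendstoI)
    fix e :: real assume "0 < e"
    define e' where "e' = e / (4 * (t + 1))"
    have "0 < e'" using \<open>0 < e\<close> t by (simp add: e'_def)
    have "mono_on {0..q} P" using P(2) by (rule mono_on_subset) auto
    moreover have "(\<lambda>k. \<Psi> k u) \<longlonglongrightarrow> P u" if "u \<in> {0..q}" for u
      unfolding P_def using that by (intro mechanism_tendsto conv) auto
    moreover have "\<forall>\<^sub>F k in sequentially. mono_on {0..q} (\<Psi> k)"
      using eventually_h_times_le[of q]
    proof eventually_elim
      case (elim k)
      then have "q \<le> 1 / h k" using h_pos[of k] by (simp add: field_simps)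
      then show ?case
        by (intro mono_on_subset[OF discrete_mechanism_mono[OF mean h_pos \<tau>_pos]]) auto
    qed
    ultimately have unif: "\<forall>\<^sub>F k in sequentially. \<forall>u\<in>{0..q}. \<bar>\<Psi> k u - P u\<bar> \<le> e'"
      using \<open>0 < e'\<close> by (intro monotone_pointwise_imp_uniform[OF q P(4)])
    have "(\<lambda>k. \<tau> k * P q) \<longlonglongrightarrow> 0 * P q" by (intro tendsto_intros \<tau>_lim)
    then have trunc: "\<forall>\<^sub>F k in sequentially. \<tau> k * P q < e / 4"
      using \<open>0 < e\<close> by (intro order_tendstoD(2)[of _ 0]) auto
    have init: "\<forall>\<^sub>F k in sequentially. \<bar>gw_phi (\<pi> k) (h k) 0 q - q\<bar> < e / 4"
      using tendstoD[OF gw_phi_initial_tendsto[OF q], of "e / 4"] \<open>0 < e\<close> by (simp add: dist_real_def)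
    have time: "\<forall>\<^sub>F k in sequentially. real (n k) * \<tau> k < t + 1"
      using n by (rule order_tendstoD) simp
    show "\<forall>\<^sub>F k in sequentially. dist (gw_phi (\<pi> k) (h k) (n k) q - \<phi> q (real (n k) * \<tau> k)) 0 < e"
      using unif trunc init time eventually_h_times_le[of q]
    proof eventually_elim
      case (elim k)
      let ?u = "\<lambda>i. gw_phi (\<pi> k) (h k) i q"
      have "q \<le> 1 / h k" using elim(5) h_pos[of k] by (simp add: field_simps)
      have err: "\<bar>?u (n k) - \<phi> q (real (n k) * \<tau> k)\<bar>
          \<le> \<bar>?u 0 - q\<bar> + real (n k) * \<tau> k * e' + \<tau> k * (P q - P (\<phi> q (real (n k) * \<tau> k)))"
      proof (rule nonexpansive_euler_error[OF P(2) _ sol q \<tau>_pos, where Q = "\<Psi> k"])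
        show "\<bar>\<Psi> k v - P v\<bar> \<le> e'" if "v \<in> {0..q}" for v using elim(1) that by blast
        show "\<bar>(v - \<tau> k * \<Psi> k v) - (w - \<tau> k * \<Psi> k w)\<bar> \<le> \<bar>v - w\<bar>"
          if "v \<in> {0..q}" "w \<in> {0..q}" for v w
          using that \<open>q \<le> 1 / h k\<close>
          by (intro discrete_step_nonexpansive mean h_pos \<tau>_pos) auto
        show "?u i \<in> {0..q}" for i using gw_phi_range[OF mean h_pos q] by simp
        show "?u (Suc i) = ?u i - \<tau> k * \<Psi> k (?u i)" for i
          by (rule gw_phi_Suc[OF h_pos \<tau>_pos q])
      qed (simp add: P(1))
      have "real (n k) * \<tau> k * e' \<le> (t + 1) * e'"
        using elim(4) \<open>0 < e'\<close> by (intro mult_right_mono) auto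
      also have "\<dots> = e / 4" using t by (simp add: e'_def field_simps)
      finally have "real (n k) * \<tau> k * e' \<le> e / 4" .
      moreover have "0 \<le> P (\<phi> q (real (n k) * \<tau> k))"
        using \<tau>_pos[of k] by (intro P(3) solves_branching_odeD(2)[OF sol q]) simp
      then have "\<tau> k * (P q - P (\<phi> q (real (n k) * \<tau> k))) \<le> \<tau> k * P q"
        using \<tau>_pos[of k] by (intro mult_left_mono) auto
      ultimately show ?case using err elim(2,3) \<open>0 < e\<close> by (simp add: dist_real_def)
    qed
  qed
  ultimately have "(\<lambda>k. (gw_phi (\<pi> k) (h k) (n k) q - \<phi> q (real (n k) * \<tau> k)) + \<phi> q (real (n k) * \<tau> k))
      \<longlonglongrightarrow> 0 + \<phi> q t" by (intro tendsto_add)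
  then show "(\<lambda>k. gw_phi (\<pi> k) (h k) (n k) q) \<longlonglongrightarrow> \<phi> q t" by simp
qed

text \<open>
  A subsequence of the weighted laws of \<open>h X\<close> converges, and \<open>gw_phi\<close> is their integral of a function that
  is continuous on the whole compactification, so the integral representation passes to the limit.
\<close>

lemma gw_limit_representation:
  assumes conv: "gw_phi_converges \<pi> h \<tau> \<phi>" and "0 \<le> t"
  obtains \<beta> \<nu> where "0 \<le> \<beta>" "halfline_measure \<nu>" "finite_min_moment \<nu>"
    "\<And>q. 0 \<le> q \<Longrightarrow> \<phi> q t = \<beta> * q + (\<integral>x. 1 - exp (- q * x) \<partial>\<nu>)"
proof -
  define n where "n k = nat \<lfloor>t / \<tau> k\<rfloor>" for k
  have lim: "(\<lambda>k. gw_phi (\<pi> k) (h k) (n k) q) \<longlonglongrightarrow> \<phi> q t" if "0 \<le> q" for q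
    unfolding n_def
    by (rule conv[unfolded gw_phi_converges_def, rule_format, OF that \<open>0 \<le> t\<close>
          floor_times_step_tendsto[OF \<tau>_pos \<tau>_lim \<open>0 \<le> t\<close>]])
  have range: "0 \<le> \<phi> q t" "\<phi> q t \<le> q" if "0 \<le> q" for q
    using gw_phi_range[OF mean h_pos that]
    by (auto intro: LIMSEQ_le_const[OF lim[OF that]] LIMSEQ_le_const2[OF lim[OF that]])
  let ?\<rho> = "\<lambda>k. gw_exp_law (\<pi> k) (h k) (n k)"
  have "measure (?\<rho> k) UNIV \<le> 1" for k
    using gw_phi_range(2)[OF mean h_pos, of 1] by (simp add: gw_exp_law_props(3)[OF h_pos])
  then obtain r \<rho> where r: "strict_mono (r :: nat \<Rightarrow> nat)" and \<rho>: "unit_interval_measure \<rho>"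
    and \<rho>_conv: "\<And>F. unit_interval_test F \<Longrightarrow> (\<lambda>k. \<integral>y. F y \<partial>?\<rho> (r k)) \<longlonglongrightarrow> (\<integral>y. F y \<partial>\<rho>)"
    using unit_interval_compactness[of ?\<rho> 1, OF gw_exp_law_props(1)[OF h_pos]] by blast
  have "\<phi> q t = (\<integral>y. bernstein_kernel q y \<partial>\<rho>)" if "0 < q" for q
  proof (rule LIMSEQ_unique)
    show "(\<lambda>k. gw_phi (\<pi> (r k)) (h (r k)) (n (r k)) q) \<longlonglongrightarrow> \<phi> q t"
      using LIMSEQ_subseq_LIMSEQ[OF lim r, of q] that by (simp add: comp_def)
    show "(\<lambda>k. gw_phi (\<pi> (r k)) (h (r k)) (n (r k)) q) \<longlonglongrightarrow> (\<integral>y. bernstein_kernel q y \<partial>\<rho>)"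
      using \<rho>_conv[OF unit_interval_test_bernstein_kernel[OF that]]
      by (simp add: gw_exp_law_props(2)[OF h_pos that])
  qed
  moreover have "\<phi> 0 t = 0" using range[of 0] by simp
  moreover have "\<phi> q t \<le> q" if "0 < q" for q using range(2)[of q] that by simp
  ultimately show ?thesis
    using bernstein_representation[OF \<rho>, of "\<lambda>q. \<phi> q t"] that by blast
qed

text \<open>
  As long as the Euler scheme is above \<open>\<delta>\<close>, it decreases by at least \<open>\<tau>\<close> times \<open>\<Psi> k \<delta>\<close> in each step, and \<open>\<Psi> k \<delta>\<close>
  is at least a constant times the total mass. By assumption it is still above \<open>\<delta>\<close> after time \<open>t\<^sub>0\<close>,
  but it started below \<open>q\<^sub>0\<close>; hence the masses are bounded.
\<close>

lemma kernel_mass_bounded: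
  assumes conv: "gw_phi_converges \<pi> h \<tau> \<phi>" and "0 < q\<^sub>0" "0 < t\<^sub>0" "0 < \<phi> q\<^sub>0 t\<^sub>0"
  obtains K where "\<And>k. measure (\<Lambda> k) UNIV \<le> K"
proof -
  let ?m = "\<lambda>k. measure (\<Lambda> k) UNIV"
  define \<delta> where "\<delta> = \<phi> q\<^sub>0 t\<^sub>0 / 2"
  have "0 < \<delta>" using assms by (simp add: \<delta>_def)
  obtain c where c: "0 < c" "\<And>y. y \<in> {0..1} \<Longrightarrow> c \<le> compact_kernel \<delta> y"
    using compact_kernel_lower_bound[OF \<open>0 < \<delta>\<close>] by blast
  define n where "n k = nat \<lfloor>t\<^sub>0 / \<tau> k\<rfloor>" for k
  have n: "(\<lambda>k. real (n k) * \<tau> k) \<longlonglongrightarrow> t\<^sub>0"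
    unfolding n_def using floor_times_step_tendsto[OF \<tau>_pos \<tau>_lim] assms by simp
  have "(\<lambda>k. gw_phi (\<pi> k) (h k) (n k) q\<^sub>0) \<longlonglongrightarrow> \<phi> q\<^sub>0 t\<^sub>0"
    by (rule conv[unfolded gw_phi_converges_def, rule_format, OF _ _ n]) (use assms in auto)
  then have alive: "\<forall>\<^sub>F k in sequentially. \<delta> < gw_phi (\<pi> k) (h k) (n k) q\<^sub>0"
    by (rule order_tendstoD) (use assms in \<open>simp add: \<delta>_def\<close>)
  have time: "\<forall>\<^sub>F k in sequentially. t\<^sub>0 / 2 < real (n k) * \<tau> k"
    using n by (rule order_tendstoD) (use assms in simp)
  \<comment> \<open>\<open>C h\<close> is the relative error of the mechanism at \<open>\<delta>\<close>; it is made smaller than \<open>c / 2\<close>.\<close>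
  define C where "C = \<delta> ^ 3 + 6 * \<delta> + 2"
  have "0 < C" using \<open>0 < \<delta>\<close> by (simp add: C_def add_pos_pos)
  have small: "\<forall>\<^sub>F k in sequentially. h k < c / (2 * C)"
    using c \<open>0 < C\<close> by (intro eventually_h_small) simp
  have "\<forall>\<^sub>F k in sequentially. ?m k \<le> 4 * q\<^sub>0 / (t\<^sub>0 * c)"
    using alive time small mechanism_near_kernel[OF less_imp_le[OF \<open>0 < \<delta>\<close>]]
  proof eventually_elim
    case (elim k)
    let ?u = "\<lambda>i. gw_phi (\<pi> k) (h k) i q\<^sub>0"
    have range: "0 \<le> ?u i" "?u i \<le> q\<^sub>0" "?u i \<le> 1 / h k" for i
      using gw_phi_range[OF mean h_pos] assms by auto
    have step: "?u (Suc i) = ?u i - \<tau> k * \<Psi> k (?u i)" for i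
      using gw_phi_Suc[OF h_pos \<tau>_pos] assms by simp
    have mono: "mono_on {0..1 / h k} (\<Psi> k)" by (rule discrete_mechanism_mono[OF mean h_pos \<tau>_pos])
    have "0 \<le> \<Psi> k (?u i)" for i
      using mono_onD[OF mono, of 0 "?u i"] range[of i] h_pos[of k] by simp
    then have "?u (Suc i) \<le> ?u i" for i using step[of i] \<tau>_pos[of k] by simp
    then have "antimono ?u" by (rule decseq_SucI)
    then have u_ge: "\<delta> \<le> ?u i" if "i \<le> n k" for i
      using antimonoD[of ?u i "n k"] that elim(1) by simp
    have m: "0 \<le> ?m k" by simp
    have "C * h k * ?m k \<le> c / 2 * ?m k"
    proof (rule mult_right_mono[OF _ m])
      show "C * h k \<le> c / 2" using elim(3) \<open>0 < C\<close> by (simp add: field_simps)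
    qed
    moreover have "c * ?m k \<le> (\<integral>y. compact_kernel \<delta> y \<partial>\<Lambda> k)"
      using \<open>0 < \<delta>\<close> by (intro kernel_integral_lower_bound[OF \<Lambda>] c) auto
    moreover have "\<bar>\<Psi> k \<delta> - (\<integral>y. compact_kernel \<delta> y \<partial>\<Lambda> k)\<bar> \<le> C * h k * ?m k"
      using elim(4) by (simp add: C_def)
    moreover have "c * ?m k = c / 2 * ?m k + c / 2 * ?m k" by (simp add: algebra_simps)
    ultimately have \<Psi>_ge: "c / 2 * ?m k \<le> \<Psi> k \<delta>" by linarith
    have "\<delta> \<le> 1 / h k" using u_ge[of 0] range(3)[of 0] by linarith
    then have \<Psi>_u: "c / 2 * ?m k \<le> \<Psi> k (?u i)" if "i \<le> n k" for i
      using mono_onD[OF mono, of \<delta> "?u i"] u_ge[OF that] range[of i] \<open>0 < \<delta>\<close> \<Psi>_ge by simp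
    have "i \<le> n k \<Longrightarrow> ?u i \<le> q\<^sub>0 - real i * \<tau> k * (c / 2 * ?m k)" for i
    proof (induction i)
      case 0
      then show ?case using range(2)[of 0] by simp
    next
      case (Suc i)
      have "\<tau> k * (c / 2 * ?m k) \<le> \<tau> k * \<Psi> k (?u i)"
        using \<Psi>_u[of i] Suc.prems \<tau>_pos[of k] by (intro mult_left_mono) auto
      moreover have "real (Suc i) * \<tau> k * (c / 2 * ?m k) = real i * \<tau> k * (c / 2 * ?m k) + \<tau> k * (c / 2 * ?m k)"
        by (simp add: algebra_simps)
      ultimately show ?case using Suc step[of i] by linarith
    qed
    from this[of "n k"] have "real (n k) * \<tau> k * (c / 2 * ?m k) \<le> q\<^sub>0" using range(1)[of "n k"] by simp
    moreover have "t\<^sub>0 / 2 * (c / 2 * ?m k) \<le> real (n k) * \<tau> k * (c / 2 * ?m k)"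
      using elim(2) c m by (intro mult_right_mono) auto
    ultimately have "t\<^sub>0 / 2 * (c / 2 * ?m k) \<le> q\<^sub>0" by linarith
    then show ?case using c assms by (simp add: field_simps)
  qed
  then obtain N where N: "\<And>k. N \<le> k \<Longrightarrow> ?m k \<le> 4 * q\<^sub>0 / (t\<^sub>0 * c)" by (auto simp: eventually_sequentially)
  \<comment> \<open>The sum takes care of the finitely many \<open>k\<close> for which the bound may fail.\<close>
  have "?m k \<le> 4 * q\<^sub>0 / (t\<^sub>0 * c) + (\<Sum>i<N. ?m i)" for k
  proof (cases "N \<le> k")
    case True
    then show ?thesis using N[of k] sum_nonneg[of "{..<N}" ?m] by simp
  next
    case False
    then have "?m k \<le> (\<Sum>i<N. ?m i)" by (intro member_le_sum) auto
    moreover have "0 \<le> 4 * q\<^sub>0 / (t\<^sub>0 * c)" using c assms by simp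
    ultimately show ?thesis by linarith
  qed
  then show ?thesis by (rule that)
qed

lemma scaled_offspring_subseq:
  assumes "strict_mono r" shows "scaled_offspring (\<pi> \<circ> r) (h \<circ> r) (\<tau> \<circ> r)"
  using mean h_pos \<tau>_pos LIMSEQ_subseq_LIMSEQ[OF h_lim assms] LIMSEQ_subseq_LIMSEQ[OF \<tau>_lim assms]
  by unfold_locales (auto simp: comp_def)

text \<open>
  Along the subsequence \<open>gw_phi\<close> converges both to \<open>\<phi>\<close> and to the flow of the limiting mechanism, so the two
  agree and the mechanism can be read off from \<open>\<phi>\<close> at time zero.
\<close>

lemma subsequential_mechanism:
  assumes conv: "gw_phi_converges \<pi> h \<tau> \<phi>" and r: "strict_mono r" and \<Lambda>': "unit_interval_measure \<Lambda>'"
    and \<Lambda>_conv: "\<And>F. unit_interval_test F \<Longrightarrow> (\<lambda>k. \<integral>y. F y \<partial>\<Lambda> (r k)) \<longlonglongrightarrow> (\<integral>y. F y \<partial>\<Lambda>')"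
    and "0 \<le> q"
  shows "(\<phi> q has_real_derivative - (\<integral>y. compact_kernel q y \<partial>\<Lambda>')) (at 0 within {0..})"
proof -
  interpret sub: scaled_offspring "\<pi> \<circ> r" "h \<circ> r" "\<tau> \<circ> r" by (rule scaled_offspring_subseq[OF r])
  obtain \<psi> where \<psi>: "solves_branching_ode (\<lambda>u. \<integral>y. compact_kernel u y \<partial>\<Lambda>') \<psi>"
    using kernel_integral_mechanism(5)[OF \<Lambda>'] by blast
  have \<psi>_conv: "gw_phi_converges (\<pi> \<circ> r) (h \<circ> r) (\<tau> \<circ> r) \<psi>"
    using \<Lambda>_conv by (intro sub.gw_phi_converges_to_ode[OF \<Lambda>' _ \<psi>]) simp
  have eq: "\<psi> q t = \<phi> q t" if "0 \<le> t" for t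
  proof -
    define n where "n k = nat \<lfloor>t / \<tau> k\<rfloor>" for k
    have n: "(\<lambda>k. real (n k) * \<tau> k) \<longlonglongrightarrow> t"
      unfolding n_def by (rule floor_times_step_tendsto[OF \<tau>_pos \<tau>_lim that])
    have "(\<lambda>k. gw_phi (\<pi> k) (h k) (n k) q) \<longlonglongrightarrow> \<phi> q t"
      by (rule conv[unfolded gw_phi_converges_def, rule_format, OF \<open>0 \<le> q\<close> that n])
    from LIMSEQ_subseq_LIMSEQ[OF this r]
    have "(\<lambda>k. gw_phi (\<pi> (r k)) (h (r k)) (n (r k)) q) \<longlonglongrightarrow> \<phi> q t" by (simp add: comp_def)
    moreover have "(\<lambda>k. real (n (r k)) * \<tau> (r k)) \<longlonglongrightarrow> t"
      using LIMSEQ_subseq_LIMSEQ[OF n r] by (simp add: comp_def)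
    then have "(\<lambda>k. gw_phi (\<pi> (r k)) (h (r k)) (n (r k)) q) \<longlonglongrightarrow> \<psi> q t"
      using \<psi>_conv[unfolded gw_phi_converges_def, rule_format, OF \<open>0 \<le> q\<close> that, of "n \<circ> r"] by simp
    ultimately show ?thesis using LIMSEQ_unique by blast
  qed
  have "(\<psi> q has_real_derivative - (\<integral>y. compact_kernel (\<psi> q 0) y \<partial>\<Lambda>')) (at 0 within {0..})"
    by (rule solves_branching_odeD(3)[OF \<psi> \<open>0 \<le> q\<close>]) simp
  then have "(\<psi> q has_real_derivative - (\<integral>y. compact_kernel q y \<partial>\<Lambda>')) (at 0 within {0..})"
    by (simp add: solves_branching_odeD(1)[OF \<psi> \<open>0 \<le> q\<close>])
  then show ?thesis
    by (rule has_field_derivative_transform_within[of _ _ _ _ 1]) (auto simp: eq)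
qed

text \<open>
  The masses are bounded, so every subsequence has a convergent subsubsequence. All limits have the
  mechanism determined by \<open>\<phi>\<close> and therefore coincide.
\<close>

lemma compactified_levy_converges:
  assumes conv: "gw_phi_converges \<pi> h \<tau> \<phi>" and pos: "0 < q\<^sub>0" "0 < t\<^sub>0" "0 < \<phi> q\<^sub>0 t\<^sub>0"
  obtains \<Lambda>' where "unit_interval_measure \<Lambda>'"
    "\<And>F. unit_interval_test F \<Longrightarrow> (\<lambda>k. \<integral>y. F y \<partial>\<Lambda> k) \<longlonglongrightarrow> (\<integral>y. F y \<partial>\<Lambda>')"
proof -
  obtain K where K: "\<And>k. measure (\<Lambda> k) UNIV \<le> K" using kernel_mass_bounded[OF conv pos] by blast
  obtain r \<Lambda>' where r: "strict_mono (r :: nat \<Rightarrow> nat)" and \<Lambda>': "unit_interval_measure \<Lambda>'"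
    and r_conv: "\<And>F. unit_interval_test F \<Longrightarrow> (\<lambda>k. \<integral>y. F y \<partial>\<Lambda> (r k)) \<longlonglongrightarrow> (\<integral>y. F y \<partial>\<Lambda>')"
    by (rule unit_interval_compactness[of "\<lambda>k. \<Lambda> k" K, OF \<Lambda> K]) (rule that)
  have "(\<lambda>k. \<integral>y. F y \<partial>\<Lambda> k) \<longlonglongrightarrow> (\<integral>y. F y \<partial>\<Lambda>')" if F: "unit_interval_test F" for F
  proof (rule tendsto_subsubsequence)
    fix a :: "nat \<Rightarrow> nat" assume a: "strict_mono a"
    obtain s \<Lambda>'' where s: "strict_mono (s :: nat \<Rightarrow> nat)" and \<Lambda>'': "unit_interval_measure \<Lambda>''"
      and s_conv: "\<And>F. unit_interval_test F \<Longrightarrow> (\<lambda>k. \<integral>y. F y \<partial>\<Lambda> (a (s k))) \<longlonglongrightarrow> (\<integral>y. F y \<partial>\<Lambda>'')"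
      by (rule unit_interval_compactness[of "\<lambda>k. \<Lambda> (a k)" K, OF \<Lambda> K]) (rule that)
    have "(\<integral>y. compact_kernel u y \<partial>\<Lambda>'') = (\<integral>y. compact_kernel u y \<partial>\<Lambda>')" if "0 \<le> u" for u
    proof -
      have "(\<phi> u has_real_derivative - (\<integral>y. compact_kernel u y \<partial>\<Lambda>')) (at 0 within {0..})"
        by (rule subsequential_mechanism[OF conv r \<Lambda>' r_conv that])
      moreover have "(\<phi> u has_real_derivative - (\<integral>y. compact_kernel u y \<partial>\<Lambda>'')) (at 0 within {0..})"
        using subsequential_mechanism[OF conv strict_mono_o[OF a s] \<Lambda>'' _ that] s_conv by simp
      moreover have "at (0::real) within {0..} \<noteq> bot"
        by (simp add: at_within_Ici_at_right trivial_limit_at_right_real)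
      ultimately have "- (\<integral>y. compact_kernel u y \<partial>\<Lambda>'') = - (\<integral>y. compact_kernel u y \<partial>\<Lambda>')"
        unfolding has_real_derivative_iff_has_vector_derivative by (metis vector_derivative_unique_within)
      then show ?thesis by simp
    qed
    then have "(\<integral>y. F y \<partial>\<Lambda>'') = (\<integral>y. F y \<partial>\<Lambda>')"
      by (rule kernel_integrals_determine[OF \<Lambda>'' \<Lambda>' _ F])
    then show "\<exists>s. strict_mono (s :: nat \<Rightarrow> nat) \<and> (\<lambda>k. \<integral>y. F y \<partial>\<Lambda> (a (s k))) \<longlonglongrightarrow> (\<integral>y. F y \<partial>\<Lambda>')"
      using s s_conv[OF F] by auto
  qed
  with \<Lambda>' show ?thesis by (rule that)
qed

end

section \<open>Levy-convergence in the exponential coordinate\<close>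

lemma integral_breve_mu:
  assumes "0 < h" "0 < \<tau>" and f: "f \<in> borel_measurable borel" and f0: "f 0 = (0::real)"
  shows "(\<integral>x. f x \<partial>breve_mu \<pi> h \<tau>)
       = measure_pmf.expectation \<pi> (\<lambda>j. (real j - 1) / \<tau> * f (real j * h))"
proof -
  let ?w = "\<lambda>j. 1 / \<tau> * ((real j - 1) * pmf \<pi> j)"
  have m: "(\<lambda>j. real j * h) \<in> measurable (density (count_space {2..}) (\<lambda>j. ennreal (?w j))) (restrict_space borel {0<..})"
    using assms(1) by (auto simp: measurable_def space_restrict_space)
  have "(\<integral>x. f x \<partial>breve_mu \<pi> h \<tau>) = (\<integral>j. f (real j * h) \<partial>density (count_space {2..}) (\<lambda>j. ennreal (?w j)))"
    unfolding breve_mu_def by (rule integral_distr[OF m measurable_restrict_space1[OF f]])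
  also have "\<dots> = (\<integral>j. ?w j *\<^sub>R f (real j * h) \<partial>count_space {2..})"
    using \<open>0 < \<tau>\<close> by (intro integral_density) (auto simp: AE_count_space)
  also have "count_space {2..} = restrict_space (count_space UNIV) {2::nat..}"
    by (simp add: restrict_count_space)
  also have "(\<integral>j. ?w j *\<^sub>R f (real j * h) \<partial>restrict_space (count_space UNIV) {2..})
      = (\<integral>j. indicator {2..} j *\<^sub>R (?w j *\<^sub>R f (real j * h)) \<partial>count_space UNIV)"
    by (rule integral_restrict_space) simp
  also have "\<dots> = (\<integral>j. pmf \<pi> j *\<^sub>R ((real j - 1) / \<tau> * f (real j * h)) \<partial>count_space UNIV)"
  proof (intro Bochner_Integration.integral_cong refl)
    fix j :: nat
    consider "j = 0" | "j = 1" | "2 \<le> j" by linarith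
    then show "indicator {2..} j *\<^sub>R (?w j *\<^sub>R f (real j * h)) = pmf \<pi> j *\<^sub>R ((real j - 1) / \<tau> * f (real j * h))"
      by cases (auto simp: f0)
  qed
  also have "\<dots> = measure_pmf.expectation \<pi> (\<lambda>j. (real j - 1) / \<tau> * f (real j * h))"
    unfolding measure_pmf_eq_density by (rule integral_density[symmetric]) auto
  finally show ?thesis .
qed

text \<open>
  A function of \<open>x\<close> on \<open>[0, \<infinity>]\<close> that is \<open>F\<close> in the coordinate \<open>exp (- x)\<close> has the same integral on either
  side; this identifies the integrals in the definition of Levy-convergence.
\<close>

lemma integral_breve_mu_compactified:
  fixes g :: "ennreal \<Rightarrow> real"
  assumes "0 < h" "0 < \<tau>" and g: "g \<in> borel_measurable borel" and F: "F \<in> borel_measurable borel"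
    and eq: "\<And>x. 0 \<le> x \<Longrightarrow> g (ennreal x) = F (exp (- x))"
  shows "(\<integral>x. g (ennreal x) * min x 1 \<partial>breve_mu \<pi> h \<tau>) = (\<integral>y. F y \<partial>compactified_levy \<pi> h \<tau>)"
proof -
  have "(\<lambda>x. g (ennreal x) * min x 1) \<in> borel_measurable borel"
    by (intro borel_measurable_times measurable_compose[OF measurable_ennreal g]) simp
  then have "(\<integral>x. g (ennreal x) * min x 1 \<partial>breve_mu \<pi> h \<tau>)
      = measure_pmf.expectation \<pi> (\<lambda>j. (real j - 1) / \<tau> * (g (ennreal (real j * h)) * min (real j * h) 1))"
    by (rule integral_breve_mu[OF assms(1,2)]) simp
  also have "\<dots> = measure_pmf.expectation \<pi> (\<lambda>j. (real j - 1) / \<tau> * min (real j * h) 1 * F (exp (- (real j * h))))"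
    using \<open>0 < h\<close> by (intro Bochner_Integration.integral_cong refl) (simp add: eq)
  finally show ?thesis by (simp only: integral_compactified_levy[OF assms(1,2) F])
qed

text \<open>
  The homeomorphism of \<open>[0, \<infinity>]\<close> with \<open>[0, 1]\<close> behind the change of coordinates; \<open>neg_ln\<close> is its inverse.
\<close>

definition exp_neg :: "ennreal \<Rightarrow> real" where
  "exp_neg x = (if x = \<infinity> then 0 else exp (- enn2real x))"

definition neg_ln :: "real \<Rightarrow> ennreal" where
  "neg_ln y = (if y \<le> 0 then \<infinity> else ennreal (- ln y))"

lemma exp_neg_ennreal [simp]: "0 \<le> x \<Longrightarrow> exp_neg (ennreal x) = exp (- x)"
  by (simp add: exp_neg_def)

lemma exp_neg_range: "exp_neg x \<in> {0..1}"
  by (auto simp: exp_neg_def)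

lemma continuous_exp_neg: "continuous_on UNIV exp_neg"
  unfolding continuous_on_def
proof
  fix x :: ennreal
  show "(exp_neg \<longlongrightarrow> exp_neg x) (at x within UNIV)"
  proof (cases x)
    case (real r)
    have "((\<lambda>z. exp (- enn2real z)) \<longlongrightarrow> exp (- r)) (at x)"
      using real by (intro tendsto_intros tendsto_enn2real) auto
    moreover have "\<forall>\<^sub>F z in at x. z < top"
      using real by (intro order_tendstoD(2)[OF tendsto_ident_at]) auto
    then have "\<forall>\<^sub>F z in at x. exp (- enn2real z) = exp_neg z"
      by eventually_elim (auto simp: exp_neg_def)
    ultimately have "(exp_neg \<longlongrightarrow> exp (- r)) (at x)" by (rule Lim_transform_eventually)
    then show ?thesis using real by simp
  next
    case top
    have "(exp_neg \<longlongrightarrow> 0) (at x)"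
    proof (rule order_tendstoI)
      fix a :: real assume "a < 0"
      then show "\<forall>\<^sub>F z in at x. a < exp_neg z"
        by (intro always_eventually) (auto simp: exp_neg_def intro: less_trans)
    next
      fix a :: real assume "0 < a"
      define M where "M = max 0 (- ln a)"
      have "\<forall>\<^sub>F z in at x. ennreal M < z"
        using top by (intro order_tendstoD(1)[OF tendsto_ident_at]) auto
      then show "\<forall>\<^sub>F z in at x. exp_neg z < a"
      proof eventually_elim
        case (elim z)
        show ?case
        proof (cases z)
          case (real r)
          have "0 \<le> M" by (simp add: M_def)
          then have "M < r" using elim real by (simp add: ennreal_less_iff)
          then have "exp (- r) < exp (ln a)" by (simp add: M_def)
          then show ?thesis using real \<open>0 < a\<close> by simp
        qed (use \<open>0 < a\<close> in \<open>simp add: exp_neg_def\<close>)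
      qed
    qed
    then show ?thesis using top by (simp add: exp_neg_def)
  qed
qed

lemma continuous_neg_ln: "continuous_on {0..1} neg_ln"
proof -
  have "filterlim (\<lambda>y::real. - ln y) at_top (at_right 0)" by real_asymp
  then have "((\<lambda>y. ennreal (- ln y)) \<longlongrightarrow> \<infinity>) (at_right 0)"
    by (simp add: ennreal_tendsto_top_eq_at_top)
  then have lim0: "(neg_ln \<longlongrightarrow> \<infinity>) (at_right 0)"
    by (rule Lim_transform_eventually) (auto simp: neg_ln_def intro!: eventually_at_rightI[of 0 1])
  have "continuous_on ({0..1} - {0}) neg_ln"
  proof (rule continuous_on_eq)
    show "continuous_on ({0..1} - {0}) (\<lambda>y. ennreal (- ln y))"
      by (intro continuous_on_ennreal continuous_intros) auto
  qed (auto simp: neg_ln_def)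
  then show ?thesis
    by (rule continuous_on_extend_to_point) (use lim0 in \<open>simp add: at_within_Icc_at_right neg_ln_def\<close>)
qed

lemma measurable_neg_ln: "neg_ln \<in> borel_measurable borel"
  unfolding neg_ln_def[abs_def] by measurable

context
  fixes \<kappa> :: "ennreal measure" and \<alpha>\<^sub>0 \<alpha>inf :: real and \<mu> :: "real measure"
  assumes fin: "finite_borel_measure \<kappa>" and triple: "associated_levy_triple \<kappa> \<alpha>\<^sub>0 \<alpha>inf \<mu>"
begin

lemma triple_sets: "sets \<kappa> = sets borel" "space \<kappa> = UNIV"
  using fin sets_eq_imp_space_eq[of \<kappa> borel] by (auto simp: finite_borel_measure_def)

lemma triple_halfline: "halfline_measure \<mu>" "finite_min_moment \<mu>" "0 \<le> \<alpha>\<^sub>0" "0 \<le> \<alpha>inf"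
  using triple by (auto simp: associated_levy_triple_def levy_triple_def)

lemma triple_measurable:
  "g \<in> borel_measurable borel \<Longrightarrow> (g :: real \<Rightarrow> ennreal) \<in> borel_measurable \<mu>"
proof -
  assume g: "g \<in> borel_measurable borel"
  have "sets \<mu> = sets (restrict_space borel {0<..})" using triple_halfline by (simp add: halfline_measure_def)
  then show ?thesis using measurable_restrict_space1[OF g] measurable_cong_sets by blast
qed

lemma triple_emeasure:
  "A \<in> sets borel \<Longrightarrow> emeasure \<kappa> A = ennreal \<alpha>\<^sub>0 * indicator A 0 + ennreal \<alpha>inf * indicator A \<infinity>
        + (\<integral>\<^sup>+x. ennreal (min x 1) * indicator A (ennreal x) \<partial>\<mu>)"
  using triple by (simp add: associated_levy_triple_def)

text \<open>
  The atoms \<open>\<alpha>\<^sub>0\<close> and \<open>\<alpha>inf\<close> sit at \<open>0\<close> and \<open>\<infinity>\<close>, so on the open interval only the part coming from \<open>\<mu>\<close>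
  remains.
\<close>

lemma triple_interior:
  "density \<kappa> (indicator {0<..<\<infinity>}) = distr (density \<mu> (\<lambda>x. ennreal (min x 1))) borel ennreal"
proof (rule measure_eqI)
  show "sets (density \<kappa> (indicator {0<..<\<infinity>})) = sets (distr (density \<mu> (\<lambda>x. ennreal (min x 1))) borel ennreal)"
    by (simp add: triple_sets)
  fix A assume "A \<in> sets (density \<kappa> (indicator {0<..<\<infinity>}))"
  then have A [measurable]: "A \<in> sets borel" by (simp add: triple_sets)
  have min_meas: "(\<lambda>x. ennreal (min x 1)) \<in> borel_measurable \<mu>" by (rule triple_measurable) measurable
  have en_meas: "ennreal \<in> measurable (density \<mu> (\<lambda>x. ennreal (min x 1))) borel"
    using triple_measurable[OF measurable_ennreal] by simp
  have "emeasure (density \<kappa> (indicator {0<..<\<infinity>})) A = emeasure \<kappa> ({0<..<\<infinity>} \<inter> A)"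
  proof -
    have "indicator {0<..<\<infinity>} \<in> borel_measurable \<kappa>"
      by (intro borel_measurable_indicator) (simp add: triple_sets)
    then show ?thesis
      using A by (subst emeasure_density) (simp_all add: triple_sets indicator_inter_arith[symmetric])
  qed
  also have "\<dots> = (\<integral>\<^sup>+x. ennreal (min x 1) * indicator ({0<..<\<infinity>} \<inter> A) (ennreal x) \<partial>\<mu>)"
    by (subst triple_emeasure) auto
  also have "\<dots> = (\<integral>\<^sup>+x. ennreal (min x 1) * indicator A (ennreal x) \<partial>\<mu>)"
    by (intro nn_integral_cong) (auto simp: indicator_def halfline_space[OF triple_halfline(1,2)])
  also have "\<dots> = (\<integral>\<^sup>+x. indicator A (ennreal x) \<partial>density \<mu> (\<lambda>x. ennreal (min x 1)))"
    by (subst nn_integral_density[OF min_meas])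
       (auto intro!: triple_measurable measurable_compose[OF measurable_ennreal])
  also have "\<dots> = (\<integral>\<^sup>+x. indicator A x \<partial>distr (density \<mu> (\<lambda>x. ennreal (min x 1))) borel ennreal)"
    using A by (subst nn_integral_distr[OF en_meas]) auto
  finally show "emeasure (density \<kappa> (indicator {0<..<\<infinity>})) A = emeasure (distr (density \<mu> (\<lambda>x. ennreal (min x 1))) borel ennreal) A"
    using A by simp
qed

lemma triple_nn_integral:
  assumes g: "g \<in> borel_measurable borel"
  shows "(\<integral>\<^sup>+x. g x \<partial>\<kappa>) = ennreal \<alpha>\<^sub>0 * g 0 + ennreal \<alpha>inf * g \<infinity> + (\<integral>\<^sup>+x. ennreal (min x 1) * g (ennreal x) \<partial>\<mu>)"
proof -
  have g': "g \<in> borel_measurable \<kappa>" using g by (simp add: measurable_cong_sets[OF triple_sets(1) refl])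
  have ind: "indicator A \<in> borel_measurable \<kappa>" if "A \<in> sets borel" for A :: "ennreal set"
    using that by (intro borel_measurable_indicator) (simp add: triple_sets)
  have min_meas: "(\<lambda>x. ennreal (min x 1)) \<in> borel_measurable \<mu>" by (rule triple_measurable) measurable
  have en_meas: "ennreal \<in> measurable (density \<mu> (\<lambda>x. ennreal (min x 1))) borel"
    using triple_measurable[OF measurable_ennreal] by simp
  have pos: "x \<in> space \<mu> \<Longrightarrow> 0 < x" for x by (simp add: halfline_space[OF triple_halfline(1,2)])
  have "(\<integral>\<^sup>+x. ennreal (min x 1) * indicator {0} (ennreal x) \<partial>\<mu>) = 0"
    by (rule nn_integral_0_iff_AE[THEN iffD2]) (auto intro!: triple_measurable AE_I2 dest: pos simp: indicator_def)
  then have atom0: "emeasure \<kappa> {0} = ennreal \<alpha>\<^sub>0" by (simp add: triple_emeasure)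
  have atom_inf: "emeasure \<kappa> {\<infinity>} = ennreal \<alpha>inf" by (simp add: triple_emeasure)
  have "g x = (g 0 * indicator {0} x + g \<infinity> * indicator {\<infinity>} x) + indicator {0<..<\<infinity>} x * g x" for x
    by (cases "x = 0"; cases "x = \<infinity>") (auto simp: indicator_def less_top zero_less_iff_neq_zero)
  then have "(\<integral>\<^sup>+x. g x \<partial>\<kappa>) = (\<integral>\<^sup>+x. (g 0 * indicator {0} x + g \<infinity> * indicator {\<infinity>} x) + indicator {0<..<\<infinity>} x * g x \<partial>\<kappa>)"
    by (rule nn_integral_cong)
  also have "\<dots> = (\<integral>\<^sup>+x. g 0 * indicator {0} x + g \<infinity> * indicator {\<infinity>} x \<partial>\<kappa>) + (\<integral>\<^sup>+x. indicator {0<..<\<infinity>} x * g x \<partial>\<kappa>)"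
    using g' by (intro nn_integral_add) (auto intro!: borel_measurable_times_ennreal borel_measurable_add ind)
  also have "(\<integral>\<^sup>+x. g 0 * indicator {0} x + g \<infinity> * indicator {\<infinity>} x \<partial>\<kappa>)
      = (\<integral>\<^sup>+x. g 0 * indicator {0} x \<partial>\<kappa>) + (\<integral>\<^sup>+x. g \<infinity> * indicator {\<infinity>} x \<partial>\<kappa>)"
    by (intro nn_integral_add borel_measurable_times_ennreal ind) auto
  also have "\<dots> = g 0 * ennreal \<alpha>\<^sub>0 + g \<infinity> * ennreal \<alpha>inf"
    by (simp add: nn_integral_cmult_indicator triple_sets atom0 atom_inf[unfolded infinity_ennreal_def])
  also have "(\<integral>\<^sup>+x. indicator {0<..<\<infinity>} x * g x \<partial>\<kappa>) = (\<integral>\<^sup>+x. g x \<partial>density \<kappa> (indicator {0<..<\<infinity>}))"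
    using g' by (intro nn_integral_density[symmetric] ind) auto
  also have "\<dots> = (\<integral>\<^sup>+x. g (ennreal x) \<partial>density \<mu> (\<lambda>x. ennreal (min x 1)))"
    unfolding triple_interior using g by (intro nn_integral_distr[OF en_meas]) simp
  also have "\<dots> = (\<integral>\<^sup>+x. ennreal (min x 1) * g (ennreal x) \<partial>\<mu>)"
    by (rule nn_integral_density[OF min_meas triple_measurable[OF measurable_compose[OF measurable_ennreal g]]])
  finally show ?thesis by (simp add: mult.commute)
qed

lemma unit_interval_measure_distr: "unit_interval_measure (distr \<kappa> borel exp_neg)"
proof -
  have m: "exp_neg \<in> measurable \<kappa> borel"
    using borel_measurable_continuous_onI[OF continuous_exp_neg] by (simp add: measurable_cong_sets[OF triple_sets(1) refl])
  interpret finite_measure \<kappa> using fin by (simp add: finite_borel_measure_def)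
  have "AE y in distr \<kappa> borel exp_neg. y \<in> {0..1}"
    by (subst AE_distr_iff[OF m]) (use exp_neg_range in auto)
  then show ?thesis using finite_measure_distr[OF m] by (simp add: unit_interval_measure_def)
qed

lemma integral_distr_exp_neg:
  fixes F :: "real \<Rightarrow> real"
  assumes "F \<in> borel_measurable borel"
  shows "(\<integral>y. F y \<partial>distr \<kappa> borel exp_neg) = (\<integral>x. F (exp_neg x) \<partial>\<kappa>)"
  using assms borel_measurable_continuous_onI[OF continuous_exp_neg]
  by (intro integral_distr) (auto simp: measurable_cong_sets[OF triple_sets(1) refl])

text \<open>
  The three terms of the branching mechanism are the integrals of the kernel over the atom at \<open>0\<close>, the
  atom at \<open>\<infinity>\<close> and the rest.
\<close>

lemma branching_mechanism_eq_kernel_integral: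
  assumes "0 \<le> u"
  shows "branching_mechanism \<alpha>\<^sub>0 \<alpha>inf \<mu> u = (\<integral>y. compact_kernel u y \<partial>distr \<kappa> borel exp_neg)"
proof -
  let ?K = "compact_kernel u"
  have combine: "ennreal a * ennreal b + ennreal c * ennreal d + ennreal e = ennreal (a * b + c * d + e)"
    if "0 \<le> a" "0 \<le> b" "0 \<le> c" "0 \<le> d" "0 \<le> e" for a b c d e
    using that by (simp only: ennreal_mult ennreal_plus mult_nonneg_nonneg add_nonneg_nonneg)
  have K_nonneg: "0 \<le> ?K (exp_neg x)" for x
    using exp_neg_range by (intro compact_kernel_bounds assms)
  have K_meas: "(\<lambda>x. ?K (exp_neg x)) \<in> borel_measurable borel"
    by (rule measurable_compose[OF borel_measurable_continuous_onI[OF continuous_exp_neg] measurable_compact_kernel])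
  let ?f = "\<lambda>x. (exp (- u * x) - 1 + u * x) / x"
  have f_eq: "min x 1 * ?K (exp_neg (ennreal x)) = ?f x" if "0 < x" for x
    using compact_kernel_exp[of x u] that by (simp add: mult.commute)
  have f_nonneg: "0 \<le> ?f x" if "0 < x" for x
    unfolding f_eq[OF that, symmetric] using that by (intro mult_nonneg_nonneg K_nonneg) simp
  have f_int: "integrable \<mu> ?f"
  proof (rule integrable_halfline_bound[OF triple_halfline(1,2)])
    fix x :: real assume "0 < x"
    then have "?K (exp_neg (ennreal x)) \<le> u * (1 + u)"
      using exp_neg_range by (intro compact_kernel_bounds assms)
    then have "min x 1 * ?K (exp_neg (ennreal x)) \<le> min x 1 * (u * (1 + u))"
      using \<open>0 < x\<close> by (intro mult_left_mono) auto
    then show "\<bar>?f x\<bar> \<le> u * (1 + u) * min x 1"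
      using f_eq[OF \<open>0 < x\<close>] f_nonneg[OF \<open>0 < x\<close>] by (simp add: mult.commute)
  qed measurable
  have int_f_nonneg: "0 \<le> (\<integral>x. ?f x \<partial>\<mu>)"
    using f_nonneg by (intro Bochner_Integration.integral_nonneg) (auto simp: halfline_space[OF triple_halfline(1,2)])
  have "(\<integral>\<^sup>+x. ennreal (?K (exp_neg x)) \<partial>\<kappa>) = ennreal \<alpha>\<^sub>0 * ennreal (?K (exp_neg 0)) + ennreal \<alpha>inf * ennreal (?K (exp_neg \<infinity>))
      + (\<integral>\<^sup>+x. ennreal (min x 1) * ennreal (?K (exp_neg (ennreal x))) \<partial>\<mu>)"
    using K_meas by (intro triple_nn_integral) auto
  also have "(\<integral>\<^sup>+x. ennreal (min x 1) * ennreal (?K (exp_neg (ennreal x))) \<partial>\<mu>) = (\<integral>\<^sup>+x. ennreal (?f x) \<partial>\<mu>)"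
  proof (rule nn_integral_cong)
    fix x assume "x \<in> space \<mu>"
    then have "0 < x" by (simp add: halfline_space[OF triple_halfline(1,2)])
    then show "ennreal (min x 1) * ennreal (?K (exp_neg (ennreal x))) = ennreal (?f x)"
      unfolding f_eq[OF \<open>0 < x\<close>, symmetric] by (intro ennreal_mult[symmetric] K_nonneg) simp
  qed
  also have "\<dots> = ennreal (\<integral>x. ?f x \<partial>\<mu>)"
    using f_nonneg by (intro nn_integral_eq_integral[OF f_int] AE_I2) (simp add: halfline_space[OF triple_halfline(1,2)])
  also have "?K (exp_neg 0) = u\<^sup>2 / 2" by (simp add: exp_neg_def compact_kernel_def branching_kernel_def)
  also have "?K (exp_neg \<infinity>) = u" by (simp add: exp_neg_def compact_kernel_def)
  also have "ennreal \<alpha>\<^sub>0 * ennreal (u\<^sup>2 / 2) + ennreal \<alpha>inf * ennreal u + ennreal (\<integral>x. ?f x \<partial>\<mu>)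
      = ennreal (\<alpha>\<^sub>0 * (u\<^sup>2 / 2) + \<alpha>inf * u + (\<integral>x. ?f x \<partial>\<mu>))"
    using assms triple_halfline int_f_nonneg by (intro combine) auto
  also have "\<alpha>\<^sub>0 * (u\<^sup>2 / 2) + \<alpha>inf * u + (\<integral>x. ?f x \<partial>\<mu>) = branching_mechanism \<alpha>\<^sub>0 \<alpha>inf \<mu> u"
    by (simp add: branching_mechanism_def)
  finally have nn: "(\<integral>\<^sup>+x. ennreal (?K (exp_neg x)) \<partial>\<kappa>) = ennreal (branching_mechanism \<alpha>\<^sub>0 \<alpha>inf \<mu> u)" .
  have "0 \<le> branching_mechanism \<alpha>\<^sub>0 \<alpha>inf \<mu> u"
    using assms triple_halfline int_f_nonneg by (simp add: branching_mechanism_def)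
  then have "(\<integral>x. ?K (exp_neg x) \<partial>\<kappa>) = branching_mechanism \<alpha>\<^sub>0 \<alpha>inf \<mu> u"
    using K_nonneg K_meas nn
    by (subst integral_eq_nn_integral) (auto simp: measurable_cong_sets[OF triple_sets(1) refl])
  then show ?thesis by (simp only: integral_distr_exp_neg[OF measurable_compact_kernel])
qed

end

context scaled_offspring
begin

lemma levy_converges_imp_compactified:
  assumes conv: "levy_converges (\<lambda>k. breve_mu (\<pi> k) (h k) (\<tau> k)) \<kappa>"
    and triple: "associated_levy_triple \<kappa> \<alpha>\<^sub>0 \<alpha>inf \<mu>" and F: "unit_interval_test F"
  shows "(\<lambda>k. \<integral>y. F y \<partial>\<Lambda> k) \<longlonglongrightarrow> (\<integral>y. F y \<partial>distr \<kappa> borel exp_neg)"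
proof -
  have fin: "finite_borel_measure \<kappa>" using conv by (simp add: levy_converges_def)
  have Fm: "F \<in> borel_measurable borel" using F by (simp add: unit_interval_test_def)
  let ?g = "\<lambda>x. F (exp_neg x)"
  have g: "continuous_on UNIV ?g"
    by (rule continuous_on_compose2[OF _ continuous_exp_neg, of "{0..1}" F])
       (use F exp_neg_range in \<open>auto simp: unit_interval_test_def\<close>)
  have "(\<integral>x. ?g (ennreal x) * min x 1 \<partial>breve_mu (\<pi> k) (h k) (\<tau> k)) = (\<integral>y. F y \<partial>\<Lambda> k)" for k
    by (rule integral_breve_mu_compactified[OF h_pos \<tau>_pos borel_measurable_continuous_onI[OF g] Fm]) simp
  moreover have "(\<lambda>k. \<integral>x. ?g (ennreal x) * min x 1 \<partial>breve_mu (\<pi> k) (h k) (\<tau> k)) \<longlonglongrightarrow> (\<integral>x. ?g x \<partial>\<kappa>)"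
    using conv g unfolding levy_converges_def by blast
  ultimately show ?thesis by (simp add: integral_distr_exp_neg[OF fin triple Fm])
qed

lemma compactified_imp_levy_converges:
  assumes \<Lambda>': "unit_interval_measure \<Lambda>'"
    and conv: "\<And>F. unit_interval_test F \<Longrightarrow> (\<lambda>k. \<integral>y. F y \<partial>\<Lambda> k) \<longlonglongrightarrow> (\<integral>y. F y \<partial>\<Lambda>')"
  shows "levy_converges (\<lambda>k. breve_mu (\<pi> k) (h k) (\<tau> k)) (distr \<Lambda>' borel neg_ln)"
proof -
  interpret \<Lambda>': finite_measure \<Lambda>' using \<Lambda>' by (simp add: unit_interval_measure_def)
  have m: "neg_ln \<in> measurable \<Lambda>' borel"
    using measurable_neg_ln measurable_cong_sets[of \<Lambda>' borel borel "borel :: ennreal measure"] \<Lambda>'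
    by (simp add: unit_interval_measure_def)
  have "finite_borel_measure (distr \<Lambda>' borel neg_ln)"
    using \<Lambda>'.finite_measure_distr[OF m] by (simp add: finite_borel_measure_def)
  moreover have "(\<lambda>k. \<integral>x. g (ennreal x) * min x 1 \<partial>breve_mu (\<pi> k) (h k) (\<tau> k)) \<longlonglongrightarrow> (\<integral>x. g x \<partial>distr \<Lambda>' borel neg_ln)"
    if g: "continuous_on UNIV g" for g :: "ennreal \<Rightarrow> real"
  proof -
    have gm: "g \<in> borel_measurable borel" using g by (rule borel_measurable_continuous_onI)
    let ?F = "\<lambda>y. g (neg_ln y)"
    have Fm: "?F \<in> borel_measurable borel" by (rule measurable_compose[OF measurable_neg_ln gm])
    have "continuous_on {0..1} ?F"
      by (rule continuous_on_compose2[OF g continuous_neg_ln]) simp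
    then have "unit_interval_test ?F" using Fm by (simp add: unit_interval_test_def)
    then have "(\<lambda>k. \<integral>y. ?F y \<partial>\<Lambda> k) \<longlonglongrightarrow> (\<integral>y. ?F y \<partial>\<Lambda>')" by (rule conv)
    moreover have "(\<integral>x. g (ennreal x) * min x 1 \<partial>breve_mu (\<pi> k) (h k) (\<tau> k)) = (\<integral>y. ?F y \<partial>\<Lambda> k)" for k
      by (rule integral_breve_mu_compactified[OF h_pos \<tau>_pos gm Fm]) (simp add: neg_ln_def not_le)
    ultimately show ?thesis by (simp add: integral_distr[OF m gm])
  qed
  ultimately show ?thesis by (simp add: levy_converges_def)
qed

lemma branching_limit:
  assumes conv: "levy_converges (\<lambda>k. breve_mu (\<pi> k) (h k) (\<tau> k)) \<kappa>"
    and triple: "associated_levy_triple \<kappa> \<alpha>\<^sub>0 \<alpha>inf \<mu>"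
  obtains \<phi> where "solves_branching_ode (branching_mechanism \<alpha>\<^sub>0 \<alpha>inf \<mu>) \<phi>"
    "\<And>\<psi> q t. solves_branching_ode (branching_mechanism \<alpha>\<^sub>0 \<alpha>inf \<mu>) \<psi> \<Longrightarrow> 0 \<le> q \<Longrightarrow> 0 \<le> t \<Longrightarrow> \<psi> q t = \<phi> q t"
    "gw_phi_converges \<pi> h \<tau> \<phi>"
proof -
  have fin: "finite_borel_measure \<kappa>" using conv by (simp add: levy_converges_def)
  define N where "N = distr \<kappa> borel exp_neg"
  have N: "unit_interval_measure N" unfolding N_def by (rule unit_interval_measure_distr[OF fin triple])
  let ?P = "\<lambda>u. \<integral>y. compact_kernel u y \<partial>N"
  have ode: "solves_branching_ode (branching_mechanism \<alpha>\<^sub>0 \<alpha>inf \<mu>) \<psi> \<longleftrightarrow> solves_branching_ode ?P \<psi>" for \<psi>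
    by (rule solves_branching_ode_cong) (simp only: N_def branching_mechanism_eq_kernel_integral[OF fin triple])
  obtain \<phi> where \<phi>: "solves_branching_ode ?P \<phi>" using kernel_integral_mechanism(5)[OF N] by blast
  show ?thesis
  proof (rule that)
    show "solves_branching_ode (branching_mechanism \<alpha>\<^sub>0 \<alpha>inf \<mu>) \<phi>" using \<phi> ode by simp
    show "\<psi> q t = \<phi> q t" if "solves_branching_ode (branching_mechanism \<alpha>\<^sub>0 \<alpha>inf \<mu>) \<psi>" "0 \<le> q" "0 \<le> t" for \<psi> q t
      using that ode by (intro solves_branching_ode_unique[OF kernel_integral_mechanism(2)[OF N] \<phi>]) auto
    show "gw_phi_converges \<pi> h \<tau> \<phi>"
      by (rule gw_phi_converges_to_ode[OF N _ \<phi>])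
         (unfold N_def, rule levy_converges_imp_compactified[OF conv triple])
  qed
qed

end

theorem proposition6p4:
  fixes \<pi> :: "nat \<Rightarrow> nat pmf" and h \<tau> :: "nat \<Rightarrow> real"
  assumes mean: "\<And>k. (\<lambda>j. real j * pmf (\<pi> k) j) sums 1"
    and h_pos: "\<And>k. 0 < h k" and h_lim: "h \<longlonglongrightarrow> 0"
    and \<tau>_pos: "\<And>k. 0 < \<tau> k" and \<tau>_lim: "\<tau> \<longlonglongrightarrow> 0"
  shows
    "(\<forall>\<kappa> \<alpha>\<^sub>0 \<alpha>inf \<mu>.
        levy_converges (\<lambda>k. breve_mu (\<pi> k) (h k) (\<tau> k)) \<kappa> \<and> associated_levy_triple \<kappa> \<alpha>\<^sub>0 \<alpha>inf \<mu> \<longrightarrow>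
        (\<exists>\<phi>. solves_branching_ode (branching_mechanism \<alpha>\<^sub>0 \<alpha>inf \<mu>) \<phi> \<and>
             (\<forall>\<psi>. solves_branching_ode (branching_mechanism \<alpha>\<^sub>0 \<alpha>inf \<mu>) \<psi> \<longrightarrow>
                   (\<forall>q\<ge>0. \<forall>t\<ge>0. \<psi> q t = \<phi> q t)) \<and>
             gw_phi_converges \<pi> h \<tau> \<phi> \<and>
             (\<forall>t\<ge>0. bernstein_function (\<lambda>q. \<phi> q t)) \<and>
             (\<exists>(\<beta>\<^sub>0 :: real \<Rightarrow> real) (\<beta>inf :: real) (\<nu> :: real \<Rightarrow> real measure).
                \<beta>inf = 0 \<and>
                (\<forall>t\<ge>0. 0 \<le> \<beta>\<^sub>0 t \<and> halfline_measure (\<nu> t) \<and> finite_min_moment (\<nu> t) \<and>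
                   (\<forall>q\<ge>0. \<phi> q t = \<beta>\<^sub>0 t * q + \<beta>inf + (\<integral>x. 1 - exp (- q * x) \<partial>\<nu> t))))))
     \<and>
     (\<forall>\<phi>. gw_phi_converges \<pi> h \<tau> \<phi> \<and> (\<exists>q\<^sub>0>0. \<exists>t\<^sub>0>0. 0 < \<phi> q\<^sub>0 t\<^sub>0) \<longrightarrow>
        (\<exists>\<kappa>. levy_converges (\<lambda>k. breve_mu (\<pi> k) (h k) (\<tau> k)) \<kappa>))"
proof (intro conjI allI impI, goal_cases)
  interpret scaled_offspring \<pi> h \<tau>
    by unfold_locales (fact mean h_pos h_lim \<tau>_pos \<tau>_lim)+
  case (1 \<kappa> \<alpha>\<^sub>0 \<alpha>inf \<mu>)
  then obtain \<phi> where ode: "solves_branching_ode (branching_mechanism \<alpha>\<^sub>0 \<alpha>inf \<mu>) \<phi>"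
    and unique: "\<And>\<psi> q t. solves_branching_ode (branching_mechanism \<alpha>\<^sub>0 \<alpha>inf \<mu>) \<psi> \<Longrightarrow> 0 \<le> q \<Longrightarrow> 0 \<le> t \<Longrightarrow> \<psi> q t = \<phi> q t"
    and conv: "gw_phi_converges \<pi> h \<tau> \<phi>"
    using branching_limit by blast
  have "\<exists>p. 0 \<le> t \<longrightarrow> 0 \<le> fst p \<and> halfline_measure (snd p) \<and> finite_min_moment (snd p) \<and>
      (\<forall>q\<ge>0. \<phi> q t = fst p * q + (\<integral>x. 1 - exp (- q * x) \<partial>snd p))" for t
  proof (cases "0 \<le> t")
    case True
    show ?thesis by (rule gw_limit_representation[OF conv True]) auto
  qed auto
  then obtain p where p: "\<And>t. 0 \<le> t \<Longrightarrow> 0 \<le> fst (p t) \<and> halfline_measure (snd (p t)) \<and> finite_min_moment (snd (p t)) \<and>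
      (\<forall>q\<ge>0. \<phi> q t = fst (p t) * q + (\<integral>x. 1 - exp (- q * x) \<partial>snd (p t)))"
    by metis
  show ?case
  proof (intro exI[of _ \<phi>] conjI exI[of _ "\<lambda>t. fst (p t)"] exI[of _ 0] exI[of _ "\<lambda>t. snd (p t)"] allI impI)
    fix t :: real assume "0 \<le> t"
    show "bernstein_function (\<lambda>q. \<phi> q t)"
      using p[OF \<open>0 \<le> t\<close>] by (intro levy_khintchine_bernstein[of "snd (p t)" "fst (p t)"]) auto
    show "0 \<le> fst (p t)" "halfline_measure (snd (p t))" "finite_min_moment (snd (p t))"
      using p[OF \<open>0 \<le> t\<close>] by auto
    show "\<phi> q t = fst (p t) * q + 0 + (\<integral>x. 1 - exp (- q * x) \<partial>snd (p t))" if "0 \<le> q" for q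
      using p[OF \<open>0 \<le> t\<close>] that by simp
  qed (use ode unique conv in auto)
next
  interpret scaled_offspring \<pi> h \<tau>
    by unfold_locales (fact mean h_pos h_lim \<tau>_pos \<tau>_lim)+
  case (2 \<phi>)
  then obtain q\<^sub>0 t\<^sub>0 where "gw_phi_converges \<pi> h \<tau> \<phi>" "0 < q\<^sub>0" "0 < t\<^sub>0" "0 < \<phi> q\<^sub>0 t\<^sub>0" by blast
  then obtain N where "unit_interval_measure N"
    "\<And>F. unit_interval_test F \<Longrightarrow> (\<lambda>k. \<integral>y. F y \<partial>\<Lambda> k) \<longlonglongrightarrow> (\<integral>y. F y \<partial>N)"
    by (rule compactified_levy_converges) (rule that)
  then have "levy_converges (\<lambda>k. breve_mu (\<pi> k) (h k) (\<tau> k)) (distr N borel neg_ln)"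
    by (rule compactified_imp_levy_converges)
  then show ?case by blast
qed

end
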